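(* Let $R$ be a commutative Noetherian ring, $\mathfrak a$ a proper ideal of $R$, and $M$ a semidualizing $R$-module. Then $M$ is relative Cohen-Macaulay with respect to $\mathfrak a$ if and only if $R$ is relative Cohen-Macaulay with respect to $\mathfrak a$.
   Context: An $R$-module $M$ is semidualizing if: (i) $M$ is finitely generated; (ii) the map $R\to\operatorname{Hom}_R(M,M)$, $r\mapsto[s\mapsto rs]$, is an isomorphism; and (iii) $\operatorname{Ext}^i_R(M,M)=0$ for all $i>0$. A finitely generated $R$-module $M$ is relative Cohen-Macaulay with respect to $\mathfrak a$ if there is precisely one $i$ with $H^i_{\mathfrak a}(M)\ne0$ (local cohomology with respect to $\mathfrak a$); equivalently, $\operatorname{grade}(\mathfrak a,M)=\operatorname{cd}(\mathfrak a,M)$, where $\operatorname{cd}(\mathfrak a,M)=\sup\{i\mid H^i_{\mathfrak a}(M)\neq0\}$. *)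

theory Defs
  imports "HOL-Algebra.Module" "HOL-Algebra.Ring_Divisibility" "HOL-Algebra.Ideal_Product"
begin

section \<open>Modules and homomorphisms\<close>

text \<open>
  Modules are records of type \<open>('a, 'b) module\<close>, which extends the ring record.  The components
  \<open>mult\<close> and \<open>one\<close> play no role in the locale \<open>module\<close>; below they are filled with dummy values.
\<close>

definition regular_module :: "('a, 'r) ring_scheme \<Rightarrow> ('a, 'a) module" where
  "regular_module R =
     \<lparr>carrier = carrier R, monoid.mult = monoid.mult R, one = \<one>\<^bsub>R\<^esub>, zero = \<zero>\<^bsub>R\<^esub>, add = add R,
      smult = monoid.mult R\<rparr>"

definition mod_hom ::
  "('a, 'r) ring_scheme \<Rightarrow> ('a, 'b, 'm) module_scheme \<Rightarrow> ('a, 'c, 'n) module_scheme \<Rightarrow> ('b \<Rightarrow> 'c) set"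
  where
  "mod_hom R M N =
     {f \<in> carrier M \<rightarrow>\<^sub>E carrier N.
        (\<forall>x\<in>carrier M. \<forall>y\<in>carrier M. f (x \<oplus>\<^bsub>M\<^esub> y) = f x \<oplus>\<^bsub>N\<^esub> f y) \<and>
        (\<forall>r\<in>carrier R. \<forall>x\<in>carrier M. f (r \<odot>\<^bsub>M\<^esub> x) = r \<odot>\<^bsub>N\<^esub> f x)}"

definition Hom_module ::
  "('a, 'r) ring_scheme \<Rightarrow> ('a, 'b, 'm) module_scheme \<Rightarrow> ('a, 'c, 'n) module_scheme
     \<Rightarrow> ('a, 'b \<Rightarrow> 'c) module" where
  "Hom_module R M N =
     \<lparr>carrier = mod_hom R M N,
      monoid.mult = (\<lambda>f g. undefined), one = undefined,
      zero = (\<lambda>x\<in>carrier M. \<zero>\<^bsub>N\<^esub>),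
      add = (\<lambda>f g. \<lambda>x\<in>carrier M. f x \<oplus>\<^bsub>N\<^esub> g x),
      smult = (\<lambda>r f. \<lambda>x\<in>carrier M. r \<odot>\<^bsub>N\<^esub> f x)\<rparr>"

definition quotient_module :: "('a, 'b, 'm) module_scheme \<Rightarrow> 'b set \<Rightarrow> ('a, 'b set) module" where
  "quotient_module M N =
     \<lparr>carrier = a_rcosets\<^bsub>M\<^esub> N,
      monoid.mult = (\<lambda>A B. undefined), one = undefined,
      zero = N,
      add = set_add M,
      smult = (\<lambda>r A. \<Union>x\<in>A. N +>\<^bsub>M\<^esub> (r \<odot>\<^bsub>M\<^esub> x))\<rparr>"

definition is_zero_module :: "('a, 'b, 'm) module_scheme \<Rightarrow> bool" where
  "is_zero_module M \<longleftrightarrow> carrier M = {\<zero>\<^bsub>M\<^esub>}"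

definition submodule_generated ::
  "('a, 'r) ring_scheme \<Rightarrow> ('a, 'b, 'm) module_scheme \<Rightarrow> 'b set \<Rightarrow> 'b set" where
  "submodule_generated R M S = \<Inter>{N. submodule N R M \<and> S \<subseteq> N}"

definition finitely_generated_module ::
  "('a, 'r) ring_scheme \<Rightarrow> ('a, 'b, 'm) module_scheme \<Rightarrow> bool" where
  "finitely_generated_module R M \<longleftrightarrow>
     module R M \<and> (\<exists>S\<subseteq>carrier M. finite S \<and> submodule_generated R M S = carrier M)"


section \<open>Cohomology of cochain complexes\<close>

text \<open>A complex \<open>C 0 \<rightarrow> C 1 \<rightarrow> C 2 \<rightarrow> \<dots>\<close> has differentials \<open>d i\<close> from \<open>C i\<close> to \<open>C (Suc i)\<close>.\<close>

definition coboundaries :: "(nat \<Rightarrow> ('a, 'b) module) \<Rightarrow> (nat \<Rightarrow> 'b \<Rightarrow> 'b) \<Rightarrow> nat \<Rightarrow> 'b set" where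
  "coboundaries C d i =
     (case i of 0 \<Rightarrow> {\<zero>\<^bsub>C 0\<^esub>} | Suc j \<Rightarrow> d j ` carrier (C j))"

definition cohomology ::
  "(nat \<Rightarrow> ('a, 'b) module) \<Rightarrow> (nat \<Rightarrow> 'b \<Rightarrow> 'b) \<Rightarrow> nat \<Rightarrow> ('a, 'b set) module" where
  "cohomology C d i =
     quotient_module ((C i)\<lparr>carrier := a_kernel (C i) (C (Suc i)) (d i)\<rparr>) (coboundaries C d i)"


section \<open>Injective resolutions\<close>

text \<open>
  The test modules \<open>A\<close>, \<open>B\<close> range over the modules whose elements have the same type as those of
  \<open>E\<close>.  If this type is infinite and at least as large as \<open>R\<close>, then it contains copies of \<open>R\<close> and
  its ideals, so by Baer's criterion \<open>E\<close> has the extension property for modules on every type.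
\<close>

definition injective_module :: "('a, 'r) ring_scheme \<Rightarrow> ('a, 'c) module \<Rightarrow> bool" where
  "injective_module R E \<longleftrightarrow>
     module R E \<and>
     (\<forall>(A :: ('a, 'c) module) (B :: ('a, 'c) module).
        \<forall>j\<in>mod_hom R A B. \<forall>f\<in>mod_hom R A E.
          module R A \<longrightarrow> module R B \<longrightarrow> inj_on j (carrier A) \<longrightarrow>
          (\<exists>g\<in>mod_hom R B E. \<forall>x\<in>carrier A. g (j x) = f x))"

definition injective_resolution ::
  "('a, 'r) ring_scheme \<Rightarrow> ('a, 'b, 'm) module_scheme
     \<Rightarrow> (nat \<Rightarrow> ('a, 'c) module) \<Rightarrow> (nat \<Rightarrow> 'c \<Rightarrow> 'c) \<Rightarrow> bool" where
  "injective_resolution R M E d \<longleftrightarrow>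
     (\<forall>i. injective_module R (E i)) \<and>
     (\<forall>i. d i \<in> mod_hom R (E i) (E (Suc i))) \<and>
     (\<exists>\<epsilon>\<in>mod_hom R M (E 0). inj_on \<epsilon> (carrier M) \<and>
        \<epsilon> ` carrier M = a_kernel (E 0) (E 1) (d 0)) \<and>
     (\<forall>i. d i ` carrier (E i) = a_kernel (E (Suc i)) (E (Suc (Suc i))) (d (Suc i)))"

text \<open>
  HOL does not allow the elements of a resolution to range over all types, so one type \<open>X\<close> large
  enough for every module \<open>M :: ('a, 'b) module\<close> over a ring \<open>R\<close> on \<open>'a\<close> is fixed.  It satisfies
  \<open>|'a| \<le> |X|\<close>, \<open>|'b| \<le> |X|\<close>, \<open>\<aleph>\<^sub>0 \<le> |X|\<close> and \<open>|X|\<close> to the power \<open>|'a|\<close> equals \<open>|X|\<close>.  Hence every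
  module with at most \<open>|X|\<close> elements embeds into an injective module with at most \<open>|X|\<close> elements
  (adjoin solutions to all extension problems \<open>I \<rightarrow> N\<close>, \<open>I\<close> an ideal, and iterate along a regular
  cardinal of size at most \<open>|X|\<close> above the size of every ideal; for Noetherian \<open>R\<close> countably many
  steps suffice), the quotient again has at most \<open>|X|\<close> elements, and so injective resolutions on
  \<open>X\<close> exist.
\<close>

type_synonym ('a, 'b) resolution_universe = "'a \<times> nat \<Rightarrow> 'b + bool"

definition chosen_injective_resolution ::
  "('a, 'r) ring_scheme \<Rightarrow> ('a, 'b, 'm) module_scheme
     \<Rightarrow> (nat \<Rightarrow> ('a, ('a, 'b) resolution_universe) module) \<times>
        (nat \<Rightarrow> ('a, 'b) resolution_universe \<Rightarrow> ('a, 'b) resolution_universe)" where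
  "chosen_injective_resolution R M = (SOME (E, d). injective_resolution R M E d)"


section \<open>Ext and local cohomology as right derived functors\<close>

definition Ext_module ::
  "('a, 'r) ring_scheme \<Rightarrow> nat \<Rightarrow> ('a, 'b, 'm) module_scheme \<Rightarrow> ('a, 'c, 'n) module_scheme
     \<Rightarrow> ('a, ('b \<Rightarrow> ('a, 'c) resolution_universe) set) module" where
  "Ext_module R i M N =
     (let (E, d) = chosen_injective_resolution R N in
      cohomology (\<lambda>k. Hom_module R M (E k)) (\<lambda>k f. \<lambda>x\<in>carrier M. d k (f x)) i)"

definition torsion_module ::
  "('a, 'r) ring_scheme \<Rightarrow> 'a set \<Rightarrow> ('a, 'b) module \<Rightarrow> ('a, 'b) module" where
  "torsion_module R \<aa> M =
     M\<lparr>carrier := {x \<in> carrier M. \<exists>n::nat. \<forall>r \<in> \<aa> [^]\<^bsub>ideals_set R\<^esub> n. r \<odot>\<^bsub>M\<^esub> x = \<zero>\<^bsub>M\<^esub>}\<rparr>"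

definition local_cohomology ::
  "('a, 'r) ring_scheme \<Rightarrow> 'a set \<Rightarrow> nat \<Rightarrow> ('a, 'b, 'm) module_scheme
     \<Rightarrow> ('a, ('a, 'b) resolution_universe set) module" where
  "local_cohomology R \<aa> i M =
     (let (E, d) = chosen_injective_resolution R M in
      cohomology (\<lambda>k. torsion_module R \<aa> (E k)) d i)"


section \<open>Semidualizing and relative Cohen-Macaulay modules\<close>

definition semidualizing :: "('a, 'r) ring_scheme \<Rightarrow> ('a, 'b, 'm) module_scheme \<Rightarrow> bool" where
  "semidualizing R M \<longleftrightarrow>
     finitely_generated_module R M \<and>
     (let homothety = (\<lambda>r\<in>carrier R. \<lambda>s\<in>carrier M. r \<odot>\<^bsub>M\<^esub> s) in
        homothety \<in> mod_hom R (regular_module R) (Hom_module R M M) \<and>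
        bij_betw homothety (carrier R) (carrier (Hom_module R M M))) \<and>
     (\<forall>i>0. is_zero_module (Ext_module R i M M))"

definition relative_Cohen_Macaulay ::
  "('a, 'r) ring_scheme \<Rightarrow> 'a set \<Rightarrow> ('a, 'b, 'm) module_scheme \<Rightarrow> bool" where
  "relative_Cohen_Macaulay R \<aa> M \<longleftrightarrow>
     finitely_generated_module R M \<and> (\<exists>!i. \<not> is_zero_module (local_cohomology R \<aa> i M))"

end

theory Submission
  imports Defs "HOL-Algebra.IntRing" "HOL-Library.Countable_Set"
begin

text \<open>
  Let \<open>E\<close> be an injective resolution of the semidualizing module \<open>M\<close>.  The complex \<open>Hom(M, E)\<close> is a
  resolution of \<open>Hom(M, M) = R\<close>, and its terms are acyclic for the torsion functor \<open>\<Gamma>\<close> of \<open>\<aa>\<close>; hence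
  \<open>Hom(M, \<Gamma> E)\<close> computes the local cohomology of \<open>R\<close>.  If \<open>\<Gamma> E\<close> is exact below degree \<open>g\<close>, then it
  splits there because its terms are injective, so \<open>Hom(M, \<Gamma> E)\<close> is exact below \<open>g\<close> too, and its
  cohomology in degree \<open>g\<close> is \<open>Hom(M, H)\<close> for the cohomology \<open>H\<close> of \<open>\<Gamma> E\<close> in that degree.  This is nonzero if
  \<open>H\<close> is, since a finitely generated faithful module has a nonzero homomorphism to \<open>R/p\<close> for every
  prime \<open>p\<close>.  So the lowest nonvanishing degrees of \<open>M\<close> and \<open>R\<close> agree.

  The highest ones agree as well: local cohomology vanishes above the number of generators of \<open>\<aa>\<close>, so
  by descending induction the functor in the top degree in question is right exact on finitely
  generated modules.  If it kills \<open>R\<close>, it kills every finitely generated module.  If it kills \<open>M\<close> but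
  not \<open>R\<close>, an ideal \<open>p\<close> maximal among those whose quotient \<open>R/p\<close> it does not kill is prime, and the
  image of a nonzero homomorphism from \<open>M\<close> to \<open>R/p\<close> yields a contradiction.

  Injective modules are treated through Baer's criterion, which does not depend on the type of the
  elements of the test modules; this allows resolutions on different types to be compared.
\<close>

text \<open>Ext and local cohomology are defined through a resolution picked by the choice operator
  on one fixed type. The choice is meaningful only if a resolution exists on that very type, so
  existence must come with a bound on size: the injective modules are coinduced from divisible
  abelian groups, and their elements are coded in the resolution type. The modules to be compared
  (\<open>M\<close>, \<open>R\<close>, ideals, quotients, Hom modules) live on many types, and so do
  their cohomology modules. Hence only the vanishing of cohomology is tracked, a predicate that
  makes sense on every type, and long exact sequences become implications between vanishing
  statements. The Noetherian hypothesis makes torsion preserve injectivity: a map from an ideal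
  \<open>I\<close> into the \<open>x\<close>-torsion is killed by one power \<open>x^n\<close>, and
  for large \<open>k\<close> the intersection of \<open>I\<close> with \<open>x^k R\<close> lies in
  \<open>x^n I\<close>, so the map extends by zero to \<open>I + x^k R\<close>. The acyclicity of
  Hom(M, E) rests on this, after a reduction to cyclic modules.\<close>

definition mhom ::
  "('a, 'r) ring_scheme \<Rightarrow> ('a, 'b, 'm) module_scheme \<Rightarrow> ('a, 'c, 'n) module_scheme \<Rightarrow> ('b \<Rightarrow> 'c) \<Rightarrow> bool"
  where
  "mhom R A B f \<longleftrightarrow>
     (\<forall>x\<in>carrier A. f x \<in> carrier B) \<and>
     (\<forall>x\<in>carrier A. \<forall>y\<in>carrier A. f (x \<oplus>\<^bsub>A\<^esub> y) = f x \<oplus>\<^bsub>B\<^esub> f y) \<and>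
     (\<forall>r\<in>carrier R. \<forall>x\<in>carrier A. f (r \<odot>\<^bsub>A\<^esub> x) = r \<odot>\<^bsub>B\<^esub> f x)"

lemma mhomI:
  assumes "\<And>x. x \<in> carrier A \<Longrightarrow> f x \<in> carrier B"
    and "\<And>x y. x \<in> carrier A \<Longrightarrow> y \<in> carrier A \<Longrightarrow> f (x \<oplus>\<^bsub>A\<^esub> y) = f x \<oplus>\<^bsub>B\<^esub> f y"
    and "\<And>r x. r \<in> carrier R \<Longrightarrow> x \<in> carrier A \<Longrightarrow> f (r \<odot>\<^bsub>A\<^esub> x) = r \<odot>\<^bsub>B\<^esub> f x"
  shows "mhom R A B f"
  using assms by (simp add: mhom_def)

lemma mhom_closed: "mhom R A B f \<Longrightarrow> x \<in> carrier A \<Longrightarrow> f x \<in> carrier B"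
  and mhom_add: "mhom R A B f \<Longrightarrow> x \<in> carrier A \<Longrightarrow> y \<in> carrier A \<Longrightarrow> f (x \<oplus>\<^bsub>A\<^esub> y) = f x \<oplus>\<^bsub>B\<^esub> f y"
  and mhom_smult: "mhom R A B f \<Longrightarrow> r \<in> carrier R \<Longrightarrow> x \<in> carrier A \<Longrightarrow> f (r \<odot>\<^bsub>A\<^esub> x) = r \<odot>\<^bsub>B\<^esub> f x"
  by (simp_all add: mhom_def)

lemma mhom_compose: "mhom R A B f \<Longrightarrow> mhom R B C g \<Longrightarrow> mhom R A C (\<lambda>x. g (f x))"
  by (simp add: mhom_def)

section \<open>Modules over a commutative ring\<close>

context cring
begin

text \<open>With \<open>module R M\<close> as a premise instead of a locale context, these rules let
  the simplifier handle several modules over \<open>R\<close> at once.\<close>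

lemma module_rules:
  assumes "module R M"
  shows mod_add_closed [simp]: "x \<in> carrier M \<Longrightarrow> y \<in> carrier M \<Longrightarrow> x \<oplus>\<^bsub>M\<^esub> y \<in> carrier M"
    and mod_zero_closed [simp]: "\<zero>\<^bsub>M\<^esub> \<in> carrier M"
    and mod_neg_closed [simp]: "x \<in> carrier M \<Longrightarrow> \<ominus>\<^bsub>M\<^esub> x \<in> carrier M"
    and mod_minus_closed [simp]: "x \<in> carrier M \<Longrightarrow> y \<in> carrier M \<Longrightarrow> x \<ominus>\<^bsub>M\<^esub> y \<in> carrier M"
    and mod_smult_closed [simp]: "r \<in> carrier R \<Longrightarrow> x \<in> carrier M \<Longrightarrow> r \<odot>\<^bsub>M\<^esub> x \<in> carrier M"
    and mod_l_zero [simp]: "x \<in> carrier M \<Longrightarrow> \<zero>\<^bsub>M\<^esub> \<oplus>\<^bsub>M\<^esub> x = x"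
    and mod_r_zero [simp]: "x \<in> carrier M \<Longrightarrow> x \<oplus>\<^bsub>M\<^esub> \<zero>\<^bsub>M\<^esub> = x"
    and mod_one [simp]: "x \<in> carrier M \<Longrightarrow> \<one> \<odot>\<^bsub>M\<^esub> x = x"
    and mod_l_null [simp]: "x \<in> carrier M \<Longrightarrow> \<zero> \<odot>\<^bsub>M\<^esub> x = \<zero>\<^bsub>M\<^esub>"
    and mod_r_null [simp]: "r \<in> carrier R \<Longrightarrow> r \<odot>\<^bsub>M\<^esub> \<zero>\<^bsub>M\<^esub> = \<zero>\<^bsub>M\<^esub>"
    and mod_neg_zero [simp]: "\<ominus>\<^bsub>M\<^esub> \<zero>\<^bsub>M\<^esub> = \<zero>\<^bsub>M\<^esub>"
    and mod_neg_neg [simp]: "x \<in> carrier M \<Longrightarrow> \<ominus>\<^bsub>M\<^esub> (\<ominus>\<^bsub>M\<^esub> x) = x"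
    and mod_r_neg [simp]: "x \<in> carrier M \<Longrightarrow> x \<oplus>\<^bsub>M\<^esub> \<ominus>\<^bsub>M\<^esub> x = \<zero>\<^bsub>M\<^esub>"
    and mod_l_neg [simp]: "x \<in> carrier M \<Longrightarrow> \<ominus>\<^bsub>M\<^esub> x \<oplus>\<^bsub>M\<^esub> x = \<zero>\<^bsub>M\<^esub>"
    and mod_r_neg1 [simp]: "x \<in> carrier M \<Longrightarrow> y \<in> carrier M \<Longrightarrow> \<ominus>\<^bsub>M\<^esub> x \<oplus>\<^bsub>M\<^esub> (x \<oplus>\<^bsub>M\<^esub> y) = y"
    and mod_r_neg2 [simp]: "x \<in> carrier M \<Longrightarrow> y \<in> carrier M \<Longrightarrow> x \<oplus>\<^bsub>M\<^esub> (\<ominus>\<^bsub>M\<^esub> x \<oplus>\<^bsub>M\<^esub> y) = y"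
    and mod_minus_self [simp]: "x \<in> carrier M \<Longrightarrow> x \<ominus>\<^bsub>M\<^esub> x = \<zero>\<^bsub>M\<^esub>"
    and mod_assoc: "x \<in> carrier M \<Longrightarrow> y \<in> carrier M \<Longrightarrow> z \<in> carrier M \<Longrightarrow> (x \<oplus>\<^bsub>M\<^esub> y) \<oplus>\<^bsub>M\<^esub> z = x \<oplus>\<^bsub>M\<^esub> (y \<oplus>\<^bsub>M\<^esub> z)"
    and mod_comm: "x \<in> carrier M \<Longrightarrow> y \<in> carrier M \<Longrightarrow> x \<oplus>\<^bsub>M\<^esub> y = y \<oplus>\<^bsub>M\<^esub> x"
    and mod_lcomm: "x \<in> carrier M \<Longrightarrow> y \<in> carrier M \<Longrightarrow> z \<in> carrier M \<Longrightarrow> x \<oplus>\<^bsub>M\<^esub> (y \<oplus>\<^bsub>M\<^esub> z) = y \<oplus>\<^bsub>M\<^esub> (x \<oplus>\<^bsub>M\<^esub> z)"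
    and mod_neg_add: "x \<in> carrier M \<Longrightarrow> y \<in> carrier M \<Longrightarrow> \<ominus>\<^bsub>M\<^esub> (x \<oplus>\<^bsub>M\<^esub> y) = \<ominus>\<^bsub>M\<^esub> x \<oplus>\<^bsub>M\<^esub> \<ominus>\<^bsub>M\<^esub> y"
    and mod_minus_eq: "x \<in> carrier M \<Longrightarrow> y \<in> carrier M \<Longrightarrow> x \<ominus>\<^bsub>M\<^esub> y = x \<oplus>\<^bsub>M\<^esub> \<ominus>\<^bsub>M\<^esub> y"
    and mod_l_distr: "r \<in> carrier R \<Longrightarrow> s \<in> carrier R \<Longrightarrow> x \<in> carrier M \<Longrightarrow> (r \<oplus> s) \<odot>\<^bsub>M\<^esub> x = r \<odot>\<^bsub>M\<^esub> x \<oplus>\<^bsub>M\<^esub> s \<odot>\<^bsub>M\<^esub> x"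
    and mod_r_distr: "r \<in> carrier R \<Longrightarrow> x \<in> carrier M \<Longrightarrow> y \<in> carrier M \<Longrightarrow> r \<odot>\<^bsub>M\<^esub> (x \<oplus>\<^bsub>M\<^esub> y) = r \<odot>\<^bsub>M\<^esub> x \<oplus>\<^bsub>M\<^esub> r \<odot>\<^bsub>M\<^esub> y"
    and mod_smult_assoc: "r \<in> carrier R \<Longrightarrow> s \<in> carrier R \<Longrightarrow> x \<in> carrier M \<Longrightarrow> (r \<otimes> s) \<odot>\<^bsub>M\<^esub> x = r \<odot>\<^bsub>M\<^esub> (s \<odot>\<^bsub>M\<^esub> x)"
    and mod_r_neg_smult: "r \<in> carrier R \<Longrightarrow> x \<in> carrier M \<Longrightarrow> r \<odot>\<^bsub>M\<^esub> (\<ominus>\<^bsub>M\<^esub> x) = \<ominus>\<^bsub>M\<^esub> (r \<odot>\<^bsub>M\<^esub> x)"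
    and mod_l_neg_smult: "r \<in> carrier R \<Longrightarrow> x \<in> carrier M \<Longrightarrow> (\<ominus> r) \<odot>\<^bsub>M\<^esub> x = \<ominus>\<^bsub>M\<^esub> (r \<odot>\<^bsub>M\<^esub> x)"
    and mod_minus_eq_zero: "x \<in> carrier M \<Longrightarrow> y \<in> carrier M \<Longrightarrow> x \<ominus>\<^bsub>M\<^esub> y = \<zero>\<^bsub>M\<^esub> \<longleftrightarrow> x = y"
    and mod_add_cancel: "x \<in> carrier M \<Longrightarrow> y \<in> carrier M \<Longrightarrow> z \<in> carrier M \<Longrightarrow> x \<oplus>\<^bsub>M\<^esub> y = x \<oplus>\<^bsub>M\<^esub> z \<longleftrightarrow> y = z"
    and mod_neg_unique: "x \<in> carrier M \<Longrightarrow> y \<in> carrier M \<Longrightarrow> x \<oplus>\<^bsub>M\<^esub> y = \<zero>\<^bsub>M\<^esub> \<longleftrightarrow> y = \<ominus>\<^bsub>M\<^esub> x"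
    and mod_abelian_group: "abelian_group M"
proof -
  interpret M: module R M by fact
  show "x \<in> carrier M \<Longrightarrow> y \<in> carrier M \<Longrightarrow> x \<ominus>\<^bsub>M\<^esub> y = \<zero>\<^bsub>M\<^esub> \<longleftrightarrow> x = y"
    by (metis M.M.add.inv_closed M.M.add.inv_equality M.M.minus_minus M.M.r_neg a_minus_def)
  show "x \<in> carrier M \<Longrightarrow> y \<in> carrier M \<Longrightarrow> x \<oplus>\<^bsub>M\<^esub> y = \<zero>\<^bsub>M\<^esub> \<longleftrightarrow> y = \<ominus>\<^bsub>M\<^esub> x"
    using M.M.minus_equality[of y x] M.M.a_comm[of x y] M.M.r_neg[of x] by auto
  show "x \<in> carrier M \<Longrightarrow> y \<in> carrier M \<Longrightarrow> z \<in> carrier M \<Longrightarrow> x \<oplus>\<^bsub>M\<^esub> y = x \<oplus>\<^bsub>M\<^esub> z \<longleftrightarrow> y = z"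
    by simp
  show "abelian_group M" by (rule module.axioms(2)[OF assms])
  show "x \<in> carrier M \<Longrightarrow> y \<in> carrier M \<Longrightarrow> x \<oplus>\<^bsub>M\<^esub> y = y \<oplus>\<^bsub>M\<^esub> x"
    by (rule M.M.a_comm)
  show "x \<in> carrier M \<Longrightarrow> y \<in> carrier M \<Longrightarrow> z \<in> carrier M \<Longrightarrow> x \<oplus>\<^bsub>M\<^esub> (y \<oplus>\<^bsub>M\<^esub> z) = y \<oplus>\<^bsub>M\<^esub> (x \<oplus>\<^bsub>M\<^esub> z)"
    by (rule M.M.a_lcomm)
qed (simp_all add: module.smult_l_distr[OF assms] module.smult_r_distr[OF assms]
    module.smult_assoc1[OF assms] module.smult_l_minus[OF assms] module.smult_r_minus[OF assms]
    module.smult_l_null[OF assms] module.smult_r_null[OF assms] module.smult_one[OF assms]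
    abelian_group.r_neg1[OF module.axioms(2)[OF assms]] 
    abelian_group.r_neg2[OF module.axioms(2)[OF assms]]
    abelian_group.r_neg[OF module.axioms(2)[OF assms]]
    abelian_group.l_neg[OF module.axioms(2)[OF assms]]
    abelian_group.minus_add[OF module.axioms(2)[OF assms]]
    abelian_group.minus_minus[OF module.axioms(2)[OF assms]]
    abelian_group.minus_closed[OF module.axioms(2)[OF assms]]
    abelian_group.a_inv_closed[OF module.axioms(2)[OF assms]]
    abelian_group.minus_equality[OF module.axioms(2)[OF assms]]
    abelian_monoid.zero_closed[OF abelian_group.axioms(1)[OF module.axioms(2)[OF assms]]]
    abelian_monoid.a_closed[OF abelian_group.axioms(1)[OF module.axioms(2)[OF assms]]]
    abelian_monoid.l_zero[OF abelian_group.axioms(1)[OF module.axioms(2)[OF assms]]]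
    abelian_monoid.r_zero[OF abelian_group.axioms(1)[OF module.axioms(2)[OF assms]]]
    abelian_monoid.a_assoc[OF abelian_group.axioms(1)[OF module.axioms(2)[OF assms]]]
    module.smult_closed[OF assms] a_minus_def)

text \<open>Ordered rewriting can leave other summands between \<open>x\<close> and its negative;
  these rules cancel across up to three of them.\<close>

lemma mod_cancels:
  assumes "module R M" "x \<in> carrier M" "y \<in> carrier M"
  shows "x \<oplus>\<^bsub>M\<^esub> (y \<oplus>\<^bsub>M\<^esub> \<ominus>\<^bsub>M\<^esub> x) = y"
    and "z \<in> carrier M \<Longrightarrow> x \<oplus>\<^bsub>M\<^esub> (y \<oplus>\<^bsub>M\<^esub> (\<ominus>\<^bsub>M\<^esub> x \<oplus>\<^bsub>M\<^esub> z)) = y \<oplus>\<^bsub>M\<^esub> z"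
    and "z \<in> carrier M \<Longrightarrow> x \<oplus>\<^bsub>M\<^esub> (y \<oplus>\<^bsub>M\<^esub> (z \<oplus>\<^bsub>M\<^esub> \<ominus>\<^bsub>M\<^esub> x)) = y \<oplus>\<^bsub>M\<^esub> z"
    and "z \<in> carrier M \<Longrightarrow> w \<in> carrier M \<Longrightarrow> x \<oplus>\<^bsub>M\<^esub> (y \<oplus>\<^bsub>M\<^esub> (z \<oplus>\<^bsub>M\<^esub> (\<ominus>\<^bsub>M\<^esub> x \<oplus>\<^bsub>M\<^esub> w))) = y \<oplus>\<^bsub>M\<^esub> (z \<oplus>\<^bsub>M\<^esub> w)"
    and "z \<in> carrier M \<Longrightarrow> w \<in> carrier M \<Longrightarrow> x \<oplus>\<^bsub>M\<^esub> (y \<oplus>\<^bsub>M\<^esub> (z \<oplus>\<^bsub>M\<^esub> (w \<oplus>\<^bsub>M\<^esub> \<ominus>\<^bsub>M\<^esub> x))) = y \<oplus>\<^bsub>M\<^esub> (z \<oplus>\<^bsub>M\<^esub> w)"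
proof -
  note [simp] = assms
  have *: "x \<oplus>\<^bsub>M\<^esub> (u \<oplus>\<^bsub>M\<^esub> \<ominus>\<^bsub>M\<^esub> x) = u" if "u \<in> carrier M" for u
    using that mod_comm[of M u "\<ominus>\<^bsub>M\<^esub> x"] by simp
  then show "x \<oplus>\<^bsub>M\<^esub> (y \<oplus>\<^bsub>M\<^esub> \<ominus>\<^bsub>M\<^esub> x) = y" by simp
  show "z \<in> carrier M \<Longrightarrow> x \<oplus>\<^bsub>M\<^esub> (y \<oplus>\<^bsub>M\<^esub> (\<ominus>\<^bsub>M\<^esub> x \<oplus>\<^bsub>M\<^esub> z)) = y \<oplus>\<^bsub>M\<^esub> z"
    using mod_lcomm[of M y "\<ominus>\<^bsub>M\<^esub> x" z] by simp
  show "z \<in> carrier M \<Longrightarrow> x \<oplus>\<^bsub>M\<^esub> (y \<oplus>\<^bsub>M\<^esub> (z \<oplus>\<^bsub>M\<^esub> \<ominus>\<^bsub>M\<^esub> x)) = y \<oplus>\<^bsub>M\<^esub> z"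
    using *[of "y \<oplus>\<^bsub>M\<^esub> z"] by (simp add: mod_assoc)
  show "z \<in> carrier M \<Longrightarrow> w \<in> carrier M \<Longrightarrow> x \<oplus>\<^bsub>M\<^esub> (y \<oplus>\<^bsub>M\<^esub> (z \<oplus>\<^bsub>M\<^esub> (\<ominus>\<^bsub>M\<^esub> x \<oplus>\<^bsub>M\<^esub> w))) = y \<oplus>\<^bsub>M\<^esub> (z \<oplus>\<^bsub>M\<^esub> w)"
    using mod_r_neg2[of M x "y \<oplus>\<^bsub>M\<^esub> (z \<oplus>\<^bsub>M\<^esub> w)"] mod_lcomm[of M z "\<ominus>\<^bsub>M\<^esub> x" w] mod_lcomm[of M y "\<ominus>\<^bsub>M\<^esub> x" "z \<oplus>\<^bsub>M\<^esub> w"] by simp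
  show "z \<in> carrier M \<Longrightarrow> w \<in> carrier M \<Longrightarrow> x \<oplus>\<^bsub>M\<^esub> (y \<oplus>\<^bsub>M\<^esub> (z \<oplus>\<^bsub>M\<^esub> (w \<oplus>\<^bsub>M\<^esub> \<ominus>\<^bsub>M\<^esub> x))) = y \<oplus>\<^bsub>M\<^esub> (z \<oplus>\<^bsub>M\<^esub> w)"
    using *[of "y \<oplus>\<^bsub>M\<^esub> (z \<oplus>\<^bsub>M\<^esub> w)"] by (simp add: mod_assoc)
qed

lemmas mod_ac = mod_assoc mod_comm mod_lcomm
lemmas mod_simps = mod_ac mod_cancels mod_neg_add mod_minus_eq mod_r_distr mod_r_neg_smult


lemma mhom_zero: "mhom R A B f \<Longrightarrow> module R A \<Longrightarrow> module R B \<Longrightarrow> f \<zero>\<^bsub>A\<^esub> = \<zero>\<^bsub>B\<^esub>"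
  using mhom_smult[of R A B f \<zero> "\<zero>\<^bsub>A\<^esub>"] mhom_closed[of R A B f "\<zero>\<^bsub>A\<^esub>"] by simp

lemma mhom_neg: "mhom R A B f \<Longrightarrow> module R A \<Longrightarrow> module R B \<Longrightarrow> x \<in> carrier A \<Longrightarrow> f (\<ominus>\<^bsub>A\<^esub> x) = \<ominus>\<^bsub>B\<^esub> f x"
  using mhom_add[of R A B f x "\<ominus>\<^bsub>A\<^esub> x"] mhom_closed[of R A B f] mhom_zero[of A B f]
    mod_neg_unique[of B "f x" "f (\<ominus>\<^bsub>A\<^esub> x)"] by simp

lemma mhom_minus: "mhom R A B f \<Longrightarrow> module R A \<Longrightarrow> module R B \<Longrightarrow> x \<in> carrier A \<Longrightarrow> y \<in> carrier A \<Longrightarrow> f (x \<ominus>\<^bsub>A\<^esub> y) = f x \<ominus>\<^bsub>B\<^esub> f y"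
  by (simp add: mod_minus_eq mhom_add mhom_neg mhom_closed)

lemma mhom_lin: "mhom R A B f \<Longrightarrow> mhom R A B g \<Longrightarrow> module R A \<Longrightarrow> module R B \<Longrightarrow> mhom R A B (\<lambda>x. f x \<oplus>\<^bsub>B\<^esub> g x)"
  and mhom_diff: "mhom R A B f \<Longrightarrow> mhom R A B g \<Longrightarrow> module R A \<Longrightarrow> module R B \<Longrightarrow> mhom R A B (\<lambda>x. f x \<ominus>\<^bsub>B\<^esub> g x)"
  and mhom_uminus: "mhom R A B f \<Longrightarrow> module R A \<Longrightarrow> module R B \<Longrightarrow> mhom R A B (\<lambda>x. \<ominus>\<^bsub>B\<^esub> f x)"
  and mhom_smult_const: "s \<in> carrier R \<Longrightarrow> mhom R A B f \<Longrightarrow> module R A \<Longrightarrow> module R B \<Longrightarrow> mhom R A B (\<lambda>x. s \<odot>\<^bsub>B\<^esub> f x)"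
  and mhom_const_zero: "module R B \<Longrightarrow> mhom R A B (\<lambda>x. \<zero>\<^bsub>B\<^esub>)"
  by (simp_all add: mhom_def mod_simps mod_smult_assoc[symmetric] m_comm)

section \<open>Submodules, kernels and images\<close>

lemma submodI:
  assumes "module R M" "S \<subseteq> carrier M" "\<zero>\<^bsub>M\<^esub> \<in> S"
    "\<And>x y. x \<in> S \<Longrightarrow> y \<in> S \<Longrightarrow> x \<oplus>\<^bsub>M\<^esub> y \<in> S" "\<And>r x. r \<in> carrier R \<Longrightarrow> x \<in> S \<Longrightarrow> r \<odot>\<^bsub>M\<^esub> x \<in> S"
  shows "submodule S R M"
proof (rule module.submoduleI)
  fix a assume "a \<in> S"
  then have "\<ominus>\<^bsub>M\<^esub> a = (\<ominus> \<one>) \<odot>\<^bsub>M\<^esub> a"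
    using assms(1,2) by (auto simp: mod_l_neg_smult subset_iff)
  then show "\<ominus>\<^bsub>M\<^esub> a \<in> S" using assms(5)[of "\<ominus> \<one>" a] \<open>a \<in> S\<close> by simp
qed (use assms in auto)

lemma submod_rules:
  assumes "module R M" "submodule S R M"
  shows submod_subset: "S \<subseteq> carrier M"
    and submod_carrier: "x \<in> S \<Longrightarrow> x \<in> carrier M"
    and submod_zero: "\<zero>\<^bsub>M\<^esub> \<in> S"
    and submod_add: "x \<in> S \<Longrightarrow> y \<in> S \<Longrightarrow> x \<oplus>\<^bsub>M\<^esub> y \<in> S"
    and submod_neg: "x \<in> S \<Longrightarrow> \<ominus>\<^bsub>M\<^esub> x \<in> S"
    and submod_minus: "x \<in> S \<Longrightarrow> y \<in> S \<Longrightarrow> x \<ominus>\<^bsub>M\<^esub> y \<in> S"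
    and submod_smult: "r \<in> carrier R \<Longrightarrow> x \<in> S \<Longrightarrow> r \<odot>\<^bsub>M\<^esub> x \<in> S"
    and submod_module: "module R (M\<lparr>carrier := S\<rparr>)"
  using module.submoduleE[OF assms] subgroup.one_closed[OF submodule.axioms(1)[OF assms(2)]]
    submodule.submodule_is_module[OF assms(2,1)]
  by (auto simp: a_minus_def)

lemma mhom_incl: "S \<subseteq> carrier M \<Longrightarrow> mhom R (M\<lparr>carrier := S\<rparr>) M (\<lambda>x. x)"
  by (auto simp: mhom_def)

lemma mhom_restrict: "mhom R A B f \<Longrightarrow> S \<subseteq> carrier A \<Longrightarrow> mhom R (A\<lparr>carrier := S\<rparr>) B f"
  by (auto simp: mhom_def subset_iff)

lemma mhom_corestrict: "mhom R A B f \<Longrightarrow> (\<And>x. x \<in> carrier A \<Longrightarrow> f x \<in> T) \<Longrightarrow> mhom R A (B\<lparr>carrier := T\<rparr>) f"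
  by (auto simp: mhom_def)

lemma mhom_codomain_mono: "mhom R A (B\<lparr>carrier := T\<rparr>) f \<Longrightarrow> T \<subseteq> carrier B \<Longrightarrow> mhom R A B f"
  by (auto simp: mhom_def)

lemma kernel_submod:
  assumes "mhom R A B f" "module R A" "module R B"
  shows "submodule {x \<in> carrier A. f x = \<zero>\<^bsub>B\<^esub>} R A"
  using assms by (intro submodI) (auto simp: mhom_zero mhom_add mhom_smult)

lemma image_submod:
  assumes "mhom R A B f" "module R A" "module R B"
  shows "submodule (f ` carrier A) R B"
proof (rule submodI)
  show "\<zero>\<^bsub>B\<^esub> \<in> f ` carrier A" using mhom_zero[OF assms] mod_zero_closed[OF assms(2)] by force
  show "x \<in> f ` carrier A \<Longrightarrow> y \<in> f ` carrier A \<Longrightarrow> x \<oplus>\<^bsub>B\<^esub> y \<in> f ` carrier A" for x y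
    using mhom_add[OF assms(1)] mod_add_closed[OF assms(2)] by (metis (no_types, lifting) image_iff)
  show "r \<in> carrier R \<Longrightarrow> x \<in> f ` carrier A \<Longrightarrow> r \<odot>\<^bsub>B\<^esub> x \<in> f ` carrier A" for r x
    using mhom_smult[OF assms(1)] mod_smult_closed[OF assms(2)] by (metis (no_types, lifting) image_iff)
qed (use assms in \<open>auto simp: mhom_closed\<close>)

lemma zero_submod: "module R M \<Longrightarrow> submodule {\<zero>\<^bsub>M\<^esub>} R M"
  by (intro submodI) auto

lemma carrier_submod: "module R M \<Longrightarrow> submodule (carrier M) R M"
  by (intro submodI) auto

lemma mod_eq_from_minus:
  assumes "module R M" "x \<in> carrier M" "y \<in> carrier M" "x \<ominus>\<^bsub>M\<^esub> y = z"
  shows "x = z \<oplus>\<^bsub>M\<^esub> y"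
  using assms by (auto simp: mod_simps)

section \<open>Ideals as modules\<close>

definition ideal_module :: "'a set \<Rightarrow> ('a, 'a) module" where
  "ideal_module I = (regular_module R)\<lparr>carrier := I\<rparr>"

lemma ideal_module_simps [simp]:
  "carrier (ideal_module I) = I" "add (ideal_module I) = add R" "zero (ideal_module I) = \<zero>"
  "smult (ideal_module I) = mult R"
  "carrier (regular_module R) = carrier R" "add (regular_module R) = add R" "zero (regular_module R) = \<zero>"
  "smult (regular_module R) = mult R"
  by (simp_all add: ideal_module_def regular_module_def)

lemma regular_module: "module R (regular_module R)"
proof (rule moduleI)
  show "abelian_group (regular_module R)"
    by (rule abelian_groupI) (auto simp: a_ac intro: l_neg)
qed (auto simp: l_distr r_distr m_ac is_cring)

lemma ideal_submodule: "ideal I R \<Longrightarrow> submodule I R (regular_module R)"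
  by (rule submodI[OF regular_module])
    (auto simp: ideal.Icarr ideal.I_l_closed additive_subgroup.zero_closed[OF ideal.axioms(1)]
      additive_subgroup.a_closed[OF ideal.axioms(1)])

lemma submodule_ideal:
  assumes "submodule I R (regular_module R)" shows "ideal I R"
proof (rule idealI)
  note S = submod_rules[OF regular_module assms, simplified]
  show "subgroup I (add_monoid R)"
  proof (rule add.subgroupI)
    fix a assume "a \<in> I"
    then show "\<ominus> a \<in> I" using S(7)[of "\<ominus> \<one>" a] S(2) by (simp add: l_minus)
  qed (use S in auto)
  fix a x assume "a \<in> I" "x \<in> carrier R"
  then show "x \<otimes> a \<in> I" "a \<otimes> x \<in> I" using S(7)[of x a] S(2) m_comm by auto
qed (rule ring_axioms)

lemma ideal_module: "ideal I R \<Longrightarrow> module R (ideal_module I)"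
  unfolding ideal_module_def by (rule submod_module[OF regular_module ideal_submodule])

lemma smult_mhom:
  assumes "module R M" "x \<in> carrier M"
  shows "mhom R (regular_module R) M (\<lambda>r. r \<odot>\<^bsub>M\<^esub> x)"
    and "ideal I R \<Longrightarrow> mhom R (ideal_module I) M (\<lambda>r. r \<odot>\<^bsub>M\<^esub> x)"
  using assms by (auto simp: mhom_def mod_l_distr mod_smult_assoc ideal.Icarr)

text \<open>For \<open>S\<close> zero this is the annihilator of \<open>x\<close>; for
  \<open>S\<close> an ideal of \<open>R\<close> it is the colon ideal
  \<open>(S : x)\<close>.\<close>

lemma annihilator_ideal:
  assumes "module R M" "submodule S R M" "x \<in> carrier M"
  shows "ideal {r \<in> carrier R. r \<odot>\<^bsub>M\<^esub> x \<in> S} R"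
  by (rule submodule_ideal, rule submodI[OF regular_module])
    (use assms in \<open>auto simp: mod_l_distr mod_smult_assoc submod_rules\<close>)

section \<open>Short exact sequences and quotient modules\<close>

definition ses ::
  "('a, 'x, 'm) module_scheme \<Rightarrow> ('a, 'y, 'n) module_scheme \<Rightarrow> ('a, 'z, 'o) module_scheme \<Rightarrow> ('x \<Rightarrow> 'y) \<Rightarrow> ('y \<Rightarrow> 'z) \<Rightarrow> bool"
  where
  "ses A B C f g \<longleftrightarrow> module R A \<and> module R B \<and> module R C \<and> mhom R A B f \<and> mhom R B C g \<and>
     inj_on f (carrier A) \<and> g ` carrier B = carrier C \<and>
     (\<forall>b\<in>carrier B. g b = \<zero>\<^bsub>C\<^esub> \<longleftrightarrow> b \<in> f ` carrier A)"

lemma mhom_inj_onI: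
  assumes "mhom R A B f" "module R A" "module R B" "\<And>x. x \<in> carrier A \<Longrightarrow> f x = \<zero>\<^bsub>B\<^esub> \<Longrightarrow> x = \<zero>\<^bsub>A\<^esub>"
  shows "inj_on f (carrier A)"
proof (rule inj_onI)
  fix x y assume xy: "x \<in> carrier A" "y \<in> carrier A" "f x = f y"
  then have "f (x \<ominus>\<^bsub>A\<^esub> y) = \<zero>\<^bsub>B\<^esub>" using assms by (simp add: mhom_minus mhom_closed)
  then show "x = y" using assms(4)[of "x \<ominus>\<^bsub>A\<^esub> y"] assms(2) xy by (simp add: mod_minus_eq_zero)
qed

lemma mhom_inj_zero:
  assumes "mhom R A B f" "module R A" "module R B" "inj_on f (carrier A)" "x \<in> carrier A"
  shows "f x = \<zero>\<^bsub>B\<^esub> \<longleftrightarrow> x = \<zero>\<^bsub>A\<^esub>"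
  using mhom_zero[OF assms(1-3)] inj_onD[OF assms(4), of x "\<zero>\<^bsub>A\<^esub>"] assms(2,5) by auto

lemma ses_kernel:
  assumes "module R B" "module R C" "mhom R B C g" "g ` carrier B = carrier C"
  shows "ses (B\<lparr>carrier := {x \<in> carrier B. g x = \<zero>\<^bsub>C\<^esub>}\<rparr>) B C (\<lambda>x. x) g"
  using assms submod_module[OF _ kernel_submod] by (auto simp: ses_def mhom_incl)

text \<open>The module axioms are equations and existence statements that pass to the image of a
  surjection compatible with the operations. This serves for quotient modules and for copies of a
  module on another type.\<close>

lemma module_of_surj:
  assumes M: "module R M" and h: "mhom R M Q p" and z: "p \<zero>\<^bsub>M\<^esub> = \<zero>\<^bsub>Q\<^esub>" and s: "p ` carrier M = carrier Q"
  shows "module R Q"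
proof -
  have ex: "\<exists>x\<in>carrier M. y = p x" if "y \<in> carrier Q" for y using that s by auto
  have add: "p x \<oplus>\<^bsub>Q\<^esub> p y = p (x \<oplus>\<^bsub>M\<^esub> y)" if "x \<in> carrier M" "y \<in> carrier M" for x y
    using mhom_add[OF h that] by simp
  have sm: "r \<odot>\<^bsub>Q\<^esub> p y = p (r \<odot>\<^bsub>M\<^esub> y)" if "r \<in> carrier R" "y \<in> carrier M" for r y
    using mhom_smult[OF h that] by simp
  have c: "p x \<in> carrier Q" if "x \<in> carrier M" for x using mhom_closed[OF h that] .
  show ?thesis
  proof (rule moduleI[OF is_cring])
    show "abelian_group Q"
    proof (rule abelian_groupI)
      show "\<zero>\<^bsub>Q\<^esub> \<in> carrier Q" using c[OF mod_zero_closed[OF M]] z by simp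
      fix x assume "x \<in> carrier Q"
      then obtain a where a: "a \<in> carrier M" "x = p a" using ex by blast
      show "\<zero>\<^bsub>Q\<^esub> \<oplus>\<^bsub>Q\<^esub> x = x" using a M by (simp add: add flip: z)
      have "p (\<ominus>\<^bsub>M\<^esub> a) \<oplus>\<^bsub>Q\<^esub> x = \<zero>\<^bsub>Q\<^esub>" using a M by (simp add: add z)
      then show "\<exists>y\<in>carrier Q. y \<oplus>\<^bsub>Q\<^esub> x = \<zero>\<^bsub>Q\<^esub>" using a M c by (metis mod_neg_closed)
      fix y assume "y \<in> carrier Q"
      then obtain b where b: "b \<in> carrier M" "y = p b" using ex by blast
      show "x \<oplus>\<^bsub>Q\<^esub> y \<in> carrier Q" using a b M by (simp add: add c)
      show "x \<oplus>\<^bsub>Q\<^esub> y = y \<oplus>\<^bsub>Q\<^esub> x" using a b M by (simp add: add mod_comm)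
      fix w assume "w \<in> carrier Q"
      then obtain d where d: "d \<in> carrier M" "w = p d" using ex by blast
      show "x \<oplus>\<^bsub>Q\<^esub> y \<oplus>\<^bsub>Q\<^esub> w = x \<oplus>\<^bsub>Q\<^esub> (y \<oplus>\<^bsub>Q\<^esub> w)" using a b d M by (simp add: add mod_assoc)
    qed
  next
    fix x assume "x \<in> carrier Q"
    then obtain a where a: "a \<in> carrier M" "x = p a" using ex by blast
    show "\<one> \<odot>\<^bsub>Q\<^esub> x = x" using a M by (simp add: sm)
  next
    fix r x assume r: "r \<in> carrier R" and "x \<in> carrier Q"
    then obtain a where a: "a \<in> carrier M" "x = p a" using ex by blast
    show "r \<odot>\<^bsub>Q\<^esub> x \<in> carrier Q" using a r M by (simp add: sm c)
    {
      fix t assume t: "t \<in> carrier R"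
      show "(r \<oplus> t) \<odot>\<^bsub>Q\<^esub> x = r \<odot>\<^bsub>Q\<^esub> x \<oplus>\<^bsub>Q\<^esub> t \<odot>\<^bsub>Q\<^esub> x"
        using a r t M by (simp add: sm add mod_l_distr)
      show "(r \<otimes> t) \<odot>\<^bsub>Q\<^esub> x = r \<odot>\<^bsub>Q\<^esub> (t \<odot>\<^bsub>Q\<^esub> x)"
        using a r t M by (simp add: sm mod_smult_assoc)
    }
    fix y assume "y \<in> carrier Q"
    then obtain b where b: "b \<in> carrier M" "y = p b" using ex by blast
    show "r \<odot>\<^bsub>Q\<^esub> (x \<oplus>\<^bsub>Q\<^esub> y) = r \<odot>\<^bsub>Q\<^esub> x \<oplus>\<^bsub>Q\<^esub> r \<odot>\<^bsub>Q\<^esub> y"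
      using a b r M by (simp add: sm add mod_r_distr)
  qed
qed

lemma mem_coset_iff:
  assumes M: "module R M" "submodule S R M" "x \<in> carrier M"
  shows "y \<in> S +>\<^bsub>M\<^esub> x \<longleftrightarrow> y \<in> carrier M \<and> y \<ominus>\<^bsub>M\<^esub> x \<in> S"
proof
  assume "y \<in> S +>\<^bsub>M\<^esub> x"
  then obtain h where "h \<in> S" "y = h \<oplus>\<^bsub>M\<^esub> x" by (auto simp: a_r_coset_def')
  then show "y \<in> carrier M \<and> y \<ominus>\<^bsub>M\<^esub> x \<in> S"
    using M submod_carrier[OF M(1,2)] by (simp add: mod_simps)
next
  assume "y \<in> carrier M \<and> y \<ominus>\<^bsub>M\<^esub> x \<in> S"
  moreover from this have "y = (y \<ominus>\<^bsub>M\<^esub> x) \<oplus>\<^bsub>M\<^esub> x" using M by (simp add: mod_simps)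
  ultimately show "y \<in> S +>\<^bsub>M\<^esub> x" by (auto simp: a_r_coset_def')
qed

lemma coset_eq_iff:
  assumes M: "module R M" "submodule S R M" "x \<in> carrier M" "y \<in> carrier M"
  shows "S +>\<^bsub>M\<^esub> x = S +>\<^bsub>M\<^esub> y \<longleftrightarrow> x \<ominus>\<^bsub>M\<^esub> y \<in> S"
proof
  assume "S +>\<^bsub>M\<^esub> x = S +>\<^bsub>M\<^esub> y"
  then have "x \<in> S +>\<^bsub>M\<^esub> y" using M by (auto simp: mem_coset_iff submod_zero[OF M(1,2)])
  then show "x \<ominus>\<^bsub>M\<^esub> y \<in> S" using M by (simp add: mem_coset_iff)
next
  assume s: "x \<ominus>\<^bsub>M\<^esub> y \<in> S"
  have 1: "z \<ominus>\<^bsub>M\<^esub> y = (z \<ominus>\<^bsub>M\<^esub> x) \<oplus>\<^bsub>M\<^esub> (x \<ominus>\<^bsub>M\<^esub> y)" "z \<ominus>\<^bsub>M\<^esub> x = (z \<ominus>\<^bsub>M\<^esub> y) \<ominus>\<^bsub>M\<^esub> (x \<ominus>\<^bsub>M\<^esub> y)" if "z \<in> carrier M" for z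
    using M that by (simp_all add: mod_simps)
  show "S +>\<^bsub>M\<^esub> x = S +>\<^bsub>M\<^esub> y"
  proof (rule Set.set_eqI)
    fix z
    have "z \<ominus>\<^bsub>M\<^esub> x \<in> S \<longleftrightarrow> z \<ominus>\<^bsub>M\<^esub> y \<in> S" if "z \<in> carrier M"
      using submod_add[OF M(1,2) _ s, of "z \<ominus>\<^bsub>M\<^esub> x"] submod_minus[OF M(1,2) _ s, of "z \<ominus>\<^bsub>M\<^esub> y"]
      unfolding 1[OF that, symmetric] by blast
    then show "z \<in> S +>\<^bsub>M\<^esub> x \<longleftrightarrow> z \<in> S +>\<^bsub>M\<^esub> y" using M by (auto simp: mem_coset_iff)
  qed
qed

lemma quotient_ses:
  assumes M: "module R M" "submodule S R M"
  shows "ses (M\<lparr>carrier := S\<rparr>) M (quotient_module M S) (\<lambda>x. x) (\<lambda>x. S +>\<^bsub>M\<^esub> x)"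
proof -
  interpret S: abelian_subgroup S M
    by (intro abelian_subgroupI3 additive_subgroup.intro submodule.axioms(1)[OF M(2)] mod_abelian_group M(1))
  let ?Q = "quotient_module M S" and ?p = "\<lambda>x. S +>\<^bsub>M\<^esub> x"
  have im: "?p ` carrier M = carrier ?Q"
    by (auto simp: quotient_module_def A_RCOSETS_def')
  have hom: "mhom R M ?Q ?p"
  proof (rule mhomI)
    fix r x assume r: "r \<in> carrier R" and x: "x \<in> carrier M"
    \<comment> \<open>Scalar multiplication on cosets is a union over all representatives; every
      member of the union is the same coset.\<close>
    have a: "S +>\<^bsub>M\<^esub> (r \<odot>\<^bsub>M\<^esub> y) = S +>\<^bsub>M\<^esub> (r \<odot>\<^bsub>M\<^esub> x)" if "y \<in> S +>\<^bsub>M\<^esub> x" for y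
    proof -
      have y: "y \<in> carrier M" "y \<ominus>\<^bsub>M\<^esub> x \<in> S" using that x M by (auto simp: mem_coset_iff)
      then have "r \<odot>\<^bsub>M\<^esub> y \<ominus>\<^bsub>M\<^esub> r \<odot>\<^bsub>M\<^esub> x = r \<odot>\<^bsub>M\<^esub> (y \<ominus>\<^bsub>M\<^esub> x)" using r x M by (simp add: mod_simps)
      then show ?thesis using y r x M submod_smult[OF M r] by (simp add: coset_eq_iff)
    qed
    have "x \<in> S +>\<^bsub>M\<^esub> x" using x M by (simp add: mem_coset_iff submod_zero[OF M])
    then have "(\<Union>y\<in>S +>\<^bsub>M\<^esub> x. S +>\<^bsub>M\<^esub> (r \<odot>\<^bsub>M\<^esub> y)) = S +>\<^bsub>M\<^esub> (r \<odot>\<^bsub>M\<^esub> x)"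
      using SUP_cong[OF refl a, where A="S +>\<^bsub>M\<^esub> x"] by (simp only: UN_constant) auto
    then show "?p (r \<odot>\<^bsub>M\<^esub> x) = r \<odot>\<^bsub>?Q\<^esub> ?p x"
      by (simp add: quotient_module_def)
  qed (use im in \<open>auto simp: quotient_module_def S.a_rcos_sum\<close>)
  have z: "?p \<zero>\<^bsub>M\<^esub> = \<zero>\<^bsub>?Q\<^esub>"
    using M by (simp add: quotient_module_def S.a_coset_add_zero submod_subset[OF M])
  have k: "?p x = \<zero>\<^bsub>?Q\<^esub> \<longleftrightarrow> x \<in> S" if "x \<in> carrier M" for x
    using coset_eq_iff[OF M that mod_zero_closed[OF M(1)]] z that M(1) by (simp add: mod_minus_eq)
  show ?thesis
    using module_of_surj[OF M(1) hom z im] hom im k submod_module[OF M] M(1) submod_subset[OF M]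
    by (auto simp: ses_def mhom_incl)
qed

section \<open>Baer's criterion and the extension of homomorphisms\<close>

text \<open>The extension of \<open>f\<close> to all of \<open>R\<close> is recorded by the image
  \<open>e\<close> of the unit.\<close>

definition baer :: "('a, 'x, 'm) module_scheme \<Rightarrow> bool" where
  "baer E \<longleftrightarrow> module R E \<and>
     (\<forall>I f. ideal I R \<longrightarrow> mhom R (ideal_module I) E f \<longrightarrow> (\<exists>e\<in>carrier E. \<forall>r\<in>I. f r = r \<odot>\<^bsub>E\<^esub> e))"

lemma baer_module: "baer E \<Longrightarrow> module R E"
  by (simp add: baer_def)

lemma baerD: "baer E \<Longrightarrow> ideal I R \<Longrightarrow> mhom R (ideal_module I) E f \<Longrightarrow> \<exists>e\<in>carrier E. \<forall>r\<in>I. f r = r \<odot>\<^bsub>E\<^esub> e"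
  by (simp add: baer_def)

text \<open>A map into \<open>A\<close> is followed by \<open>s\<close>, extended inside
  \<open>B\<close>, and brought back by \<open>p\<close>.\<close>

lemma baer_retract:
  assumes "baer B" "module R A" "mhom R A B s" "mhom R B A p" "\<And>x. x \<in> carrier A \<Longrightarrow> p (s x) = x"
  shows "baer A"
  unfolding baer_def
proof (intro conjI allI impI)
  fix I f assume I: "ideal I R" and f: "mhom R (ideal_module I) A f"
  obtain e where e: "e \<in> carrier B" "\<forall>r\<in>I. s (f r) = r \<odot>\<^bsub>B\<^esub> e"
    using baerD[OF assms(1) I mhom_compose[OF f assms(3)]] by blast
  have "f r = r \<odot>\<^bsub>A\<^esub> p e" if "r \<in> I" for r
    using assms(5)[of "f r"] e that mhom_closed[OF f] mhom_smult[OF assms(4)] ideal.Icarr[OF I] by simp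
  then show "\<exists>e\<in>carrier A. \<forall>r\<in>I. f r = r \<odot>\<^bsub>A\<^esub> e" using e mhom_closed[OF assms(4)] by blast
qed fact

text \<open>Partial homomorphisms are handled through their graphs, so that Zorn's lemma applies to
  set inclusion.\<close>

lemma baer_extend:
  fixes B :: "('a, 'y, 'n) module_scheme" and J :: "('a, 'z, 'o) module_scheme"
  assumes J: "baer J" and B: "module R B" and S: "submodule S R B" and f: "mhom R (B\<lparr>carrier := S\<rparr>) J f"
  shows "\<exists>g. mhom R B J g \<and> (\<forall>x\<in>S. g x = f x)"
proof -
  note Jm = baer_module[OF J]
  \<comment> \<open>\<open>G\<close> is the graph of a partial homomorphism extending
    \<open>f\<close>. The last clause makes it single-valued, because differences of pairs stay in
    \<open>G\<close>.\<close>
  define good where "good G \<longleftrightarrow> G \<subseteq> carrier B \<times> carrier J \<and> (\<lambda>x. (x, f x)) ` S \<subseteq> G \<and>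
    (\<forall>x y x' y'. (x, y) \<in> G \<longrightarrow> (x', y') \<in> G \<longrightarrow> (x \<oplus>\<^bsub>B\<^esub> x', y \<oplus>\<^bsub>J\<^esub> y') \<in> G) \<and>
    (\<forall>r\<in>carrier R. \<forall>x y. (x, y) \<in> G \<longrightarrow> (r \<odot>\<^bsub>B\<^esub> x, r \<odot>\<^bsub>J\<^esub> y) \<in> G) \<and>
    (\<forall>y. (\<zero>\<^bsub>B\<^esub>, y) \<in> G \<longrightarrow> y = \<zero>\<^bsub>J\<^esub>)" for G
  have f': "f x \<in> carrier J" "x \<in> carrier B" if "x \<in> S" for x
    using mhom_closed[OF f] submod_carrier[OF B S] that by auto
  have f0: "f \<zero>\<^bsub>B\<^esub> = \<zero>\<^bsub>J\<^esub>" using mhom_zero[OF f submod_module[OF B S] Jm] by simp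
  have 0: "good ((\<lambda>x. (x, f x)) ` S)"
    using f' f0 mhom_add[OF f] mhom_smult[OF f] submod_rules[OF B S]
    by (auto simp: good_def)
  have "\<exists>G\<in>Collect good. \<forall>G'\<in>Collect good. G \<subseteq> G' \<longrightarrow> G' = G"
  proof (rule subset_Zorn)
    fix C assume C: "subset.chain (Collect good) C"
    show "\<exists>U\<in>Collect good. \<forall>X\<in>C. X \<subseteq> U"
    proof (cases "C = {}")
      case False
      have ch: "\<And>X. X \<in> C \<Longrightarrow> good X" and tot: "\<And>X Y. X \<in> C \<Longrightarrow> Y \<in> C \<Longrightarrow> X \<subseteq> Y \<or> Y \<subseteq> X"
        using C by (auto simp: subset.chain_def)
      have "good (\<Union>C)"
        unfolding good_def
      proof (intro conjI allI impI ballI)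
        fix x y x' y' assume "(x, y) \<in> \<Union>C" "(x', y') \<in> \<Union>C"
        then obtain X where "X \<in> C" "(x, y) \<in> X" "(x', y') \<in> X" using tot by blast
        then show "(x \<oplus>\<^bsub>B\<^esub> x', y \<oplus>\<^bsub>J\<^esub> y') \<in> \<Union>C" using ch[of X] unfolding good_def by blast
      next
        show "\<Union>C \<subseteq> carrier B \<times> carrier J" using ch unfolding good_def by blast
        show "(\<lambda>x. (x, f x)) ` S \<subseteq> \<Union>C" using ch False unfolding good_def by blast
      qed (use ch in \<open>unfold good_def, blast+\<close>)
      then show ?thesis by blast
    qed (use 0 in blast)
  qed
  then obtain G where G: "good G" and max: "\<And>G'. good G' \<Longrightarrow> G \<subseteq> G' \<Longrightarrow> G' = G" by blast
  have Gc: "x \<in> carrier B" "y \<in> carrier J" if "(x, y) \<in> G" for x y using G that unfolding good_def by auto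
  have Gf: "(x, f x) \<in> G" if "x \<in> S" for x using G that unfolding good_def by auto
  have Ga: "(x \<oplus>\<^bsub>B\<^esub> x', y \<oplus>\<^bsub>J\<^esub> y') \<in> G" if "(x, y) \<in> G" "(x', y') \<in> G" for x x' y y'
    using G that unfolding good_def by auto
  have Gs: "(r \<odot>\<^bsub>B\<^esub> x, r \<odot>\<^bsub>J\<^esub> y) \<in> G" if "r \<in> carrier R" "(x, y) \<in> G" for r x y
    using G that unfolding good_def by auto
  have Gz: "y = \<zero>\<^bsub>J\<^esub>" if "(\<zero>\<^bsub>B\<^esub>, y) \<in> G" for y using G that unfolding good_def by auto
  have Gn: "(\<ominus>\<^bsub>B\<^esub> x, \<ominus>\<^bsub>J\<^esub> y) \<in> G" if "(x, y) \<in> G" for x y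
    using Gs[of "\<ominus> \<one>", OF _ that] Gc[OF that] B Jm by (simp add: mod_l_neg_smult)
  have Gu: "y = y'" if "(x, y) \<in> G" "(x, y') \<in> G" for x y y'
    using Gz[of "y \<oplus>\<^bsub>J\<^esub> \<ominus>\<^bsub>J\<^esub> y'"] Ga[OF that(1) Gn[OF that(2)]] Gc[OF that(1)] Gc[OF that(2)] B Jm
    by (simp add: mod_minus_eq_zero flip: mod_minus_eq)
  have G0: "(\<zero>\<^bsub>B\<^esub>, \<zero>\<^bsub>J\<^esub>) \<in> G" using Gf[OF submod_zero[OF B S]] f0 by simp
  have dom: "\<exists>y. (b, y) \<in> G" if b: "b \<in> carrier B" for b
  proof -
    \<comment> \<open>Baer's criterion is applied to the ideal of scalars \<open>r\<close> for which
      \<open>r b\<close> lies in the domain of \<open>G\<close>; the element \<open>e\<close> it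
      provides becomes the value at \<open>b\<close>.\<close>
    define I where "I = {r \<in> carrier R. \<exists>y. (r \<odot>\<^bsub>B\<^esub> b, y) \<in> G}"
    define k where "k r = (SOME y. (r \<odot>\<^bsub>B\<^esub> b, y) \<in> G)" for r
    have k: "(r \<odot>\<^bsub>B\<^esub> b, k r) \<in> G" if "r \<in> I" for r
      using that unfolding I_def k_def by (auto intro: someI)
    have I: "ideal I R"
      by (rule submodule_ideal, rule submodI[OF regular_module])
        (use b B Ga Gs G0 in \<open>auto simp: I_def mod_l_distr mod_smult_assoc, (blast | fastforce)+\<close>)
    have kh: "mhom R (ideal_module I) J k"
    proof (rule mhomI)
      fix x y assume "x \<in> carrier (ideal_module I)" "y \<in> carrier (ideal_module I)"
      then have xy: "x \<in> I" "y \<in> I" by auto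
      then have "x \<oplus> y \<in> I" using ideal.axioms(1)[OF I] additive_subgroup.a_closed by fastforce
      from Gu[OF k[OF this]] Ga[OF k[OF xy(1)] k[OF xy(2)]] xy b B ideal.Icarr[OF I]
      show "k (x \<oplus>\<^bsub>ideal_module I\<^esub> y) = k x \<oplus>\<^bsub>J\<^esub> k y" by (simp add: mod_l_distr)
    next
      fix r x assume r: "r \<in> carrier R" and "x \<in> carrier (ideal_module I)"
      then have x: "x \<in> I" by auto
      then have "r \<otimes> x \<in> I" using ideal.I_l_closed[OF I x r] by simp
      from Gu[OF k[OF this]] Gs[OF r k[OF x]] r x b B ideal.Icarr[OF I]
      show "k (r \<odot>\<^bsub>ideal_module I\<^esub> x) = r \<odot>\<^bsub>J\<^esub> k x" by (simp add: mod_smult_assoc)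
    qed (use Gc(2)[OF k] in auto)
    obtain e where e: "e \<in> carrier J" "\<And>r. r \<in> I \<Longrightarrow> k r = r \<odot>\<^bsub>J\<^esub> e"
      using baerD[OF J I kh] by blast
    define G' where "G' = {(x \<oplus>\<^bsub>B\<^esub> r \<odot>\<^bsub>B\<^esub> b, y \<oplus>\<^bsub>J\<^esub> r \<odot>\<^bsub>J\<^esub> e) | x y r. (x, y) \<in> G \<and> r \<in> carrier R}"
    have G'I: "(x \<oplus>\<^bsub>B\<^esub> r \<odot>\<^bsub>B\<^esub> b, y \<oplus>\<^bsub>J\<^esub> r \<odot>\<^bsub>J\<^esub> e) \<in> G'" if "(x, y) \<in> G" "r \<in> carrier R" for x y r
      using that unfolding G'_def by blast
    have sub: "G \<subseteq> G'"
    proof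
      fix z assume z: "z \<in> G"
      obtain x y where "z = (x, y)" by force
      with z G'I[of x y \<zero>] Gc[of x y] b B e Jm show "z \<in> G'" by simp
    qed
    have "good G'"
      unfolding good_def
    proof (intro conjI allI impI ballI)
      show "G' \<subseteq> carrier B \<times> carrier J" unfolding G'_def using Gc b B e Jm by auto
      show "(\<lambda>x. (x, f x)) ` S \<subseteq> G'" using sub Gf by auto
    next
      fix x y x' y' assume "(x, y) \<in> G'" "(x', y') \<in> G'"
      then obtain u v r u' v' r' where *: "(u, v) \<in> G" "(u', v') \<in> G" "r \<in> carrier R" "r' \<in> carrier R"
        "x = u \<oplus>\<^bsub>B\<^esub> r \<odot>\<^bsub>B\<^esub> b" "y = v \<oplus>\<^bsub>J\<^esub> r \<odot>\<^bsub>J\<^esub> e" "x' = u' \<oplus>\<^bsub>B\<^esub> r' \<odot>\<^bsub>B\<^esub> b" "y' = v' \<oplus>\<^bsub>J\<^esub> r' \<odot>\<^bsub>J\<^esub> e"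
        unfolding G'_def by blast
      have "x \<oplus>\<^bsub>B\<^esub> x' = (u \<oplus>\<^bsub>B\<^esub> u') \<oplus>\<^bsub>B\<^esub> (r \<oplus> r') \<odot>\<^bsub>B\<^esub> b" "y \<oplus>\<^bsub>J\<^esub> y' = (v \<oplus>\<^bsub>J\<^esub> v') \<oplus>\<^bsub>J\<^esub> (r \<oplus> r') \<odot>\<^bsub>J\<^esub> e"
        using * Gc[OF *(1)] Gc[OF *(2)] b B e Jm by (simp_all add: mod_l_distr mod_ac)
      then show "(x \<oplus>\<^bsub>B\<^esub> x', y \<oplus>\<^bsub>J\<^esub> y') \<in> G'" using G'I[OF Ga[OF *(1,2)], of "r \<oplus> r'"] * by simp
    next
      fix t x y assume t: "t \<in> carrier R" and "(x, y) \<in> G'"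
      then obtain u v r where *: "(u, v) \<in> G" "r \<in> carrier R"
        "x = u \<oplus>\<^bsub>B\<^esub> r \<odot>\<^bsub>B\<^esub> b" "y = v \<oplus>\<^bsub>J\<^esub> r \<odot>\<^bsub>J\<^esub> e"
        unfolding G'_def by blast
      have "t \<odot>\<^bsub>B\<^esub> x = t \<odot>\<^bsub>B\<^esub> u \<oplus>\<^bsub>B\<^esub> (t \<otimes> r) \<odot>\<^bsub>B\<^esub> b" "t \<odot>\<^bsub>J\<^esub> y = t \<odot>\<^bsub>J\<^esub> v \<oplus>\<^bsub>J\<^esub> (t \<otimes> r) \<odot>\<^bsub>J\<^esub> e"
        using * Gc[OF *(1)] t b B e Jm by (simp_all add: mod_r_distr mod_smult_assoc)
      then show "(t \<odot>\<^bsub>B\<^esub> x, t \<odot>\<^bsub>J\<^esub> y) \<in> G'" using G'I[OF Gs[OF t *(1)], of "t \<otimes> r"] * t by simp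
    next
      \<comment> \<open>Here the choice of \<open>e\<close> matters: if \<open>u + r b = 0\<close>,
        then \<open>r\<close> lies in \<open>I\<close> and \<open>r e = k r = - v\<close>.\<close>
      fix y assume "(\<zero>\<^bsub>B\<^esub>, y) \<in> G'"
      then obtain u v r where *: "(u, v) \<in> G" "r \<in> carrier R"
        "\<zero>\<^bsub>B\<^esub> = u \<oplus>\<^bsub>B\<^esub> r \<odot>\<^bsub>B\<^esub> b" "y = v \<oplus>\<^bsub>J\<^esub> r \<odot>\<^bsub>J\<^esub> e"
        unfolding G'_def by blast
      then have rb: "r \<odot>\<^bsub>B\<^esub> b = \<ominus>\<^bsub>B\<^esub> u" using mod_neg_unique[OF B, of u "r \<odot>\<^bsub>B\<^esub> b"] Gc[OF *(1)] b B by simp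
      then have rI: "r \<in> I" using Gn[OF *(1)] * unfolding I_def by auto
      have "k r = \<ominus>\<^bsub>J\<^esub> v" using Gu[OF k[OF rI]] Gn[OF *(1)] rb by simp
      then show "y = \<zero>\<^bsub>J\<^esub>" using e(2)[OF rI] * Gc[OF *(1)] Jm by simp
    qed
    then have "G' = G" using max sub by blast
    moreover have "(b, e) \<in> G'" using G'I[OF G0, of \<one>] b B e Jm by simp
    ultimately show ?thesis by auto
  qed
  define g where "g b = (SOME y. (b, y) \<in> G)" for b
  have g: "(b, g b) \<in> G" if "b \<in> carrier B" for b
    using dom[OF that] unfolding g_def by (auto intro: someI)
  have "mhom R B J g"
  proof (rule mhomI)
    fix x y assume xy: "x \<in> carrier B" "y \<in> carrier B"
    then show "g (x \<oplus>\<^bsub>B\<^esub> y) = g x \<oplus>\<^bsub>J\<^esub> g y"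
      using Gu[OF g Ga[OF g g]] B by simp
  next
    fix r x assume "r \<in> carrier R" "x \<in> carrier B"
    then show "g (r \<odot>\<^bsub>B\<^esub> x) = r \<odot>\<^bsub>J\<^esub> g x"
      using Gu[OF g Gs[OF _ g]] B by simp
  qed (use g Gc in blast)
  moreover have "g x = f x" if "x \<in> S" for x
    using Gu[OF g Gf[OF that]] f'[OF that] by simp
  ultimately show ?thesis by blast
qed

text \<open>The map \<open>u\<close> descends to the image of \<open>p\<close>, a submodule of
  \<open>C\<close>, and extends from there. An injective \<open>p\<close> gives extension along an
  embedding, a surjective one factorization through a quotient.\<close>

lemma baer_factor:
  fixes J :: "('a, 'z, 'o) module_scheme"
  assumes J: "baer J" and B: "module R B" and C: "module R C"
    and p: "mhom R B C p" and u: "mhom R B J u"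
    and ker: "\<And>x. x \<in> carrier B \<Longrightarrow> p x = \<zero>\<^bsub>C\<^esub> \<Longrightarrow> u x = \<zero>\<^bsub>J\<^esub>"
  shows "\<exists>h. mhom R C J h \<and> (\<forall>x\<in>carrier B. h (p x) = u x)"
proof -
  note Jm = baer_module[OF J]
  define q where "q y = (SOME x. x \<in> carrier B \<and> p x = y)" for y
  have q: "q y \<in> carrier B \<and> p (q y) = y" if "y \<in> p ` carrier B" for y
    unfolding q_def using that by (intro someI_ex[of "\<lambda>x. x \<in> carrier B \<and> p x = y"]) auto
  have eq: "u x = u x'" if "x \<in> carrier B" "x' \<in> carrier B" "p x = p x'" for x x'
  proof -
    have "p (x \<ominus>\<^bsub>B\<^esub> x') = \<zero>\<^bsub>C\<^esub>" using that B C p by (simp add: mhom_minus mhom_closed)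
    then have "u x \<ominus>\<^bsub>J\<^esub> u x' = \<zero>\<^bsub>J\<^esub>" using ker[of "x \<ominus>\<^bsub>B\<^esub> x'"] that B Jm u by (simp add: mhom_minus)
    then show ?thesis using that Jm u by (simp add: mod_minus_eq_zero mhom_closed)
  qed
  note S = image_submod[OF p B C]
  have uq: "u (q (p x)) = u x" if "x \<in> carrier B" for x
    using q[of "p x"] that by (intro eq) auto
  have h: "mhom R (C\<lparr>carrier := p ` carrier B\<rparr>) J (\<lambda>y. u (q y))"
  proof (rule mhomI)
    fix x y assume "x \<in> carrier (C\<lparr>carrier := p ` carrier B\<rparr>)" "y \<in> carrier (C\<lparr>carrier := p ` carrier B\<rparr>)"
    then obtain a b where "a \<in> carrier B" "b \<in> carrier B" "x = p a" "y = p b" by auto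
    then show "u (q (x \<oplus>\<^bsub>C\<lparr>carrier := p ` carrier B\<rparr>\<^esub> y)) = u (q x) \<oplus>\<^bsub>J\<^esub> u (q y)"
      using uq[of "a \<oplus>\<^bsub>B\<^esub> b"] uq[of a] uq[of b] B mhom_add[OF p] mhom_add[OF u] by simp
  next
    fix r x assume r: "r \<in> carrier R" and "x \<in> carrier (C\<lparr>carrier := p ` carrier B\<rparr>)"
    then obtain a where "a \<in> carrier B" "x = p a" by auto
    then show "u (q (r \<odot>\<^bsub>C\<lparr>carrier := p ` carrier B\<rparr>\<^esub> x)) = r \<odot>\<^bsub>J\<^esub> u (q x)"
      using uq[of "r \<odot>\<^bsub>B\<^esub> a"] uq[of a] B r mhom_smult[OF p] mhom_smult[OF u] by simp
  qed (use q mhom_closed[OF u] in auto)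
  obtain g where "mhom R C J g" "\<forall>y\<in>p ` carrier B. g y = u (q y)"
    using baer_extend[OF J C S h] by blast
  then show ?thesis using uq by auto
qed

end

section \<open>Embeddings into divisible groups\<close>

text \<open>A nonzero ideal has a least positive element, which divides every other element by
  division with remainder.\<close>

lemma int_ideal_multiples:
  assumes I: "ideal I \<Z>"
  shows "\<exists>m. I = {k * m | k. True}"
proof -
  have z: "0 \<in> I" and add: "\<And>x y. x \<in> I \<Longrightarrow> y \<in> I \<Longrightarrow> x + y \<in> I" and mul: "\<And>k x. x \<in> I \<Longrightarrow> k * x \<in> I"
    using additive_subgroup.zero_closed[OF ideal.axioms(1)[OF I]]
      additive_subgroup.a_closed[OF ideal.axioms(1)[OF I]] ideal.I_l_closed[OF I] by auto
  show ?thesis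
  proof (cases "I = {0}")
    case False
    then obtain x where x: "x \<in> I" "x \<noteq> 0" using z by blast
    have "int (nat \<bar>x\<bar>) \<in> I" using mul[OF x(1), of "sgn x"] by (simp add: sgn_if split: if_splits)
    then have ex: "\<exists>n. 0 < n \<and> int n \<in> I" using x(2) by (intro exI[of _ "nat \<bar>x\<bar>"]) auto
    define n where "n = (LEAST n. 0 < n \<and> int n \<in> I)"
    have n: "0 < n" "int n \<in> I" using LeastI_ex[OF ex] unfolding n_def by auto
    have "int n dvd r" if "r \<in> I" for r
    proof -
      have "r mod int n \<in> I"
        using add[OF that mul[OF n(2), of "- (r div int n)"]] by (simp add: minus_mult_div_eq_mod[symmetric] mult.commute)
      then have "\<not> 0 < nat (r mod int n)"
        using not_less_Least[of "nat (r mod int n)" "\<lambda>n. 0 < n \<and> int n \<in> I"] n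
        unfolding n_def[symmetric] by (auto simp: nat_less_iff)
      moreover have "r mod int n \<ge> 0" using n by simp
      ultimately have "r mod int n = 0" by linarith
      then show ?thesis by presburger
    qed
    then have "I = {k * int n | k. True}" using mul[OF n(2)] by (auto simp: dvd_def mult.commute)
    then show ?thesis by blast
  qed auto
qed

text \<open>A map on the ideal generated by \<open>m\<close> is determined by its value at
  \<open>m\<close>, so dividing this one value by \<open>m\<close> extends it.\<close>

lemma divisible_baer:
  assumes D: "module \<Z> D" and div: "\<And>m d. m \<noteq> 0 \<Longrightarrow> d \<in> carrier D \<Longrightarrow> \<exists>e\<in>carrier D. m \<odot>\<^bsub>D\<^esub> e = d"
  shows "int.baer D"
  unfolding int.baer_def
proof (intro conjI allI impI)
  fix I f assume I: "ideal I \<Z>" and f: "mhom \<Z> (int.ideal_module I) D f"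
  obtain m where m: "I = {k * m | k. True}" using int_ideal_multiples[OF I] by blast
  have mI: "m \<in> I" unfolding m by (auto intro: exI[of _ 1])
  have fm: "f m \<in> carrier D" using mhom_closed[OF f] mI by simp
  have "\<exists>e\<in>carrier D. m \<odot>\<^bsub>D\<^esub> e = f m"
  proof (cases "m = 0")
    case True
    have "f 0 = \<zero>\<^bsub>D\<^esub>" using int.mhom_zero[OF f int.ideal_module[OF I] D] by simp
    moreover have "0 \<odot>\<^bsub>D\<^esub> \<zero>\<^bsub>D\<^esub> = \<zero>\<^bsub>D\<^esub>" using D by (intro int.mod_r_null) auto
    ultimately show ?thesis using True int.mod_zero_closed[OF D] by force
  qed (use div fm in blast)
  then obtain e where e: "e \<in> carrier D" "m \<odot>\<^bsub>D\<^esub> e = f m" by blast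
  have "f r = r \<odot>\<^bsub>D\<^esub> e" if "r \<in> I" for r
  proof -
    obtain k where k: "r = k * m" using \<open>r \<in> I\<close> m by auto
    have "f r = k \<odot>\<^bsub>D\<^esub> f m" using mhom_smult[OF f, of k m] mI k by simp
    also have "\<dots> = r \<odot>\<^bsub>D\<^esub> e" using e int.mod_smult_assoc[OF D, of k m e] k by simp
    finally show ?thesis .
  qed
  then show "\<exists>e\<in>carrier D. \<forall>r\<in>I. f r = r \<odot>\<^bsub>D\<^esub> e" using e by blast
qed fact

definition zmod :: "('x, 'm) ring_scheme \<Rightarrow> (int, 'x) module" where
  "zmod G = \<lparr>carrier = carrier G, monoid.mult = (\<lambda>x y. undefined), one = undefined, zero = \<zero>\<^bsub>G\<^esub>, add = add G,
     smult = (\<lambda>n x. add_pow G n x)\<rparr>"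

lemma zmod_simps [simp]: "carrier (zmod G) = carrier G" "zero (zmod G) = zero G" "add (zmod G) = add G"
  by (simp_all add: zmod_def)

lemma zmod_module:
  assumes "abelian_group G" shows "module \<Z> (zmod G)"
proof -
  interpret G: abelian_group G by fact
  have ag: "abelian_group (zmod G)"
    by (rule abelian_groupI) (auto simp: G.a_ac intro: G.l_neg)
  show ?thesis
    by (rule moduleI[OF int_is_cring ag])
      (auto simp: zmod_def G.add.int_pow_mult G.add.int_pow_distrib G.add.int_pow_pow mult.commute)
qed

lemma zmod_mhomI:
  assumes A: "module \<Z> A" and B: "module \<Z> B"
    and cl: "\<And>x. x \<in> carrier A \<Longrightarrow> f x \<in> carrier B"
    and add: "\<And>x y. x \<in> carrier A \<Longrightarrow> y \<in> carrier A \<Longrightarrow> f (x \<oplus>\<^bsub>A\<^esub> y) = f x \<oplus>\<^bsub>B\<^esub> f y"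
  shows "mhom \<Z> A B f"
proof (rule mhomI[OF cl add])
  fix r :: int and x assume x: "x \<in> carrier A"
  note A' = int.mod_smult_closed[OF A _ x] and B' = int.mod_smult_closed[OF B _ cl[OF x]]
  have f0: "f \<zero>\<^bsub>A\<^esub> = \<zero>\<^bsub>B\<^esub>"
    using add[of "\<zero>\<^bsub>A\<^esub>" "\<zero>\<^bsub>A\<^esub>"] int.mod_add_cancel[OF B, of "f \<zero>\<^bsub>A\<^esub>" "f \<zero>\<^bsub>A\<^esub>" "\<zero>\<^bsub>B\<^esub>"] cl A B
    by simp
  have pos: "f (int n \<odot>\<^bsub>A\<^esub> x) = int n \<odot>\<^bsub>B\<^esub> f x" for n
  proof (induction n)
    case 0
    then show ?case using int.mod_l_null[OF A x] int.mod_l_null[OF B cl[OF x]] f0 by simp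
  next
    case (Suc n)
    have "int (Suc n) \<odot>\<^bsub>A\<^esub> x = int n \<odot>\<^bsub>A\<^esub> x \<oplus>\<^bsub>A\<^esub> x"
      using int.mod_l_distr[OF A, of "int n" 1 x] int.mod_one[OF A x] x by (simp add: add.commute)
    moreover have "int (Suc n) \<odot>\<^bsub>B\<^esub> f x = int n \<odot>\<^bsub>B\<^esub> f x \<oplus>\<^bsub>B\<^esub> f x"
      using int.mod_l_distr[OF B, of "int n" 1 "f x"] int.mod_one[OF B cl[OF x]] cl[OF x] by (simp add: add.commute)
    ultimately show ?case using Suc add[of "int n \<odot>\<^bsub>A\<^esub> x" x] A' x by simp
  qed
  have "f (- int n \<odot>\<^bsub>A\<^esub> x) = - int n \<odot>\<^bsub>B\<^esub> f x" for n
  proof -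
    have "(- int n) \<odot>\<^bsub>A\<^esub> x = \<ominus>\<^bsub>A\<^esub> (int n \<odot>\<^bsub>A\<^esub> x)" "(- int n) \<odot>\<^bsub>B\<^esub> f x = \<ominus>\<^bsub>B\<^esub> (int n \<odot>\<^bsub>B\<^esub> f x)"
      using int.mod_l_neg_smult[OF A, of "int n" x] int.mod_l_neg_smult[OF B, of "int n" "f x"] x cl[OF x] by auto
    moreover have "f (\<ominus>\<^bsub>A\<^esub> (int n \<odot>\<^bsub>A\<^esub> x)) = \<ominus>\<^bsub>B\<^esub> f (int n \<odot>\<^bsub>A\<^esub> x)"
      using int.mod_neg_unique[OF B, of "f (int n \<odot>\<^bsub>A\<^esub> x)" "f (\<ominus>\<^bsub>A\<^esub> (int n \<odot>\<^bsub>A\<^esub> x))"]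
        add[of "int n \<odot>\<^bsub>A\<^esub> x" "\<ominus>\<^bsub>A\<^esub> (int n \<odot>\<^bsub>A\<^esub> x)"] f0 A' cl A int.mod_neg_closed[OF A] int.mod_r_neg[OF A]
      by simp
    ultimately show ?thesis using pos by simp
  qed
  then show "f (r \<odot>\<^bsub>A\<^esub> x) = r \<odot>\<^bsub>B\<^esub> f x"
    by (cases r rule: int_cases2) (use pos in auto)
qed

text \<open>The rational vector space whose basis is the type \<open>'x\<close>, regarded as an
  abelian group.\<close>

definition fin_rat :: "(int, 'x \<Rightarrow> rat) module" where
  "fin_rat = \<lparr>carrier = {v. finite {x. v x \<noteq> 0}}, monoid.mult = (\<lambda>x y. undefined), one = undefined, zero = (\<lambda>x. 0),
     add = (\<lambda>f g x. f x + g x), smult = (\<lambda>n f x. of_int n * f x)\<rparr>"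

text \<open>The free abelian group on \<open>B\<close>.\<close>

definition fin_int :: "'x set \<Rightarrow> (int, 'x \<Rightarrow> int) module" where
  "fin_int B = \<lparr>carrier = {v. finite {x. v x \<noteq> 0} \<and> {x. v x \<noteq> 0} \<subseteq> B}, monoid.mult = (\<lambda>x y. undefined), one = undefined, zero = (\<lambda>x. 0),
     add = (\<lambda>f g x. f x + g x), smult = (\<lambda>n f x. n * f x)\<rparr>"

lemma finite_support_add:
  fixes f g :: "'x \<Rightarrow> 'y::comm_monoid_add"
  assumes "finite {x. f x \<noteq> 0}" "finite {x. g x \<noteq> 0}"
  shows "finite {x. f x + g x \<noteq> 0}"
  by (rule finite_subset[OF _ finite_UnI[OF assms]]) auto

lemma finite_support_mult:
  fixes f :: "'x \<Rightarrow> 'y::mult_zero"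
  assumes "finite {x. f x \<noteq> 0}"
  shows "finite {x. c * f x \<noteq> 0}"
  by (rule finite_subset[OF _ assms]) auto

lemma fin_rat_module: "module \<Z> (fin_rat :: (int, 'x \<Rightarrow> rat) module)"
proof (rule moduleI[OF int_is_cring])
  show "abelian_group (fin_rat :: (int, 'x \<Rightarrow> rat) module)"
  proof (rule abelian_groupI)
    fix v :: "'x \<Rightarrow> rat" assume "v \<in> carrier fin_rat"
    then show "\<exists>y\<in>carrier fin_rat. y \<oplus>\<^bsub>fin_rat\<^esub> v = \<zero>\<^bsub>fin_rat\<^esub>"
      by (intro bexI[of _ "\<lambda>x. - v x"]) (auto simp: fin_rat_def)
  qed (auto simp: fin_rat_def finite_support_add)
qed (auto simp: fin_rat_def ring_distribs mult.assoc simp del: mult_eq_0_iff intro!: finite_support_mult)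

lemma fin_int_module: "module \<Z> (fin_int B)"
proof (rule moduleI[OF int_is_cring])
  show "abelian_group (fin_int B)"
  proof (rule abelian_groupI)
    fix v assume "v \<in> carrier (fin_int B)"
    then show "\<exists>y\<in>carrier (fin_int B). y \<oplus>\<^bsub>fin_int B\<^esub> v = \<zero>\<^bsub>fin_int B\<^esub>"
      by (intro bexI[of _ "\<lambda>x. - v x"]) (auto simp: fin_int_def)
    fix w assume "v \<in> carrier (fin_int B)" "w \<in> carrier (fin_int B)"
    then show "v \<oplus>\<^bsub>fin_int B\<^esub> w \<in> carrier (fin_int B)"
      by (auto simp: fin_int_def subset_iff intro!: finite_support_add) (metis add_0_right)
  qed (auto simp: fin_int_def)
qed (auto simp: fin_int_def ring_distribs mult.assoc simp del: mult_eq_0_iff intro!: finite_support_mult)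

text \<open>The canonical map from the free abelian group on the elements of \<open>B\<close> to
  \<open>B\<close>, which computes a formal sum.\<close>

definition evaluate :: "(int, 'x) module \<Rightarrow> ('x \<Rightarrow> int) \<Rightarrow> 'x" where
  "evaluate B v = finsum B (\<lambda>x. v x \<odot>\<^bsub>B\<^esub> x) {x. v x \<noteq> 0}"

lemma evaluate_superset:
  assumes "module \<Z> B" "finite T" "{x. v x \<noteq> 0} \<subseteq> T" "T \<subseteq> carrier B"
  shows "evaluate B v = finsum B (\<lambda>x. v x \<odot>\<^bsub>B\<^esub> x) T"
proof -
  interpret B: module \<Z> B by fact
  show ?thesis unfolding evaluate_def
    by (rule B.M.add.finprod_mono_neutral_cong_left) (use assms in \<open>auto simp: subset_iff\<close>)
qed

lemma evaluate_mhom: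
  assumes B: "module \<Z> B"
  shows "mhom \<Z> (fin_int (carrier B)) B (evaluate B)"
proof -
  interpret B: module \<Z> B by fact
  show ?thesis
  proof (rule mhomI)
    fix v assume "v \<in> carrier (fin_int (carrier B))"
    then show "evaluate B v \<in> carrier B"
      unfolding evaluate_def by (intro B.M.finsum_closed) (auto simp: fin_int_def)
  next
    fix v w assume vw: "v \<in> carrier (fin_int (carrier B))" "w \<in> carrier (fin_int (carrier B))"
    let ?T = "{x. v x \<noteq> 0} \<union> {x. w x \<noteq> 0}"
    have T: "finite ?T" "?T \<subseteq> carrier B" using vw by (auto simp: fin_int_def)
    have "evaluate B (\<lambda>x. v x + w x) = finsum B (\<lambda>x. (v x + w x) \<odot>\<^bsub>B\<^esub> x) ?T"
      using T by (intro evaluate_superset[OF B]) auto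
    also have "\<dots> = finsum B (\<lambda>x. v x \<odot>\<^bsub>B\<^esub> x \<oplus>\<^bsub>B\<^esub> w x \<odot>\<^bsub>B\<^esub> x) ?T"
      by (rule B.M.finsum_cong') (use T B.smult_l_distr in \<open>auto simp: subset_iff\<close>)
    also have "\<dots> = finsum B (\<lambda>x. v x \<odot>\<^bsub>B\<^esub> x) ?T \<oplus>\<^bsub>B\<^esub> finsum B (\<lambda>x. w x \<odot>\<^bsub>B\<^esub> x) ?T"
      using T by (intro B.M.finsum_addf) (auto simp: subset_iff)
    also have "\<dots> = evaluate B v \<oplus>\<^bsub>B\<^esub> evaluate B w"
      using evaluate_superset[OF B T(1) _ T(2)] by simp
    finally show "evaluate B (v \<oplus>\<^bsub>fin_int (carrier B)\<^esub> w) = evaluate B v \<oplus>\<^bsub>B\<^esub> evaluate B w"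
      by (simp add: fin_int_def)
  next
    fix r :: int and v assume v: "v \<in> carrier (fin_int (carrier B))"
    let ?T = "{x. v x \<noteq> 0}"
    have T: "finite ?T" "?T \<subseteq> carrier B" using v by (auto simp: fin_int_def)
    have "evaluate B (\<lambda>x. r * v x) = finsum B (\<lambda>x. (r * v x) \<odot>\<^bsub>B\<^esub> x) ?T"
      using T by (intro evaluate_superset[OF B]) auto
    also have "\<dots> = finsum B (\<lambda>x. r \<odot>\<^bsub>B\<^esub> (v x \<odot>\<^bsub>B\<^esub> x)) ?T"
      by (rule B.M.finsum_cong') (use T B.smult_assoc1 in \<open>auto simp: subset_iff\<close>)
    also have "\<dots> = r \<odot>\<^bsub>B\<^esub> evaluate B v"
      unfolding evaluate_def using T B.finsum_smult_ldistr[of ?T r "\<lambda>x. v x \<odot>\<^bsub>B\<^esub> x"] by (auto simp: subset_iff)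
    finally show "evaluate B (r \<odot>\<^bsub>fin_int (carrier B)\<^esub> v) = r \<odot>\<^bsub>B\<^esub> evaluate B v"
      by (simp add: fin_int_def)
  qed
qed

lemma evaluate_single:
  assumes B: "module \<Z> B" and b: "b \<in> carrier B"
  shows "evaluate B (\<lambda>x. if x = b then 1 else 0) = b"
proof -
  interpret B: module \<Z> B by fact
  have "b = 1 \<odot>\<^bsub>B\<^esub> b" using B.smult_one[OF b] by simp
  then show ?thesis
    using evaluate_superset[OF B, of "{b}" "\<lambda>x. if x = b then 1 else 0"] b by (auto simp: B.smult_closed)
qed

text \<open>Every quotient \<open>B/S\<close> embeds into a divisible group: write \<open>B/S\<close> as a quotient of the free
  abelian group on \<open>B\<close> and allow rational coefficients.\<close>

lemma embed_divisible:
  fixes B :: "(int, 'x) module"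
  assumes B: "module \<Z> B" and S: "submodule S \<Z> B"
  shows "\<exists>(D :: (int, ('x \<Rightarrow> rat) set) module) q (rep :: ('x \<Rightarrow> rat) set \<Rightarrow> 'x \<Rightarrow> rat). int.baer D \<and> mhom \<Z> B D q \<and>
    (\<forall>b\<in>carrier B. q b = \<zero>\<^bsub>D\<^esub> \<longleftrightarrow> b \<in> S) \<and> inj_on rep (carrier D) \<and> (\<forall>d\<in>carrier D. finite {x. rep d x \<noteq> 0})"
proof -
  let ?V = "fin_rat :: (int, 'x \<Rightarrow> rat) module" and ?F = "fin_int (carrier B)"
  note V = fin_rat_module[where 'x='x] and F = fin_int_module[of "carrier B"] and ev = evaluate_mhom[OF B]
  define emb :: "('x \<Rightarrow> int) \<Rightarrow> 'x \<Rightarrow> rat" where "emb v = (\<lambda>x. of_int (v x))" for v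
  have emb: "mhom \<Z> ?F ?V emb"
    by (rule mhomI) (auto simp: fin_int_def fin_rat_def emb_def)
  have emb_inj: "emb v = emb w \<longleftrightarrow> v = w" for v w by (auto simp: emb_def fun_eq_iff)
  \<comment> \<open>\<open>L\<close> is the kernel of the map from the free group onto
    \<open>B/S\<close>; hence \<open>?V\<close> modulo the image \<open>K\<close> of
    \<open>L\<close> contains a copy of \<open>B/S\<close>.\<close>
  define L where "L = {v \<in> carrier ?F. evaluate B v \<in> S}"
  define K where "K = emb ` L"
  have L: "submodule L \<Z> ?F"
    by (rule int.submodI[OF F]; unfold L_def)
      (use F B S ev in \<open>auto simp: mhom_add mhom_smult int.mhom_zero[OF ev F B] int.submod_rules[OF B S]\<close>)
  have K: "submodule K \<Z> ?V"
    using int.image_submod[OF int.mhom_restrict[OF emb] int.submod_module[OF F L] V] int.submod_subset[OF F L]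
    by (simp add: K_def)
  let ?D = "quotient_module ?V K" and ?p = "\<lambda>v. K +>\<^bsub>?V\<^esub> v"
  have ses: "int.ses (?V\<lparr>carrier := K\<rparr>) ?V ?D (\<lambda>x. x) ?p" by (rule int.quotient_ses[OF V K])
  then have D: "module \<Z> ?D" and p: "mhom \<Z> ?V ?D ?p" and surj: "?p ` carrier ?V = carrier ?D"
    and ker: "\<And>v. v \<in> carrier ?V \<Longrightarrow> ?p v = \<zero>\<^bsub>?D\<^esub> \<longleftrightarrow> v \<in> K"
    by (auto simp: int.ses_def)
  have baer: "int.baer ?D"
  proof (rule divisible_baer[OF D])
    fix m :: int and d assume m: "m \<noteq> 0" and "d \<in> carrier ?D"
    then obtain v where v: "v \<in> carrier ?V" "d = ?p v" using surj by auto
    define w where "w = (\<lambda>x. v x / of_int m)"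
    have w: "w \<in> carrier ?V" "m \<odot>\<^bsub>?V\<^esub> w = v" using v m by (auto simp: w_def fin_rat_def)
    then have "m \<odot>\<^bsub>?D\<^esub> ?p w = d" using mhom_smult[OF p, of m w] v by simp
    then show "\<exists>e\<in>carrier ?D. m \<odot>\<^bsub>?D\<^esub> e = d" using mhom_closed[OF p w(1)] by blast
  qed
  define sg :: "'x \<Rightarrow> 'x \<Rightarrow> int" where "sg b = (\<lambda>x. if x = b then 1 else 0)" for b
  have sg: "sg b \<in> carrier ?F" "evaluate B (sg b) = b" if "b \<in> carrier B" for b
    using that evaluate_single[OF B that] by (auto simp: sg_def fin_int_def)
  have embp: "?p (emb v) = \<zero>\<^bsub>?D\<^esub> \<longleftrightarrow> evaluate B v \<in> S" if "v \<in> carrier ?F" for v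
    using ker[of "emb v"] mhom_closed[OF emb that] that by (auto simp: K_def L_def emb_inj)
  have pe: "mhom \<Z> ?F ?D (\<lambda>v. ?p (emb v))" by (rule mhom_compose[OF emb p])
  have q: "mhom \<Z> B ?D (\<lambda>b. ?p (emb (sg b)))"
  proof (rule zmod_mhomI[OF B D])
    fix x y assume xy: "x \<in> carrier B" "y \<in> carrier B"
    then have s: "x \<oplus>\<^bsub>B\<^esub> y \<in> carrier B" using int.mod_add_closed[OF B] by simp
    \<comment> \<open>The basis element of a sum and the sum of the basis elements differ by a
      formal sum of value zero, which the quotient kills.\<close>
    let ?u = "sg (x \<oplus>\<^bsub>B\<^esub> y) \<ominus>\<^bsub>?F\<^esub> (sg x \<oplus>\<^bsub>?F\<^esub> sg y)"
    have u: "?u \<in> carrier ?F" using sg xy s F by (simp add: int.mod_minus_closed int.mod_add_closed)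
    have "evaluate B ?u = \<zero>\<^bsub>B\<^esub>"
      using sg xy s F B by (simp add: int.mhom_minus[OF ev F B] mhom_add[OF ev] int.mod_add_closed int.mod_minus_self)
    then have "?p (emb ?u) = \<zero>\<^bsub>?D\<^esub>" using embp[OF u] int.submod_zero[OF B S] by simp
    moreover have "?p (emb ?u) = ?p (emb (sg (x \<oplus>\<^bsub>B\<^esub> y))) \<ominus>\<^bsub>?D\<^esub> (?p (emb (sg x)) \<oplus>\<^bsub>?D\<^esub> ?p (emb (sg y)))"
      using sg xy s F by (simp add: int.mhom_minus[OF pe F D] mhom_add[OF pe] int.mod_add_closed)
    ultimately show "?p (emb (sg (x \<oplus>\<^bsub>B\<^esub> y))) = ?p (emb (sg x)) \<oplus>\<^bsub>?D\<^esub> ?p (emb (sg y))"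
      using int.mod_minus_eq_zero[OF D] mhom_closed[OF pe] sg xy s int.mod_add_closed[OF D] by simp
  qed (use mhom_closed[OF pe] sg in auto)
  have qk: "?p (emb (sg b)) = \<zero>\<^bsub>?D\<^esub> \<longleftrightarrow> b \<in> S" if "b \<in> carrier B" for b
    using embp[OF sg(1)[OF that]] sg(2)[OF that] by simp
  \<comment> \<open>Chosen representatives bound the size of the quotient by that of the finitely
    supported functions.\<close>
  define rep where "rep d = (SOME v. v \<in> carrier ?V \<and> ?p v = d)" for d
  have rep: "rep d \<in> carrier ?V \<and> ?p (rep d) = d" if "d \<in> carrier ?D" for d
    unfolding rep_def using that surj by (intro someI_ex[of "\<lambda>v. v \<in> carrier ?V \<and> ?p v = d"]) (metis imageE)
  then have "inj_on rep (carrier ?D)" by (metis inj_onI)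
  moreover have "\<forall>d\<in>carrier ?D. finite {x. rep d x \<noteq> 0}" using rep by (auto simp: fin_rat_def)
  ultimately show ?thesis using baer q qk
    by (intro exI[of _ ?D] exI[of _ "\<lambda>b. ?p (emb (sg b))"] exI[of _ rep]) auto
qed

section \<open>Existence of injective resolutions\<close>

text \<open>The factor \<open>nat\<close> makes the index type infinite even for finite
  \<open>'a\<close>, and an infinite set is equinumerous with its square.\<close>

lemma inj_Times_resolution_index: "\<exists>g :: ('a \<times> nat) \<times> ('a \<times> nat) \<Rightarrow> 'a \<times> nat. inj g"
proof -
  have "infinite (UNIV :: ('a \<times> nat) set)" by (simp add: finite_prod)
  then have "\<exists>g. bij_betw g (UNIV \<times> UNIV :: (('a \<times> nat) \<times> ('a \<times> nat)) set) (UNIV :: ('a \<times> nat) set)"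
    unfolding card_of_ordIso by (rule card_of_Times_same_infinite)
  then show ?thesis by (auto simp: bij_betw_def)
qed

text \<open>A function of two arguments is a function on pairs, and \<open>g\<close> codes the pairs
  by single indices.\<close>

lemma inj_fun_collapse:
  fixes g :: "'c \<times> 't \<Rightarrow> 't"
  assumes "inj g"
  shows "\<exists>h :: ('c \<Rightarrow> 't \<Rightarrow> 'w) \<Rightarrow> 't \<Rightarrow> 'w. inj h"
proof
  show "inj (\<lambda>F :: 'c \<Rightarrow> 't \<Rightarrow> 'w. \<lambda>t. case_prod F (inv_into UNIV g t))"
  proof (rule injI, intro ext)
    fix F G :: "'c \<Rightarrow> 't \<Rightarrow> 'w" and c s
    assume "(\<lambda>t. case_prod F (inv_into UNIV g t)) = (\<lambda>t. case_prod G (inv_into UNIV g t))"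
    from fun_cong[OF this, of "g (c, s)"] show "F c s = G c s" by (simp add: inv_into_f_f[OF assms])
  qed
qed

text \<open>The first embedding will code the elements of a coinduced module, which are functions on
  \<open>R\<close>; the second stores a sequence of elements in a single one.\<close>

lemma universe_collapse:
  "\<exists>h :: ('a \<Rightarrow> ('a, 'n) resolution_universe) \<Rightarrow> ('a, 'n) resolution_universe. inj h"
  "\<exists>h :: (nat \<Rightarrow> ('a, 'n) resolution_universe) \<Rightarrow> ('a, 'n) resolution_universe. inj h"
proof -
  obtain g :: "('a \<times> nat) \<times> ('a \<times> nat) \<Rightarrow> 'a \<times> nat" where g: "inj g"
    using inj_Times_resolution_index by blast
  have "inj (\<lambda>(a, t). g ((a, 0), t))" using g by (auto simp: inj_def)
  then show "\<exists>h :: ('a \<Rightarrow> ('a, 'n) resolution_universe) \<Rightarrow> ('a, 'n) resolution_universe. inj h"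
    by (rule inj_fun_collapse)
  have "inj (\<lambda>(k, t). g ((undefined, k), t))" using g by (auto simp: inj_def)
  then show "\<exists>h :: (nat \<Rightarrow> ('a, 'n) resolution_universe) \<Rightarrow> ('a, 'n) resolution_universe. inj h"
    by (rule inj_fun_collapse)
qed

text \<open>A finitely supported function is coded by the sequence that lists its support at the
  even places and the corresponding values at the odd ones.\<close>

lemma universe_fin_rat:
  "\<exists>h :: (('a, 'n) resolution_universe \<Rightarrow> rat) \<Rightarrow> ('a, 'n) resolution_universe. inj_on h {v. finite {x. v x \<noteq> 0}}"
proof -
  obtain h :: "(nat \<Rightarrow> ('a, 'n) resolution_universe) \<Rightarrow> ('a, 'n) resolution_universe" where h: "inj h"
    using universe_collapse(2) by blast
  define rx :: "rat \<Rightarrow> ('a, 'n) resolution_universe" where "rx q = (\<lambda>(a, m). Inr (m = to_nat q))" for q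
  have rx: "inj rx"
  proof (rule injI)
    fix p q assume "rx p = rx q"
    from fun_cong[OF this, of "(undefined, to_nat p)"] show "p = q" by (simp add: rx_def)
  qed
  \<comment> \<open>Inserting \<open>undefined\<close> keeps the enumerated set nonempty, so that
    its enumeration has exactly this range.\<close>
  define en where "en v = from_nat_into (insert undefined {x. v x \<noteq> 0})" for v :: "('a, 'n) resolution_universe \<Rightarrow> rat"
  have en: "range (en v) = insert undefined {x. v x \<noteq> 0}" if "finite {x. v x \<noteq> 0}" for v
    unfolding en_def using that by (intro range_from_nat_into) (auto intro: countable_finite)
  define F where "F v k = (if even k then en v (k div 2) else rx (v (en v (k div 2))))" for v k
  have "inj_on (\<lambda>v. h (F v)) {v. finite {x. v x \<noteq> 0}}"
  proof (rule inj_onI)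
    fix v w assume v: "v \<in> {v. finite {x. v x \<noteq> 0}}" and w: "w \<in> {v. finite {x. v x \<noteq> 0}}" and "h (F v) = h (F w)"
    then have eq: "F v = F w" using h by (auto dest: injD)
    have e: "en v k = en w k" for k using fun_cong[OF eq, of "2 * k"] by (simp add: F_def)
    have val: "v (en v k) = w (en w k)" for k
      using fun_cong[OF eq, of "2 * k + 1"] injD[OF rx] by (simp add: F_def)
    have ee: "en v = en w" using e by blast
    show "v = w"
    proof
      fix x show "v x = w x"
      proof (cases "x \<in> range (en v)")
        case True then show ?thesis using val e by (metis rangeE)
      next
        case False then show ?thesis using en[of v] en[of w] v w ee by auto
      qed
    qed
  qed
  then show ?thesis by blast
qed

text \<open>The first map makes room for a copy of the module to be resolved, the second for a copy
  of the ring and its ideals.\<close>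

lemma universe_inj:
  "inj (\<lambda>n. (\<lambda>_. Inl n) :: ('a, 'n) resolution_universe)"
  "inj (\<lambda>a. (\<lambda>(b, k). Inr (b = a)) :: ('a, 'n) resolution_universe)"
  by (auto simp: inj_def fun_eq_iff)

context cring
begin

section \<open>Copies of modules and coinduced injective modules\<close>

lemma transport_module:
  fixes M :: "('a, 'x, 'm) module_scheme" and j :: "'x \<Rightarrow> 'y"
  assumes M: "module R M" and j: "inj_on j (carrier M)"
  shows "\<exists>(N :: ('a, 'y) module) k. module R N \<and> mhom R M N j \<and> mhom R N M k \<and> carrier N = j ` carrier M \<and>
    (\<forall>x\<in>carrier M. k (j x) = x) \<and> (\<forall>y\<in>carrier N. j (k y) = y)"
proof -
  define k where "k = inv_into (carrier M) j"
  have k: "k (j x) = x" if "x \<in> carrier M" for x unfolding k_def using j that by simp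
  define N :: "('a, 'y) module" where "N = \<lparr>carrier = j ` carrier M, monoid.mult = (\<lambda>x y. undefined), one = undefined,
    zero = j \<zero>\<^bsub>M\<^esub>, add = (\<lambda>x y. j (k x \<oplus>\<^bsub>M\<^esub> k y)), smult = (\<lambda>r x. j (r \<odot>\<^bsub>M\<^esub> k x))\<rparr>"
  have hj: "mhom R M N j" by (rule mhomI) (auto simp: N_def k)
  have N: "module R N" by (rule module_of_surj[OF M hj]) (auto simp: N_def)
  have hk: "mhom R N M k" by (rule mhomI) (use M in \<open>auto simp: N_def k\<close>)
  show ?thesis using N hj hk k by (intro exI[of _ N] exI[of _ k]) (auto simp: N_def)
qed

text \<open>The coinduced module of additive maps from \<open>R\<close> to \<open>D\<close>, on
  which \<open>r\<close> acts through multiplication by \<open>r\<close> in the argument.\<close>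

definition hom_int :: "(int, 'd) module \<Rightarrow> ('a, 'a \<Rightarrow> 'd) module" where
  "hom_int D = \<lparr>carrier = {\<phi> \<in> carrier R \<rightarrow>\<^sub>E carrier D. \<forall>x\<in>carrier R. \<forall>y\<in>carrier R. \<phi> (x \<oplus> y) = \<phi> x \<oplus>\<^bsub>D\<^esub> \<phi> y},
     monoid.mult = (\<lambda>x y. undefined), one = undefined, zero = (\<lambda>x\<in>carrier R. \<zero>\<^bsub>D\<^esub>),
     add = (\<lambda>\<phi> \<psi>. \<lambda>x\<in>carrier R. \<phi> x \<oplus>\<^bsub>D\<^esub> \<psi> x), smult = (\<lambda>r \<phi>. \<lambda>x\<in>carrier R. \<phi> (x \<otimes> r))\<rparr>"

lemma hom_int_module:
  assumes D: "module \<Z> D"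
  shows "module R (hom_int D)"
proof -
  interpret D: abelian_group D by (rule int.mod_abelian_group[OF D])
  show ?thesis
  proof (rule moduleI[OF is_cring])
    show "abelian_group (hom_int D)"
    proof (rule abelian_groupI)
      fix \<phi> assume ph: "\<phi> \<in> carrier (hom_int D)"
      let ?n = "\<lambda>x\<in>carrier R. \<ominus>\<^bsub>D\<^esub> \<phi> x"
      have "?n \<in> carrier (hom_int D)" using ph by (auto simp: hom_int_def D.minus_add PiE_def Pi_def)
      moreover have "?n \<oplus>\<^bsub>hom_int D\<^esub> \<phi> = \<zero>\<^bsub>hom_int D\<^esub>"
        using ph by (auto simp: hom_int_def fun_eq_iff restrict_def D.l_neg PiE_def Pi_def)
      ultimately show "\<exists>y\<in>carrier (hom_int D). y \<oplus>\<^bsub>hom_int D\<^esub> \<phi> = \<zero>\<^bsub>hom_int D\<^esub>" by blast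
      show "\<zero>\<^bsub>hom_int D\<^esub> \<oplus>\<^bsub>hom_int D\<^esub> \<phi> = \<phi>"
        using ph by (auto simp: hom_int_def fun_eq_iff restrict_def PiE_def extensional_def Pi_def)
    next
      fix \<phi> \<psi> assume "\<phi> \<in> carrier (hom_int D)" "\<psi> \<in> carrier (hom_int D)"
      then show "\<phi> \<oplus>\<^bsub>hom_int D\<^esub> \<psi> \<in> carrier (hom_int D)"
        by (auto simp: hom_int_def D.a_ac PiE_def Pi_def)
      from \<open>\<phi> \<in> carrier (hom_int D)\<close> \<open>\<psi> \<in> carrier (hom_int D)\<close>
      show "\<phi> \<oplus>\<^bsub>hom_int D\<^esub> \<psi> = \<psi> \<oplus>\<^bsub>hom_int D\<^esub> \<phi>"
        by (auto simp: hom_int_def fun_eq_iff restrict_def D.a_ac PiE_def Pi_def)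
    next
      fix \<phi> \<psi> \<chi> assume "\<phi> \<in> carrier (hom_int D)" "\<psi> \<in> carrier (hom_int D)" "\<chi> \<in> carrier (hom_int D)"
      then show "\<phi> \<oplus>\<^bsub>hom_int D\<^esub> \<psi> \<oplus>\<^bsub>hom_int D\<^esub> \<chi> = \<phi> \<oplus>\<^bsub>hom_int D\<^esub> (\<psi> \<oplus>\<^bsub>hom_int D\<^esub> \<chi>)"
        by (auto simp: hom_int_def fun_eq_iff restrict_def D.a_ac PiE_def Pi_def)
    qed (auto simp: hom_int_def)
  next
    fix r s \<phi> assume "r \<in> carrier R" "s \<in> carrier R" "\<phi> \<in> carrier (hom_int D)"
    then show "(r \<oplus> s) \<odot>\<^bsub>hom_int D\<^esub> \<phi> = r \<odot>\<^bsub>hom_int D\<^esub> \<phi> \<oplus>\<^bsub>hom_int D\<^esub> s \<odot>\<^bsub>hom_int D\<^esub> \<phi>"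
      "(r \<otimes> s) \<odot>\<^bsub>hom_int D\<^esub> \<phi> = r \<odot>\<^bsub>hom_int D\<^esub> (s \<odot>\<^bsub>hom_int D\<^esub> \<phi>)"
      by (auto simp: hom_int_def fun_eq_iff restrict_def r_distr m_ac)
  next
    fix r \<phi> assume "r \<in> carrier R" "\<phi> \<in> carrier (hom_int D)"
    then show "r \<odot>\<^bsub>hom_int D\<^esub> \<phi> \<in> carrier (hom_int D)"
      by (auto simp: hom_int_def l_distr)
  next
    fix \<phi> assume "\<phi> \<in> carrier (hom_int D)"
    then show "\<one> \<odot>\<^bsub>hom_int D\<^esub> \<phi> = \<phi>"
      by (auto simp: hom_int_def fun_eq_iff restrict_def PiE_def extensional_def)
  qed (auto simp: hom_int_def fun_eq_iff restrict_def)
qed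

text \<open>By evaluation at the unit, an \<open>R\<close>-linear map from \<open>I\<close> to the
  coinduced module amounts to an additive map from \<open>I\<close> to \<open>D\<close>. The latter
  extends to \<open>R\<close> because \<open>D\<close> is injective over the integers.\<close>

lemma hom_int_baer:
  assumes D: "int.baer D"
  shows "baer (hom_int D)"
  unfolding baer_def
proof (intro conjI allI impI)
  note Dm = int.baer_module[OF D]
  show "module R (hom_int D)" by (rule hom_int_module[OF Dm])
  fix I f assume I: "ideal I R" and f: "mhom R (ideal_module I) (hom_int D) f"
  have zR: "module \<Z> (zmod R)" by (rule zmod_module[OF abelian_group_axioms])
  have Ic: "\<And>x. x \<in> I \<Longrightarrow> x \<in> carrier R" by (rule ideal.Icarr[OF I])
  have fc: "f r \<in> carrier (hom_int D)" if "r \<in> I" for r using mhom_closed[OF f] that by simp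
  have Ia: "\<And>x y. x \<in> I \<Longrightarrow> y \<in> I \<Longrightarrow> x \<oplus> y \<in> I" and I0: "\<zero> \<in> I" and In: "\<And>x. x \<in> I \<Longrightarrow> \<ominus> x \<in> I"
    using additive_subgroup.a_closed[OF ideal.axioms(1)[OF I]] additive_subgroup.zero_closed[OF ideal.axioms(1)[OF I]]
      additive_subgroup.a_inv_closed[OF ideal.axioms(1)[OF I]] by auto
  have S: "submodule I \<Z> (zmod R)"
  proof (rule int.submodI[OF zR])
    fix n :: int and x assume x: "x \<in> I"
    have "[n] \<cdot> x = ([n] \<cdot> \<one>) \<otimes> x" using add_pow_ldistr_int[of \<one> x n] Ic[OF x] by simp
    then show "n \<odot>\<^bsub>zmod R\<^esub> x \<in> I" using ideal.I_l_closed[OF I x, of "[n] \<cdot> \<one>"] by (simp add: zmod_def)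
  qed (use Ic Ia I0 in auto)
  have add: "f (x \<oplus> y) \<one> = f x \<one> \<oplus>\<^bsub>D\<^esub> f y \<one>" if "x \<in> I" "y \<in> I" for x y
    using mhom_add[OF f, of x y] that by (simp add: hom_int_def)
  have g: "mhom \<Z> ((zmod R)\<lparr>carrier := I\<rparr>) D (\<lambda>r. f r \<one>)"
    by (rule zmod_mhomI[OF int.submod_module[OF zR S] Dm]) (use fc add in \<open>auto simp: hom_int_def\<close>)
  obtain G where G: "mhom \<Z> (zmod R) D G" "\<And>r. r \<in> I \<Longrightarrow> G r = f r \<one>"
    using int.baer_extend[OF D zR S g] by blast
  let ?e = "restrict G (carrier R)"
  have e: "?e \<in> carrier (hom_int D)"
    using mhom_closed[OF G(1)] mhom_add[OF G(1)] by (auto simp: hom_int_def)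
  have "f r = r \<odot>\<^bsub>hom_int D\<^esub> ?e" if r: "r \<in> I" for r
  proof (rule ext)
    fix s
    show "f r s = (r \<odot>\<^bsub>hom_int D\<^esub> ?e) s"
    proof (cases "s \<in> carrier R")
      case True
      then have "s \<otimes> r \<in> I" using ideal.I_l_closed[OF I r] by simp
      then have "G (s \<otimes> r) = (s \<odot>\<^bsub>hom_int D\<^esub> f r) \<one>" using G(2) mhom_smult[OF f True, of r] r by simp
      then show ?thesis using True Ic[OF r] by (simp add: hom_int_def)
    next
      case False
      then show ?thesis using fc[OF r] by (simp add: hom_int_def PiE_def extensional_def)
    qed
  qed
  then show "\<exists>e\<in>carrier (hom_int D). \<forall>r\<in>I. f r = r \<odot>\<^bsub>hom_int D\<^esub> e" using e by blast
qed

text \<open>Embedding \<open>B/S\<close> rather than \<open>B\<close> yields the next term of a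
  resolution together with its differential: \<open>S\<close> will be the image of the preceding
  map, and no quotient has to be realized on the resolution type.\<close>

lemma embed_baer:
  fixes B :: "('a, ('a, 'n) resolution_universe) module"
  assumes B: "module R B" and S: "submodule S R B"
  shows "\<exists>(J :: ('a, ('a, 'n) resolution_universe) module) d. baer J \<and> mhom R B J d \<and>
    (\<forall>b\<in>carrier B. d b = \<zero>\<^bsub>J\<^esub> \<longleftrightarrow> b \<in> S)"
proof -
  have zB: "module \<Z> (zmod B)" by (rule zmod_module[OF mod_abelian_group[OF B]])
  have pow: "[n] \<cdot>\<^bsub>B\<^esub> x = ([n] \<cdot> \<one>) \<odot>\<^bsub>B\<^esub> x" if "x \<in> carrier B" for n :: int and x
  proof -
    have "mhom \<Z> (zmod R) (zmod B) (\<lambda>r. r \<odot>\<^bsub>B\<^esub> x)"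
      by (rule zmod_mhomI[OF zmod_module[OF abelian_group_axioms] zB])
        (use that B in \<open>auto simp: mod_l_distr\<close>)
    from mhom_smult[OF this, of n \<one>] that B show ?thesis by (simp add: zmod_def)
  qed
  have zS: "submodule S \<Z> (zmod B)"
    by (rule int.submodI[OF zB])
      (use submod_rules[OF B S] in \<open>auto simp: zmod_def pow subset_iff\<close>)
  obtain D :: "(int, (('a, 'n) resolution_universe \<Rightarrow> rat) set) module" and q
    and rep :: "(('a, 'n) resolution_universe \<Rightarrow> rat) set \<Rightarrow> ('a, 'n) resolution_universe \<Rightarrow> rat" where
    D: "int.baer D" and q: "mhom \<Z> (zmod B) D q" and qk: "\<And>b. b \<in> carrier B \<Longrightarrow> q b = \<zero>\<^bsub>D\<^esub> \<longleftrightarrow> b \<in> S"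
    and rep: "inj_on rep (carrier D)" and fin: "\<And>d. d \<in> carrier D \<Longrightarrow> finite {x. rep d x \<noteq> 0}"
    using embed_divisible[OF zB zS] by auto
  let ?J = "hom_int D"
  have J: "baer ?J" by (rule hom_int_baer[OF D])
  note Jm = baer_module[OF J]
  obtain h :: "('a \<Rightarrow> ('a, 'n) resolution_universe) \<Rightarrow> ('a, 'n) resolution_universe" where h: "inj h"
    using universe_collapse(1) by blast
  obtain k :: "(('a, 'n) resolution_universe \<Rightarrow> rat) \<Rightarrow> ('a, 'n) resolution_universe"
    where k: "inj_on k {v. finite {x. v x \<noteq> 0}}"
    using universe_fin_rat by blast
  have kr: "d = d'" if "k (rep d) = k (rep d')" "d \<in> carrier D" "d' \<in> carrier D" for d d'
    using that k rep fin by (auto simp: inj_on_def)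
  \<comment> \<open>Each value of a function is replaced by its representative and coded by
    \<open>k\<close> as one element of the resolution type; \<open>h\<close> then codes the whole
    function.\<close>
  have "inj_on (\<lambda>\<phi>. h (\<lambda>a. k (rep (\<phi> a)))) (carrier ?J)"
  proof (rule inj_onI)
    fix \<phi> \<psi> assume ph: "\<phi> \<in> carrier ?J" "\<psi> \<in> carrier ?J" and "h (\<lambda>a. k (rep (\<phi> a))) = h (\<lambda>a. k (rep (\<psi> a)))"
    then have "\<And>a. k (rep (\<phi> a)) = k (rep (\<psi> a))" using h by (metis injD)
    then have "\<And>a. a \<in> carrier R \<Longrightarrow> \<phi> a = \<psi> a" using ph by (intro kr) (auto simp: hom_int_def)
    then show "\<phi> = \<psi>" using ph by (intro extensionalityI[of _ "carrier R"]) (auto simp: hom_int_def PiE_def)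
  qed
  from transport_module[OF Jm this] obtain N :: "('a, ('a, 'n) resolution_universe) module" and k' j where
    N: "module R N" and j: "mhom R ?J N j" and k': "mhom R N ?J k'" and kj: "\<And>x. x \<in> carrier ?J \<Longrightarrow> k' (j x) = x"
    and jk: "\<And>y. y \<in> carrier N \<Longrightarrow> j (k' y) = y" by blast
  have Nb: "baer N" by (rule baer_retract[OF J N k' j]) (rule jk)
  \<comment> \<open>This is the adjoint of \<open>q\<close>. Evaluation at the unit gives
    \<open>q\<close> back, and \<open>S\<close> is closed under scalars, so the kernel is
    \<open>S\<close> again.\<close>
  define d where "d b = (\<lambda>r\<in>carrier R. q (r \<odot>\<^bsub>B\<^esub> b))" for b
  have dc: "mhom R B ?J d"
    by (rule mhomI) (use B mhom_closed[OF q] mhom_add[OF q] in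
        \<open>auto simp: d_def hom_int_def mod_r_distr mod_l_distr mod_smult_assoc fun_eq_iff restrict_def\<close>)
  have dk: "d b = \<zero>\<^bsub>?J\<^esub> \<longleftrightarrow> b \<in> S" if b: "b \<in> carrier B" for b
  proof
    assume "d b = \<zero>\<^bsub>?J\<^esub>"
    from fun_cong[OF this, of \<one>] show "b \<in> S" using b B qk by (simp add: d_def hom_int_def)
  next
    assume "b \<in> S"
    then have "q (r \<odot>\<^bsub>B\<^esub> b) = \<zero>\<^bsub>D\<^esub>" if "r \<in> carrier R" for r
      using qk[of "r \<odot>\<^bsub>B\<^esub> b"] b B submod_smult[OF B S that] that by simp
    then show "d b = \<zero>\<^bsub>?J\<^esub>" by (auto simp: d_def hom_int_def fun_eq_iff restrict_def)
  qed
  have "j (d b) = \<zero>\<^bsub>N\<^esub> \<longleftrightarrow> b \<in> S" if "b \<in> carrier B" for b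
    using dk[OF that] kj mhom_closed[OF dc that] mhom_zero[OF j Jm N] mhom_zero[OF k' N Jm] by metis
  then show ?thesis using Nb mhom_compose[OF dc j] by blast
qed

section \<open>Agreement of Baer's criterion with injectivity\<close>

text \<open>\<open>mhom\<close> imposes no value outside the carrier, so its maps compose as plain
  functions; this equivalence leads back to the convention of the definitions.\<close>

lemma mod_hom_iff: "f \<in> mod_hom R A B \<longleftrightarrow> mhom R A B f \<and> f \<in> extensional (carrier A)"
  by (auto simp: mod_hom_def mhom_def PiE_def)

lemma mhom_restrict_mod_hom: "mhom R A B f \<Longrightarrow> module R A \<Longrightarrow> restrict f (carrier A) \<in> mod_hom R A B"
  by (auto simp: mod_hom_iff mhom_def)

lemma baer_imp_injective_module:
  assumes E: "baer E" shows "injective_module R E"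
  unfolding injective_module_def
proof (intro conjI allI ballI impI)
  show "module R E" by (rule baer_module[OF E])
  fix A B j f assume j: "j \<in> mod_hom R A B" and f: "f \<in> mod_hom R A E" and A: "module R A" and B: "module R B" and i: "inj_on j (carrier A)"
  have j': "mhom R A B j" and f': "mhom R A E f" using j f by (auto simp: mod_hom_iff)
  obtain h where h: "mhom R B E h" "\<And>x. x \<in> carrier A \<Longrightarrow> h (j x) = f x"
    using baer_factor[OF E A B j' f'] mhom_inj_zero[OF j' A B i] mhom_zero[OF f' A baer_module[OF E]] by blast
  then show "\<exists>g\<in>mod_hom R B E. \<forall>x\<in>carrier A. g (j x) = f x"
    using mhom_restrict_mod_hom[OF h(1) B] mhom_closed[OF j'] by (intro bexI[of _ "restrict h (carrier B)"]) auto
qed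

text \<open>Through \<open>\<kappa>\<close> the type of \<open>E\<close> carries a copy of
  \<open>R\<close>, so a copy of the inclusion of \<open>I\<close> in \<open>R\<close> is among the
  test embeddings.\<close>

lemma injective_module_imp_baer:
  fixes E :: "('a, 'c) module" and \<kappa> :: "'a \<Rightarrow> 'c"
  assumes \<kappa>: "inj \<kappa>" and E: "injective_module R E"
  shows "baer E"
  unfolding baer_def
proof (intro conjI allI impI)
  show Em: "module R E" using E by (simp add: injective_module_def)
  fix I f assume I: "ideal I R" and f: "mhom R (ideal_module I) E f"
  have "inj_on \<kappa> (carrier (regular_module R))" using \<kappa> by (auto simp: inj_on_def)
  from transport_module[OF regular_module this] obtain N :: "('a, 'c) module" and k where
    N: "module R N" and h: "mhom R (regular_module R) N \<kappa>" and hk: "mhom R N (regular_module R) k"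
    and cN: "carrier N = \<kappa> ` carrier R" and k: "\<And>x. x \<in> carrier R \<Longrightarrow> k (\<kappa> x) = x" by auto
  have Ic: "\<And>r. r \<in> I \<Longrightarrow> r \<in> carrier R" by (rule ideal.Icarr[OF I])
  have hI: "mhom R (ideal_module I) N \<kappa>"
    unfolding ideal_module_def using mhom_restrict[OF h, of I] Ic by auto
  have S: "submodule (\<kappa> ` I) R N" using image_submod[OF hI ideal_module[OF I] N] by simp
  let ?A = "N\<lparr>carrier := \<kappa> ` I\<rparr>"
  have A: "module R ?A" by (rule submod_module[OF N S])
  have "mhom R ?A (ideal_module I) k"
    using hk k Ic submod_subset[OF N S] by (auto simp: mhom_def subset_iff)
  from mhom_compose[OF this f] have "restrict (\<lambda>y. f (k y)) (carrier ?A) \<in> mod_hom R ?A E"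
    by (rule mhom_restrict_mod_hom[OF _ A])
  moreover have "restrict (\<lambda>y. y) (carrier ?A) \<in> mod_hom R ?A N"
    by (rule mhom_restrict_mod_hom[OF mhom_incl[OF submod_subset[OF N S]] A])
  moreover have "inj_on (restrict (\<lambda>y. y) (carrier ?A)) (carrier ?A)" by (auto simp: inj_on_def)
  ultimately obtain g where g: "g \<in> mod_hom R N E" "\<forall>y\<in>carrier ?A. g (restrict (\<lambda>y. y) (carrier ?A) y) = restrict (\<lambda>y. f (k y)) (carrier ?A) y"
    using E A N unfolding injective_module_def by blast
  have g': "mhom R N E g" using g(1) by (simp add: mod_hom_iff)
  have "f r = r \<odot>\<^bsub>E\<^esub> g (\<kappa> \<one>)" if r: "r \<in> I" for r
  proof -
    have "f r = g (\<kappa> r)" using g(2) r k Ic by auto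
    also have "\<kappa> r = r \<odot>\<^bsub>N\<^esub> \<kappa> \<one>" using mhom_smult[OF h, of r \<one>] Ic[OF r] by simp
    also have "g \<dots> = r \<odot>\<^bsub>E\<^esub> g (\<kappa> \<one>)" using mhom_smult[OF g'] Ic[OF r] cN by simp
    finally show ?thesis .
  qed
  then show "\<exists>e\<in>carrier E. \<forall>r\<in>I. f r = r \<odot>\<^bsub>E\<^esub> e" using mhom_closed[OF g'] cN by blast
qed

section \<open>Resolutions: existence and choice\<close>

text \<open>The terms are arbitrary modules, because the resolution of \<open>R\<close> by Hom
  modules has terms that are acyclic but need not be injective.\<close>

definition resolution ::
  "('a, 'x, 'm) module_scheme \<Rightarrow> (nat \<Rightarrow> ('a, 'c) module) \<Rightarrow> (nat \<Rightarrow> 'c \<Rightarrow> 'c) \<Rightarrow> ('x \<Rightarrow> 'c) \<Rightarrow> bool" where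
  "resolution N E d e \<longleftrightarrow> module R N \<and> (\<forall>i. module R (E i)) \<and> (\<forall>i. mhom R (E i) (E (Suc i)) (d i)) \<and>
     mhom R N (E 0) e \<and> inj_on e (carrier N) \<and>
     (\<forall>z\<in>carrier (E 0). d 0 z = \<zero>\<^bsub>E (Suc 0)\<^esub> \<longleftrightarrow> z \<in> e ` carrier N) \<and>
     (\<forall>i. \<forall>z\<in>carrier (E (Suc i)). d (Suc i) z = \<zero>\<^bsub>E (Suc (Suc i))\<^esub> \<longleftrightarrow> z \<in> d i ` carrier (E i))"

definition baer_resolution ::
  "('a, 'x, 'm) module_scheme \<Rightarrow> (nat \<Rightarrow> ('a, 'c) module) \<Rightarrow> (nat \<Rightarrow> 'c \<Rightarrow> 'c) \<Rightarrow> ('x \<Rightarrow> 'c) \<Rightarrow> bool" where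
  "baer_resolution N E d e \<longleftrightarrow> resolution N E d e \<and> (\<forall>i. baer (E i))"

lemma resolutionD:
  assumes "resolution N E d e"
  shows "module R N" "module R (E i)" "mhom R (E i) (E (Suc i)) (d i)" "mhom R N (E 0) e" "inj_on e (carrier N)"
    "z \<in> carrier (E 0) \<Longrightarrow> d 0 z = \<zero>\<^bsub>E (Suc 0)\<^esub> \<longleftrightarrow> z \<in> e ` carrier N"
    "z' \<in> carrier (E (Suc i)) \<Longrightarrow> d (Suc i) z' = \<zero>\<^bsub>E (Suc (Suc i))\<^esub> \<longleftrightarrow> z' \<in> d i ` carrier (E i)"
  using assms by (auto simp: resolution_def)

lemma resolution_dd:
  assumes "resolution N E d e"
  shows "x \<in> carrier N \<Longrightarrow> d 0 (e x) = \<zero>\<^bsub>E (Suc 0)\<^esub>"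
    "z \<in> carrier (E i) \<Longrightarrow> d (Suc i) (d i z) = \<zero>\<^bsub>E (Suc (Suc i))\<^esub>"
  using resolutionD(6)[OF assms, of "e x"] resolutionD(7)[OF assms, of "d i z" i]
    mhom_closed[OF resolutionD(4)[OF assms]] mhom_closed[OF resolutionD(3)[OF assms]] by auto

lemma ex_baer_resolution_universe:
  fixes N :: "('a, ('a, 'n) resolution_universe) module"
  assumes N: "module R N"
  shows "\<exists>(E :: nat \<Rightarrow> ('a, ('a, 'n) resolution_universe) module) d e. baer_resolution N E d e"
proof -
  define good where "good B S p \<longleftrightarrow> baer (fst p) \<and> mhom R B (fst p) (snd p) \<and> (\<forall>b\<in>carrier B. snd p b = \<zero>\<^bsub>fst p\<^esub> \<longleftrightarrow> b \<in> S)"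
    for B :: "('a, ('a, 'n) resolution_universe) module" and S and p :: "('a, ('a, 'n) resolution_universe) module \<times> (('a, 'n) resolution_universe \<Rightarrow> ('a, 'n) resolution_universe)"
  define emb where "emb B S = (SOME p. good B S p)" for B S
  have emb: "baer (fst (emb B S))" "mhom R B (fst (emb B S)) (snd (emb B S))"
    "\<And>b. b \<in> carrier B \<Longrightarrow> snd (emb B S) b = \<zero>\<^bsub>fst (emb B S)\<^esub> \<longleftrightarrow> b \<in> S"
    if B: "module R B" and S: "submodule S R B" for B S
  proof -
    obtain J :: "('a, ('a, 'n) resolution_universe) module" and d where "baer J" "mhom R B J d" "\<forall>b\<in>carrier B. d b = \<zero>\<^bsub>J\<^esub> \<longleftrightarrow> b \<in> S"
      using embed_baer[OF B S] by blast
    then have "good B S (J, d)" by (simp add: good_def)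
    then have "good B S (emb B S)" unfolding emb_def by (rule someI)
    then show "baer (fst (emb B S))" "mhom R B (fst (emb B S)) (snd (emb B S))"
      "\<And>b. b \<in> carrier B \<Longrightarrow> snd (emb B S) b = \<zero>\<^bsub>fst (emb B S)\<^esub> \<longleftrightarrow> b \<in> S"
      by (simp_all add: good_def)
  qed
  define E0 e where "E0 = fst (emb N {\<zero>\<^bsub>N\<^esub>})" and "e = snd (emb N {\<zero>\<^bsub>N\<^esub>})"
  have E0: "baer E0" and e: "mhom R N E0 e" and ek: "\<And>b. b \<in> carrier N \<Longrightarrow> e b = \<zero>\<^bsub>E0\<^esub> \<longleftrightarrow> b = \<zero>\<^bsub>N\<^esub>"
    using emb[OF N zero_submod[OF N]] by (auto simp: E0_def e_def)
  \<comment> \<open>The state pairs the current term with the image of the preceding map, which has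
    to be the kernel of the next differential.\<close>
  define st where "st = rec_nat (E0, e ` carrier N) (\<lambda>_ (B, S). (fst (emb B S), snd (emb B S) ` carrier B))"
  define E where "E i = fst (st i)" for i
  define S where "S i = snd (st i)" for i
  define d where "d i = snd (emb (E i) (S i))" for i
  have st: "E 0 = E0" "S 0 = e ` carrier N" "E (Suc i) = fst (emb (E i) (S i))" "S (Suc i) = d i ` carrier (E i)" for i
    by (simp_all add: E_def S_def d_def st_def case_prod_beta)
  have inv: "baer (E i) \<and> submodule (S i) R (E i)" for i
  proof (induction i)
    case 0
    then show ?case using E0 image_submod[OF e N baer_module[OF E0]] by (simp add: st)
  next
    case (Suc i)
    note Bi = baer_module[OF conjunct1[OF Suc]]
    note em = emb[OF Bi conjunct2[OF Suc]]
    show ?case using em(1) image_submod[OF em(2) Bi baer_module[OF em(1)]] by (simp add: st d_def)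
  qed
  have dh: "mhom R (E i) (E (Suc i)) (d i)" and dk: "\<And>z. z \<in> carrier (E i) \<Longrightarrow> d i z = \<zero>\<^bsub>E (Suc i)\<^esub> \<longleftrightarrow> z \<in> S i" for i
    using emb[OF baer_module[OF conjunct1[OF inv[of i]]] conjunct2[OF inv[of i]]] by (simp_all add: st d_def)
  have "inj_on e (carrier N)" by (rule mhom_inj_onI[OF e N baer_module[OF E0]]) (use ek in blast)
  then have "baer_resolution N E d e"
    using inv dh dk[of _ 0, unfolded st(2)] dk[of _ "Suc _", unfolded st(4)] N e[folded st(1)]
      baer_module[OF conjunct1[OF inv]] by (simp add: baer_resolution_def resolution_def)
  then show ?thesis by blast
qed

lemma resolution_iso:
  assumes "resolution N E d e" "module R M" "mhom R M N f" "bij_betw f (carrier M) (carrier N)"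
  shows "resolution M E d (\<lambda>x. e (f x))"
proof -
  have "(\<lambda>x. e (f x)) ` carrier M = e ` carrier N"
    using image_image[of e f "carrier M"] assms(4) by (simp add: bij_betw_def)
  moreover have "inj_on (\<lambda>x. e (f x)) (carrier M)"
    using comp_inj_on[of f "carrier M" e] assms(4) resolutionD(5)[OF assms(1)] by (simp add: bij_betw_def o_def)
  ultimately show ?thesis using assms(1,2) mhom_compose[OF assms(3) resolutionD(4)[OF assms(1)]] by (simp add: resolution_def)
qed

text \<open>The recursion works inside the resolution type, so \<open>N\<close> is first copied
  there.\<close>

lemma ex_baer_resolution:
  fixes N :: "('a, 'n, 'm) module_scheme"
  assumes N: "module R N"
  shows "\<exists>(E :: nat \<Rightarrow> ('a, ('a, 'n) resolution_universe) module) d e. baer_resolution N E d e"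
proof -
  let ?j = "\<lambda>n. (\<lambda>_. Inl n) :: ('a, 'n) resolution_universe"
  have j: "inj_on ?j (carrier N)" using universe_inj(1) by (rule inj_on_subset) simp
  from transport_module[OF N this] obtain N' :: "('a, ('a, 'n) resolution_universe) module" where
    N': "module R N'" "mhom R N N' ?j" "carrier N' = ?j ` carrier N" by blast
  from ex_baer_resolution_universe[OF N'(1)] obtain E :: "nat \<Rightarrow> ('a, ('a, 'n) resolution_universe) module" and d e
    where "baer_resolution N' E d e" by blast
  then have "baer_resolution N E d (\<lambda>x. e (?j x))"
    unfolding baer_resolution_def using resolution_iso[OF _ N N'(2)] j N'(3) by (auto simp: bij_betw_def)
  then show ?thesis by blast
qed

lemma baer_resolution_imp_injective_resolution:
  assumes "baer_resolution N E d e"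
  shows "injective_resolution R N E (\<lambda>i. restrict (d i) (carrier (E i)))"
proof -
  note r = resolutionD[OF conjunct1[OF assms[unfolded baer_resolution_def]]]
  have b: "baer (E i)" for i using assms by (simp add: baer_resolution_def)
  have "\<exists>\<epsilon>\<in>mod_hom R N (E 0). inj_on \<epsilon> (carrier N) \<and>
      \<epsilon> ` carrier N = a_kernel (E 0) (E 1) (restrict (d 0) (carrier (E 0)))"
    using mhom_restrict_mod_hom[OF r(4,1)] r(5,6) mhom_closed[OF r(4)]
    by (intro bexI[of _ "restrict e (carrier N)"]) (auto simp: a_kernel_def' inj_on_def)
  moreover have "restrict (d i) (carrier (E i)) ` carrier (E i) =
      a_kernel (E (Suc i)) (E (Suc (Suc i))) (restrict (d (Suc i)) (carrier (E (Suc i))))" for i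
    using r(7)[of _ i] mhom_closed[OF r(3)] by (auto simp: a_kernel_def')
  ultimately show ?thesis
    using baer_imp_injective_module[OF b] mhom_restrict_mod_hom[OF r(3,2)] by (simp add: injective_resolution_def)
qed

lemma injective_resolution_imp_baer_resolution:
  fixes E :: "nat \<Rightarrow> ('a, ('a, 'n) resolution_universe) module"
  assumes N: "module R N" and r: "injective_resolution R N E d"
  shows "\<exists>e. baer_resolution N E d e"
proof -
  have b: "baer (E i)" for i
    using injective_module_imp_baer[OF universe_inj(2), of "E i"] r by (simp add: injective_resolution_def)
  obtain e where e: "e \<in> mod_hom R N (E 0)" "inj_on e (carrier N)" "e ` carrier N = a_kernel (E 0) (E 1) (d 0)"
    using r by (auto simp: injective_resolution_def)
  have "baer_resolution N E d e"
    using e r N b baer_module[OF b]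
    by (auto simp: baer_resolution_def resolution_def injective_resolution_def a_kernel_def' mod_hom_iff)
  then show ?thesis by blast
qed

text \<open>The chosen pair has the specified property only because some injective resolution exists
  on exactly this type.\<close>

lemma chosen_baer_resolution:
  fixes N :: "('a, 'n, 'm) module_scheme"
  assumes N: "module R N"
  obtains E d e where "chosen_injective_resolution R N = (E, d)" "baer_resolution N E d e"
proof -
  obtain E d where ch: "chosen_injective_resolution R N = (E, d)" by force
  obtain E' d' e' where "baer_resolution N (E' :: nat \<Rightarrow> ('a, ('a, 'n) resolution_universe) module) d' e'"
    using ex_baer_resolution[OF N] by blast
  then have "\<exists>p. case p of (E, d) \<Rightarrow> injective_resolution R N (E :: nat \<Rightarrow> ('a, ('a, 'n) resolution_universe) module) d"
    using baer_resolution_imp_injective_resolution by fastforce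
  from someI_ex[OF this] have "injective_resolution R N E d"
    using ch by (simp add: chosen_injective_resolution_def)
  then show ?thesis using injective_resolution_imp_baer_resolution[OF N] ch that by blast
qed

section \<open>Comparison of resolutions\<close>

text \<open>In each degree the right-hand side vanishes on the kernel of \<open>d i\<close> and so
  factors through \<open>d i\<close>. For \<open>k\<close> zero this produces chain maps; for
  \<open>k\<close> a chain map and \<open>\<delta>\<close> the negative differential it is the
  homotopy equation; the horseshoe lemma uses it for its off-diagonal entries.\<close>

lemma lift_chain:
  fixes C :: "nat \<Rightarrow> ('a, 'c) module" and I :: "nat \<Rightarrow> ('a, 'y) module"
  assumes C: "\<And>i. module R (C i)" and d: "\<And>i. mhom R (C i) (C (Suc i)) (d i)"
    and ex: "\<And>i z. z \<in> carrier (C (Suc i)) \<Longrightarrow> d (Suc i) z = \<zero>\<^bsub>C (Suc (Suc i))\<^esub> \<Longrightarrow> z \<in> d i ` carrier (C i)"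
    and J: "\<And>i. baer (I i)" and \<delta>: "\<And>i. mhom R (I i) (I (Suc i)) (\<delta> i)"
    and \<delta>\<delta>: "\<And>i z. z \<in> carrier (I i) \<Longrightarrow> \<delta> (Suc i) (\<delta> i z) = \<zero>\<^bsub>I (Suc (Suc i))\<^esub>"
    and k: "\<And>i. mhom R (C i) (I (Suc i)) (k i)"
    and kd: "\<And>i z. z \<in> carrier (C i) \<Longrightarrow> k (Suc i) (d i z) \<oplus>\<^bsub>I (Suc (Suc i))\<^esub> \<delta> (Suc i) (k i z) = \<zero>\<^bsub>I (Suc (Suc i))\<^esub>"
    and h0: "mhom R (C 0) (I 0) h0"
    and init: "\<And>z. z \<in> carrier (C 0) \<Longrightarrow> d 0 z = \<zero>\<^bsub>C (Suc 0)\<^esub> \<Longrightarrow> k 0 z \<oplus>\<^bsub>I (Suc 0)\<^esub> \<delta> 0 (h0 z) = \<zero>\<^bsub>I (Suc 0)\<^esub>"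
  shows "\<exists>h. h 0 = h0 \<and> (\<forall>i. mhom R (C i) (I i) (h i)) \<and>
    (\<forall>i. \<forall>z\<in>carrier (C i). h (Suc i) (d i z) = k i z \<oplus>\<^bsub>I (Suc i)\<^esub> \<delta> i (h i z))"
proof -
  note Im = baer_module[OF J]
  \<comment> \<open>The invariant \<open>P\<close> carries the vanishing that the next factorization
    needs and fixes the map in degree zero.\<close>
  define P where "P i h \<longleftrightarrow> (i = 0 \<longrightarrow> h = h0) \<and> mhom R (C i) (I i) h \<and>
    (\<forall>z\<in>carrier (C i). d i z = \<zero>\<^bsub>C (Suc i)\<^esub> \<longrightarrow> k i z \<oplus>\<^bsub>I (Suc i)\<^esub> \<delta> i (h z) = \<zero>\<^bsub>I (Suc i)\<^esub>)" for i h
  define Q where "Q i h h' \<longleftrightarrow> (\<forall>z\<in>carrier (C i). h' (d i z) = k i z \<oplus>\<^bsub>I (Suc i)\<^esub> \<delta> i (h z))" for i h and h' :: "'c \<Rightarrow> 'y"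
  have "\<exists>h. \<forall>n. P n (h n) \<and> Q n (h n) (h (Suc n))"
  proof (rule dependent_nat_choice)
    show "\<exists>h. P 0 h" using h0 init by (auto simp: P_def)
    fix h i assume P: "P i h"
    then have h: "mhom R (C i) (I i) h"
      and van: "\<And>z. z \<in> carrier (C i) \<Longrightarrow> d i z = \<zero>\<^bsub>C (Suc i)\<^esub> \<Longrightarrow> k i z \<oplus>\<^bsub>I (Suc i)\<^esub> \<delta> i (h z) = \<zero>\<^bsub>I (Suc i)\<^esub>"
      by (auto simp: P_def)
    have u: "mhom R (C i) (I (Suc i)) (\<lambda>z. k i z \<oplus>\<^bsub>I (Suc i)\<^esub> \<delta> i (h z))"
      by (intro mhom_lin k mhom_compose[OF h \<delta>] C Im)
    obtain h' where h': "mhom R (C (Suc i)) (I (Suc i)) h'"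
      and q: "\<And>z. z \<in> carrier (C i) \<Longrightarrow> h' (d i z) = k i z \<oplus>\<^bsub>I (Suc i)\<^esub> \<delta> i (h z)"
      using baer_factor[OF J C C d u van] by blast
    have "k (Suc i) w \<oplus>\<^bsub>I (Suc (Suc i))\<^esub> \<delta> (Suc i) (h' w) = \<zero>\<^bsub>I (Suc (Suc i))\<^esub>"
      if w: "w \<in> carrier (C (Suc i))" "d (Suc i) w = \<zero>\<^bsub>C (Suc (Suc i))\<^esub>" for w
    proof -
      obtain z where z: "z \<in> carrier (C i)" "w = d i z" using ex[OF w] by blast
      have hz: "h z \<in> carrier (I i)" using mhom_closed[OF h z(1)] .
      have "\<delta> (Suc i) (h' w) = \<delta> (Suc i) (k i z)"
        using q[OF z(1)] z mhom_add[OF \<delta>[of "Suc i"], of "k i z" "\<delta> i (h z)"] mhom_closed[OF k z(1)] mhom_closed[OF \<delta> hz]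
          \<delta>\<delta>[OF hz] mhom_closed[OF \<delta>[of "Suc i"]] Im by simp
      then show ?thesis using kd[OF z(1)] z by simp
    qed
    then show "\<exists>h'. P (Suc i) h' \<and> Q i h h'" using h' q by (intro exI[of _ h']) (simp add: P_def Q_def)
  qed
  then obtain h where "\<And>n. P n (h n)" "\<And>n. Q n (h n) (h (Suc n))" by blast
  then show ?thesis unfolding P_def Q_def by blast
qed

lemma baer_resolutionD:
  assumes "baer_resolution N E d e"
  shows "resolution N E d e" "baer (E i)"
  using assms by (auto simp: baer_resolution_def)

lemma chain_map:
  fixes N :: "('a, 'x, 'm) module_scheme"
  assumes r: "resolution N C d e" and r': "baer_resolution N E d' e'"
  obtains h where "\<And>i. mhom R (C i) (E i) (h i)" "\<And>i z. z \<in> carrier (C i) \<Longrightarrow> h (Suc i) (d i z) = d' i (h i z)"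
    "\<And>x. x \<in> carrier N \<Longrightarrow> h 0 (e x) = e' x"
proof -
  note R = resolutionD[OF r] and R' = resolutionD[OF baer_resolutionD(1)[OF r']] and J = baer_resolutionD(2)[OF r']
  obtain h0 where h0: "mhom R (C 0) (E 0) h0" "\<And>x. x \<in> carrier N \<Longrightarrow> h0 (e x) = e' x"
    using baer_factor[OF J R(1,2,4) R'(4)] mhom_inj_zero[OF R(4,1,2,5)] mhom_zero[OF R'(4,1,2)] by blast
  have "\<exists>h. h 0 = h0 \<and> (\<forall>i. mhom R (C i) (E i) (h i)) \<and>
    (\<forall>i. \<forall>z\<in>carrier (C i). h (Suc i) (d i z) = \<zero>\<^bsub>E (Suc i)\<^esub> \<oplus>\<^bsub>E (Suc i)\<^esub> d' i (h i z))"
  proof (rule lift_chain[OF R(2,3) _ J R'(3) _ mhom_const_zero[OF R'(2)] _ h0(1)])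
    fix z assume "z \<in> carrier (C 0)" "d 0 z = \<zero>\<^bsub>C (Suc 0)\<^esub>"
    then obtain x where "x \<in> carrier N" "z = e x" using R(6) by auto
    then show "\<zero>\<^bsub>E (Suc 0)\<^esub> \<oplus>\<^bsub>E (Suc 0)\<^esub> d' 0 (h0 z) = \<zero>\<^bsub>E (Suc 0)\<^esub>"
      using h0 resolution_dd(1)[OF baer_resolutionD(1)[OF r']] R'(2) by simp
  qed (use R(7) resolution_dd(2)[OF baer_resolutionD(1)[OF r']] mhom_zero[OF R'(3,2,2)] R'(2) in simp_all)
  then obtain h where h: "h 0 = h0" "\<And>i. mhom R (C i) (E i) (h i)"
    "\<And>i z. z \<in> carrier (C i) \<Longrightarrow> h (Suc i) (d i z) = \<zero>\<^bsub>E (Suc i)\<^esub> \<oplus>\<^bsub>E (Suc i)\<^esub> d' i (h i z)" by blast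
  show ?thesis
  proof (rule that[of h])
    show "h (Suc i) (d i z) = d' i (h i z)" if "z \<in> carrier (C i)" for i z
      using h(3)[OF that] mhom_closed[OF R'(3) mhom_closed[OF h(2) that]] R'(2) by simp
  qed (use h h0 in auto)
qed

text \<open>Since \<open>\<chi> 0\<close> kills the image of \<open>e\<close>, which is the kernel
  of \<open>d 0\<close>, it factors through \<open>d 0\<close>; this factor is the first homotopy
  map. The complex \<open>C\<close> then enters \<open>lift_chain\<close> shifted by one.\<close>

lemma null_homotopy:
  fixes N :: "('a, 'x, 'm) module_scheme"
  assumes r: "resolution N C d e" and r': "baer_resolution N' E d' e'"
    and \<chi>: "\<And>i. mhom R (C i) (E i) (\<chi> i)" and \<chi>d: "\<And>i z. z \<in> carrier (C i) \<Longrightarrow> \<chi> (Suc i) (d i z) = d' i (\<chi> i z)"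
    and \<chi>0: "\<And>x. x \<in> carrier N \<Longrightarrow> \<chi> 0 (e x) = \<zero>\<^bsub>E 0\<^esub>"
  obtains s where "\<And>i. mhom R (C (Suc i)) (E i) (s i)" "\<And>z. z \<in> carrier (C 0) \<Longrightarrow> \<chi> 0 z = s 0 (d 0 z)"
    "\<And>i z. z \<in> carrier (C (Suc i)) \<Longrightarrow> s (Suc i) (d (Suc i) z) = \<chi> (Suc i) z \<ominus>\<^bsub>E (Suc i)\<^esub> d' i (s i z)"
proof -
  note R = resolutionD[OF r] and R' = resolutionD[OF baer_resolutionD(1)[OF r']] and J = baer_resolutionD(2)[OF r']
  obtain s0 where s0: "mhom R (C (Suc 0)) (E 0) s0" "\<And>z. z \<in> carrier (C 0) \<Longrightarrow> s0 (d 0 z) = \<chi> 0 z"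
    using baer_factor[OF J R(2) R(2) R(3) \<chi>[of 0]] R(6) \<chi>0 by blast
  have "\<exists>h. h 0 = s0 \<and> (\<forall>i. mhom R (C (Suc i)) (E i) (h i)) \<and>
    (\<forall>i. \<forall>z\<in>carrier (C (Suc i)). h (Suc i) (d (Suc i) z) = \<chi> (Suc i) z \<oplus>\<^bsub>E (Suc i)\<^esub> \<ominus>\<^bsub>E (Suc i)\<^esub> d' i (h i z))"
  proof (rule lift_chain[OF R(2,3) _ J mhom_uminus[OF R'(3,2,2)] _ \<chi> _ s0(1)])
    fix z assume z: "z \<in> carrier (C (Suc 0))" "d (Suc 0) z = \<zero>\<^bsub>C (Suc (Suc 0))\<^esub>"
    then obtain y where y: "y \<in> carrier (C 0)" "z = d 0 y" using R(7) by auto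
    then show "\<chi> (Suc 0) z \<oplus>\<^bsub>E (Suc 0)\<^esub> \<ominus>\<^bsub>E (Suc 0)\<^esub> d' 0 (s0 z) = \<zero>\<^bsub>E (Suc 0)\<^esub>"
      using s0(2) \<chi>d[OF y(1)] mhom_closed[OF R'(3) mhom_closed[OF \<chi> y(1)]] R'(2) by simp
  next
    fix i z assume z: "z \<in> carrier (E i)"
    show "\<ominus>\<^bsub>E (Suc (Suc i))\<^esub> d' (Suc i) (\<ominus>\<^bsub>E (Suc i)\<^esub> d' i z) = \<zero>\<^bsub>E (Suc (Suc i))\<^esub>"
      using z mhom_neg[OF R'(3,2,2) mhom_closed[OF R'(3) z]] resolution_dd(2)[OF baer_resolutionD(1)[OF r'] z] R'(2) by simp
  next
    fix i z assume z: "z \<in> carrier (C (Suc i))"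
    show "\<chi> (Suc (Suc i)) (d (Suc i) z) \<oplus>\<^bsub>E (Suc (Suc i))\<^esub> \<ominus>\<^bsub>E (Suc (Suc i))\<^esub> d' (Suc i) (\<chi> (Suc i) z) = \<zero>\<^bsub>E (Suc (Suc i))\<^esub>"
      using \<chi>d[OF z] mhom_closed[OF R'(3) mhom_closed[OF \<chi> z]] R'(2) by simp
  qed (use R(7) in simp_all)
  then obtain h where h: "h 0 = s0" "\<And>i. mhom R (C (Suc i)) (E i) (h i)"
    "\<And>i z. z \<in> carrier (C (Suc i)) \<Longrightarrow> h (Suc i) (d (Suc i) z) = \<chi> (Suc i) z \<oplus>\<^bsub>E (Suc i)\<^esub> \<ominus>\<^bsub>E (Suc i)\<^esub> d' i (h i z)" by blast
  show ?thesis
    by (rule that[of h]) (use h s0 in \<open>auto simp: a_minus_def\<close>)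
qed

section \<open>Torsion and the vanishing of local cohomology\<close>

text \<open>In the applications \<open>X\<close> is a finite set of generators of an ideal \<open>\<aa>\<close>, so that \<open>torsion X C\<close> is
  the submodule of elements annihilated by a power of \<open>\<aa>\<close>.\<close>

definition torsion :: "'a set \<Rightarrow> ('a, 'x, 'm) module_scheme \<Rightarrow> 'x set" where
  "torsion X C = {z \<in> carrier C. \<forall>x\<in>X. \<exists>n::nat. (x [^] n) \<odot>\<^bsub>C\<^esub> z = \<zero>\<^bsub>C\<^esub>}"

lemma torsion_carrier: "z \<in> torsion X C \<Longrightarrow> z \<in> carrier C"
  by (simp add: torsion_def)

lemma pow_kills_mono:
  assumes "module R M" "x \<in> carrier R" "z \<in> carrier M" "(x [^] (n::nat)) \<odot>\<^bsub>M\<^esub> z = \<zero>\<^bsub>M\<^esub>" "n \<le> m"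
  shows "(x [^] m) \<odot>\<^bsub>M\<^esub> z = \<zero>\<^bsub>M\<^esub>"
proof -
  have "x [^] m = x [^] (m - n) \<otimes> x [^] n" using assms by (simp add: nat_pow_mult)
  then show ?thesis using assms by (simp add: mod_smult_assoc)
qed

lemma torsion_submod:
  assumes X: "X \<subseteq> carrier R" and M: "module R M"
  shows "submodule (torsion X M) R M"
proof (rule submodI[OF M])
  fix z w assume z: "z \<in> torsion X M" "w \<in> torsion X M"
  have "\<exists>n::nat. (x [^] n) \<odot>\<^bsub>M\<^esub> (z \<oplus>\<^bsub>M\<^esub> w) = \<zero>\<^bsub>M\<^esub>" if x: "x \<in> X" for x
  proof -
    obtain n m :: nat where "(x [^] n) \<odot>\<^bsub>M\<^esub> z = \<zero>\<^bsub>M\<^esub>" "(x [^] m) \<odot>\<^bsub>M\<^esub> w = \<zero>\<^bsub>M\<^esub>"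
      using z x unfolding torsion_def by blast
    then have "(x [^] (max n m)) \<odot>\<^bsub>M\<^esub> z = \<zero>\<^bsub>M\<^esub>" "(x [^] (max n m)) \<odot>\<^bsub>M\<^esub> w = \<zero>\<^bsub>M\<^esub>"
      using pow_kills_mono[OF M, of x z n "max n m"] pow_kills_mono[OF M, of x w m "max n m"] x X z
      by (auto simp: torsion_def)
    then show ?thesis using x X z M by (intro exI[of _ "max n m"]) (auto simp: mod_r_distr torsion_def)
  qed
  then show "z \<oplus>\<^bsub>M\<^esub> w \<in> torsion X M" using z M by (simp add: torsion_def)
next
  fix r z assume r: "r \<in> carrier R" and z: "z \<in> torsion X M"
  have eq: "(x [^] n) \<odot>\<^bsub>M\<^esub> (r \<odot>\<^bsub>M\<^esub> z) = r \<odot>\<^bsub>M\<^esub> ((x [^] n) \<odot>\<^bsub>M\<^esub> z)" if "x \<in> X" for x and n :: nat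
    using that X r z M by (auto simp: torsion_def m_comm simp flip: mod_smult_assoc)
  have "\<exists>n::nat. (x [^] n) \<odot>\<^bsub>M\<^esub> (r \<odot>\<^bsub>M\<^esub> z) = \<zero>\<^bsub>M\<^esub>" if x: "x \<in> X" for x
  proof -
    obtain n :: nat where "(x [^] n) \<odot>\<^bsub>M\<^esub> z = \<zero>\<^bsub>M\<^esub>" using z x by (auto simp: torsion_def)
    then show ?thesis using eq[OF x, of n] r M by auto
  qed
  then show "r \<odot>\<^bsub>M\<^esub> z \<in> torsion X M" using z r M by (simp add: torsion_def)
qed (use M X in \<open>auto simp: torsion_def\<close>)

lemma torsion_mhom:
  assumes X: "X \<subseteq> carrier R" and "mhom R A B f" "module R A" "module R B" "z \<in> torsion X A"
  shows "f z \<in> torsion X B"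
proof -
  have "\<exists>n::nat. (x [^] n) \<odot>\<^bsub>B\<^esub> f z = \<zero>\<^bsub>B\<^esub>" if x: "x \<in> X" for x
  proof -
    obtain n :: nat where "(x [^] n) \<odot>\<^bsub>A\<^esub> z = \<zero>\<^bsub>A\<^esub>" using x assms(5) by (auto simp: torsion_def)
    then have "(x [^] n) \<odot>\<^bsub>B\<^esub> f z = \<zero>\<^bsub>B\<^esub>"
      using mhom_smult[OF assms(2), of "x [^] n" z] mhom_zero[OF assms(2-4)] x X torsion_carrier[OF assms(5)] by auto
    then show ?thesis by blast
  qed
  then show ?thesis using assms mhom_closed[OF assms(2)] by (auto simp: torsion_def)
qed

lemma torsion_mhom_inj:
  assumes X: "X \<subseteq> carrier R" and "mhom R A B f" "module R A" "module R B" "inj_on f (carrier A)" "z \<in> carrier A" "f z \<in> torsion X B"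
  shows "z \<in> torsion X A"
proof -
  have "\<exists>n::nat. (x [^] n) \<odot>\<^bsub>A\<^esub> z = \<zero>\<^bsub>A\<^esub>" if x: "x \<in> X" for x
  proof -
    obtain n :: nat where n: "(x [^] n) \<odot>\<^bsub>B\<^esub> f z = \<zero>\<^bsub>B\<^esub>" using x assms(7) by (auto simp: torsion_def)
    then have "f ((x [^] n) \<odot>\<^bsub>A\<^esub> z) = \<zero>\<^bsub>B\<^esub>"
      using mhom_smult[OF assms(2), of "x [^] n" z] x X assms(6) by auto
    then have "(x [^] n) \<odot>\<^bsub>A\<^esub> z = \<zero>\<^bsub>A\<^esub>"
      using mhom_inj_zero[OF assms(2-5), of "(x [^] n) \<odot>\<^bsub>A\<^esub> z"] x X assms(3,6) by auto
    then show ?thesis by blast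
  qed
  then show ?thesis using assms(6) by (simp add: torsion_def)
qed

text \<open>Vanishing of the cohomology of the torsion subcomplex, stated on elements so that no
  quotient module is formed.\<close>

definition torsion_exact :: "'a set \<Rightarrow> (nat \<Rightarrow> ('a, 'c) module) \<Rightarrow> (nat \<Rightarrow> 'c \<Rightarrow> 'c) \<Rightarrow> nat \<Rightarrow> bool" where
  "torsion_exact X C d i \<longleftrightarrow> (\<forall>z\<in>torsion X (C i). d i z = \<zero>\<^bsub>C (Suc i)\<^esub> \<longrightarrow>
     (case i of 0 \<Rightarrow> z = \<zero>\<^bsub>C 0\<^esub> | Suc j \<Rightarrow> z \<in> d j ` torsion X (C j)))"

lemma torsion_exactD0: "torsion_exact X C d 0 \<Longrightarrow> z \<in> torsion X (C 0) \<Longrightarrow> d 0 z = \<zero>\<^bsub>C (Suc 0)\<^esub> \<Longrightarrow> z = \<zero>\<^bsub>C 0\<^esub>"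
  by (simp add: torsion_exact_def)

lemma torsion_exactDS: "torsion_exact X C d (Suc j) \<Longrightarrow> z \<in> torsion X (C (Suc j)) \<Longrightarrow> d (Suc j) z = \<zero>\<^bsub>C (Suc (Suc j))\<^esub> \<Longrightarrow> \<exists>y\<in>torsion X (C j). z = d j y"
  by (auto simp: torsion_exact_def)

text \<open>Comparison maps in both directions compose to a map homotopic to the identity. Linear
  maps preserve torsion, so these maps and the homotopy restrict to the torsion
  subcomplexes.\<close>

lemma torsion_exact_independent_aux:
  fixes N :: "('a, 'x, 'm) module_scheme"
  assumes X: "X \<subseteq> carrier R" and r: "baer_resolution N E d e" and r': "baer_resolution N E' d' e'" and t: "torsion_exact X E' d' i"
  shows "torsion_exact X E d i"
proof -
  note R = resolutionD[OF baer_resolutionD(1)[OF r]] and R' = resolutionD[OF baer_resolutionD(1)[OF r']]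
  obtain f where f: "\<And>i. mhom R (E i) (E' i) (f i)" "\<And>i z. z \<in> carrier (E i) \<Longrightarrow> f (Suc i) (d i z) = d' i (f i z)"
    "\<And>x. x \<in> carrier N \<Longrightarrow> f 0 (e x) = e' x" using chain_map[OF baer_resolutionD(1)[OF r] r'] by blast
  obtain g where g: "\<And>i. mhom R (E' i) (E i) (g i)" "\<And>i z. z \<in> carrier (E' i) \<Longrightarrow> g (Suc i) (d' i z) = d i (g i z)"
    "\<And>x. x \<in> carrier N \<Longrightarrow> g 0 (e' x) = e x" using chain_map[OF baer_resolutionD(1)[OF r'] r] by blast
  define \<chi> where "\<chi> i z = g i (f i z) \<ominus>\<^bsub>E i\<^esub> z" for i z
  have \<chi>h: "mhom R (E i) (E i) (\<chi> i)" for i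
    unfolding \<chi>_def by (intro mhom_diff mhom_compose[OF f(1) g(1)] R(2)) (auto simp: mhom_def)
  have fc: "\<And>i z. z \<in> carrier (E i) \<Longrightarrow> f i z \<in> carrier (E' i)" by (rule mhom_closed[OF f(1)])
  have gc: "\<And>i z. z \<in> carrier (E' i) \<Longrightarrow> g i z \<in> carrier (E i)" by (rule mhom_closed[OF g(1)])
  have dc: "\<And>i z. z \<in> carrier (E i) \<Longrightarrow> d i z \<in> carrier (E (Suc i))" by (rule mhom_closed[OF R(3)])
  have \<chi>d: "\<chi> (Suc i) (d i z) = d i (\<chi> i z)" if "z \<in> carrier (E i)" for i z
    unfolding \<chi>_def using that f(2) g(2) mhom_minus[OF R(3,2,2)] fc gc by simp
  have \<chi>0: "\<chi> 0 (e x) = \<zero>\<^bsub>E 0\<^esub>" if "x \<in> carrier N" for x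
    unfolding \<chi>_def using f(3) g(3) that mhom_closed[OF R(4)] R(2) by simp
  obtain s where s: "\<And>i. mhom R (E (Suc i)) (E i) (s i)" "\<And>z. z \<in> carrier (E 0) \<Longrightarrow> \<chi> 0 z = s 0 (d 0 z)"
    "\<And>i z. z \<in> carrier (E (Suc i)) \<Longrightarrow> s (Suc i) (d (Suc i) z) = \<chi> (Suc i) z \<ominus>\<^bsub>E (Suc i)\<^esub> d i (s i z)"
    using null_homotopy[OF baer_resolutionD(1)[OF r] r \<chi>h \<chi>d \<chi>0] by blast
  show ?thesis
    unfolding torsion_exact_def
  proof (intro ballI impI)
    fix z assume z: "z \<in> torsion X (E i)" "d i z = \<zero>\<^bsub>E (Suc i)\<^esub>"
    note zc = torsion_carrier[OF z(1)]
    have fz: "f i z \<in> torsion X (E' i)" by (rule torsion_mhom[OF X f(1) R(2) R'(2) z(1)])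
    have dfz: "d' i (f i z) = \<zero>\<^bsub>E' (Suc i)\<^esub>" using f(2)[OF zc] z(2) mhom_zero[OF f(1) R(2) R'(2)] by simp
    show "case i of 0 \<Rightarrow> z = \<zero>\<^bsub>E 0\<^esub> | Suc j \<Rightarrow> z \<in> d j ` torsion X (E j)"
    proof (cases i)
      case 0
      have "f 0 z = \<zero>\<^bsub>E' 0\<^esub>" using torsion_exactD0[of X E' d' "f 0 z"] t fz dfz 0 by simp
      then have "\<chi> 0 z = \<ominus>\<^bsub>E 0\<^esub> z" unfolding \<chi>_def using mhom_zero[OF g(1) R'(2) R(2)] zc 0 R(2) by (simp add: mod_minus_eq)
      moreover have "\<chi> 0 z = \<zero>\<^bsub>E 0\<^esub>" using s(2) z zc 0 mhom_zero[OF s(1) R(2) R(2)] by simp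
      ultimately have "\<ominus>\<^bsub>E 0\<^esub> (\<ominus>\<^bsub>E 0\<^esub> z) = \<ominus>\<^bsub>E 0\<^esub> \<zero>\<^bsub>E 0\<^esub>" by simp
      then have "z = \<zero>\<^bsub>E 0\<^esub>" using zc 0 R(2) by simp
      then show ?thesis using 0 by simp
    next
      case (Suc j)
      obtain y where y: "y \<in> torsion X (E' j)" "f i z = d' j y" using torsion_exactDS[of X E' d' j "f i z"] t fz dfz Suc by auto
      note yc = torsion_carrier[OF y(1)]
      have "s (Suc j) (d (Suc j) z) = \<zero>\<^bsub>E (Suc j)\<^esub>" using z Suc mhom_zero[OF s(1) R(2) R(2)] by simp
      then have "\<chi> (Suc j) z \<ominus>\<^bsub>E (Suc j)\<^esub> d j (s j z) = \<zero>\<^bsub>E (Suc j)\<^esub>" using s(3)[of z j] zc Suc by simp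
      then have 1: "\<chi> (Suc j) z = d j (s j z)"
        using zc Suc mhom_closed[OF \<chi>h] mhom_closed[OF s(1)] dc R(2) by (simp add: mod_minus_eq_zero)
      have 2: "\<chi> (Suc j) z = d j (g j y) \<ominus>\<^bsub>E (Suc j)\<^esub> z" unfolding \<chi>_def using y Suc g(2)[OF yc] by simp
      have sz: "s j z \<in> torsion X (E j)" using torsion_mhom[OF X s(1) R(2) R(2)] z Suc by simp
      have gy: "g j y \<in> torsion X (E j)" by (rule torsion_mhom[OF X g(1) R'(2) R(2) y(1)])
      have c: "z \<in> carrier (E (Suc j))" "d j (g j y) \<in> carrier (E (Suc j))" using zc Suc dc gc yc by auto
      \<comment> \<open>From \<open>f z = d' y\<close> and \<open>g (f z) - z = d (s z)\<close>, the
        torsion element \<open>g y - s z\<close> is a primitive of \<open>z\<close>.\<close>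
      have "z = d j (g j y) \<ominus>\<^bsub>E (Suc j)\<^esub> (d j (g j y) \<ominus>\<^bsub>E (Suc j)\<^esub> z)" using c R(2) by (simp add: mod_simps)
      also have "\<dots> = d j (g j y \<ominus>\<^bsub>E j\<^esub> s j z)"
        using 1 2 mhom_minus[OF R(3,2,2)] torsion_carrier[OF gy] torsion_carrier[OF sz] by simp
      finally show ?thesis using Suc submod_minus[OF R(2) torsion_submod[OF X R(2)] gy sz] by auto
    qed
  qed
qed

text \<open>Vanishing of local cohomology as a predicate: it compares modules on different types,
  whose cohomology modules have different types as well.\<close>

definition lc_zero :: "'a set \<Rightarrow> nat \<Rightarrow> ('a, 'x, 'm) module_scheme \<Rightarrow> bool" where
  "lc_zero X i N \<longleftrightarrow> (case chosen_injective_resolution R N of (E, d) \<Rightarrow> torsion_exact X E d i)"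

lemma lc_zero_iff_torsion_exact:
  assumes X: "X \<subseteq> carrier R" and r: "baer_resolution N E d e"
  shows "lc_zero X i N \<longleftrightarrow> torsion_exact X E d i"
proof -
  note N = resolutionD(1)[OF baer_resolutionD(1)[OF r]]
  obtain E' d' e' where ch: "chosen_injective_resolution R N = (E', d')" and r': "baer_resolution N E' d' e'"
    using chosen_baer_resolution[OF N] by blast
  show ?thesis using torsion_exact_independent_aux[OF X r r'] torsion_exact_independent_aux[OF X r' r] ch by (auto simp: lc_zero_def)
qed

section \<open>Long exact sequences\<close>

definition dsum :: "('a, 'x) module \<Rightarrow> ('a, 'y) module \<Rightarrow> ('a, 'x \<times> 'y) module" where
  "dsum A B = \<lparr>carrier = carrier A \<times> carrier B, monoid.mult = (\<lambda>x y. undefined), one = undefined,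
     zero = (\<zero>\<^bsub>A\<^esub>, \<zero>\<^bsub>B\<^esub>), add = (\<lambda>(a, b) (a', b'). (a \<oplus>\<^bsub>A\<^esub> a', b \<oplus>\<^bsub>B\<^esub> b')),
     smult = (\<lambda>r (a, b). (r \<odot>\<^bsub>A\<^esub> a, r \<odot>\<^bsub>B\<^esub> b))\<rparr>"

lemma dsum_simps [simp]:
  "carrier (dsum A B) = carrier A \<times> carrier B" "\<zero>\<^bsub>dsum A B\<^esub> = (\<zero>\<^bsub>A\<^esub>, \<zero>\<^bsub>B\<^esub>)"
  "(a, b) \<oplus>\<^bsub>dsum A B\<^esub> (a', b') = (a \<oplus>\<^bsub>A\<^esub> a', b \<oplus>\<^bsub>B\<^esub> b')" "r \<odot>\<^bsub>dsum A B\<^esub> (a, b) = (r \<odot>\<^bsub>A\<^esub> a, r \<odot>\<^bsub>B\<^esub> b)"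
  by (simp_all add: dsum_def)

lemma dsum_module:
  assumes A: "module R A" and B: "module R B" shows "module R (dsum A B)"
proof (rule moduleI[OF is_cring])
  show "abelian_group (dsum A B)"
  proof (rule abelian_groupI)
    fix x assume "x \<in> carrier (dsum A B)"
    then show "\<exists>y\<in>carrier (dsum A B). y \<oplus>\<^bsub>dsum A B\<^esub> x = \<zero>\<^bsub>dsum A B\<^esub>"
      using A B by (intro bexI[of _ "(\<ominus>\<^bsub>A\<^esub> fst x, \<ominus>\<^bsub>B\<^esub> snd x)"]) auto
  qed (use A B in \<open>auto simp: mod_ac\<close>)
qed (use A B in \<open>auto simp: mod_l_distr mod_r_distr mod_smult_assoc\<close>)

lemma dsum_baer:
  assumes A: "baer A" and B: "baer B" shows "baer (dsum A B)"
  unfolding baer_def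
proof (intro conjI allI impI)
  show "module R (dsum A B)" by (rule dsum_module[OF baer_module[OF A] baer_module[OF B]])
  fix I f assume I: "ideal I R" and f: "mhom R (ideal_module I) (dsum A B) f"
  have c: "f x \<in> carrier A \<times> carrier B" if "x \<in> I" for x using mhom_closed[OF f] that by simp
  have p: "fst (u \<oplus>\<^bsub>dsum A B\<^esub> v) = fst u \<oplus>\<^bsub>A\<^esub> fst v" "snd (u \<oplus>\<^bsub>dsum A B\<^esub> v) = snd u \<oplus>\<^bsub>B\<^esub> snd v"
    "fst (r \<odot>\<^bsub>dsum A B\<^esub> v) = r \<odot>\<^bsub>A\<^esub> fst v" "snd (r \<odot>\<^bsub>dsum A B\<^esub> v) = r \<odot>\<^bsub>B\<^esub> snd v" for u v r
    by (simp_all add: dsum_def case_prod_beta)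
  have "mhom R (ideal_module I) A (\<lambda>x. fst (f x))" "mhom R (ideal_module I) B (\<lambda>x. snd (f x))"
    using mhom_add[OF f] mhom_smult[OF f] c by (auto simp: mhom_def p mem_Times_iff)
  then obtain a b where "a \<in> carrier A" "b \<in> carrier B" "\<forall>r\<in>I. fst (f r) = r \<odot>\<^bsub>A\<^esub> a" "\<forall>r\<in>I. snd (f r) = r \<odot>\<^bsub>B\<^esub> b"
    using baerD[OF A I] baerD[OF B I] by meson
  then show "\<exists>e\<in>carrier (dsum A B). \<forall>r\<in>I. f r = r \<odot>\<^bsub>dsum A B\<^esub> e"
    by (intro bexI[of _ "(a, b)"]) (auto simp: prod_eq_iff)
qed

lemma torsion_dsum:
  assumes X: "X \<subseteq> carrier R" and A: "module R A" and B: "module R B"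
  shows "(u, v) \<in> torsion X (dsum A B) \<longleftrightarrow> u \<in> torsion X A \<and> v \<in> torsion X B"
proof
  assume "(u, v) \<in> torsion X (dsum A B)" then show "u \<in> torsion X A \<and> v \<in> torsion X B" by (fastforce simp: torsion_def)
next
  assume uv: "u \<in> torsion X A \<and> v \<in> torsion X B"
  have "(u, \<zero>\<^bsub>B\<^esub>) \<in> torsion X (dsum A B)"
    by (rule torsion_mhom[OF X, of A _ "\<lambda>u. (u, \<zero>\<^bsub>B\<^esub>)"]) (use uv A B dsum_module[OF A B] in \<open>auto simp: mhom_def\<close>)
  moreover have "(\<zero>\<^bsub>A\<^esub>, v) \<in> torsion X (dsum A B)"
    by (rule torsion_mhom[OF X, of B _ "\<lambda>v. (\<zero>\<^bsub>A\<^esub>, v)"]) (use uv A B dsum_module[OF A B] in \<open>auto simp: mhom_def\<close>)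
  ultimately have "(u, \<zero>\<^bsub>B\<^esub>) \<oplus>\<^bsub>dsum A B\<^esub> (\<zero>\<^bsub>A\<^esub>, v) \<in> torsion X (dsum A B)"
    by (rule submod_add[OF dsum_module[OF A B] torsion_submod[OF X dsum_module[OF A B]]])
  then show "(u, v) \<in> torsion X (dsum A B)" using uv A B by (auto simp: torsion_carrier)
qed

lemma sesD:
  assumes "ses A B C f g"
  shows "module R A" "module R B" "module R C" "mhom R A B f" "mhom R B C g"
    "inj_on f (carrier A)" "g ` carrier B = carrier C"
    "b \<in> carrier B \<Longrightarrow> g b = \<zero>\<^bsub>C\<^esub> \<longleftrightarrow> b \<in> f ` carrier A"
  using assms by (auto simp: ses_def)

text \<open>The differential of the middle resolution is upper triangular; \<open>\<theta>\<close> is its off-diagonal entry.\<close>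

lemma horseshoe:
  fixes EA :: "nat \<Rightarrow> ('a, 'p) module" and EC :: "nat \<Rightarrow> ('a, 'q) module"
  assumes s: "ses A B C f g" and rA: "baer_resolution A EA dA eA" and rC: "baer_resolution C EC dC eC"
  obtains \<theta> t where "\<And>i. mhom R (EC i) (EA (Suc i)) (\<theta> i)" "mhom R B (EA 0) t"
    "\<And>i v. v \<in> carrier (EC i) \<Longrightarrow> \<theta> (Suc i) (dC i v) = \<ominus>\<^bsub>EA (Suc (Suc i))\<^esub> dA (Suc i) (\<theta> i v)"
    "\<And>b. b \<in> carrier B \<Longrightarrow> \<theta> 0 (eC (g b)) = \<ominus>\<^bsub>EA (Suc 0)\<^esub> dA 0 (t b)"
    "\<And>a. a \<in> carrier A \<Longrightarrow> t (f a) = eA a"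
    "baer_resolution B (\<lambda>i. dsum (EA i) (EC i)) (\<lambda>i (u, v). (dA i u \<oplus>\<^bsub>EA (Suc i)\<^esub> \<theta> i v, dC i v)) (\<lambda>b. (t b, eC (g b)))"
proof -
  note S = sesD[OF s]
  note A = resolutionD[OF baer_resolutionD(1)[OF rA]] and JA = baer_resolutionD(2)[OF rA] and ddA = resolution_dd[OF baer_resolutionD(1)[OF rA]]
  note C = resolutionD[OF baer_resolutionD(1)[OF rC]] and JC = baer_resolutionD(2)[OF rC] and ddC = resolution_dd[OF baer_resolutionD(1)[OF rC]]
  have Ac: "\<And>i u. u \<in> carrier (EA i) \<Longrightarrow> dA i u \<in> carrier (EA (Suc i))" by (rule mhom_closed[OF A(3)])
  have Cc: "\<And>i u. u \<in> carrier (EC i) \<Longrightarrow> dC i u \<in> carrier (EC (Suc i))" by (rule mhom_closed[OF C(3)])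
  have eAc: "\<And>a. a \<in> carrier A \<Longrightarrow> eA a \<in> carrier (EA 0)" by (rule mhom_closed[OF A(4)])
  have eCc: "\<And>a. a \<in> carrier C \<Longrightarrow> eC a \<in> carrier (EC 0)" by (rule mhom_closed[OF C(4)])
  have gc: "\<And>b. b \<in> carrier B \<Longrightarrow> g b \<in> carrier C" by (rule mhom_closed[OF S(5)])
  have gs: "\<And>c. c \<in> carrier C \<Longrightarrow> \<exists>b\<in>carrier B. c = g b" unfolding S(7)[symmetric] by auto
  have fc: "\<And>b. b \<in> carrier A \<Longrightarrow> f b \<in> carrier B" by (rule mhom_closed[OF S(4)])
  have gf: "\<And>a. a \<in> carrier A \<Longrightarrow> g (f a) = \<zero>\<^bsub>C\<^esub>" using S(8) fc by blast
  obtain t where t: "mhom R B (EA 0) t" "\<And>a. a \<in> carrier A \<Longrightarrow> t (f a) = eA a"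
    using baer_factor[OF JA S(1,2,4) A(4)] mhom_inj_zero[OF S(4,1,2,6)] mhom_zero[OF A(4,1,2)] by blast
  have tc: "\<And>b. b \<in> carrier B \<Longrightarrow> t b \<in> carrier (EA 0)" by (rule mhom_closed[OF t(1)])
  have eg: "mhom R B (EC 0) (\<lambda>b. eC (g b))" by (rule mhom_compose[OF S(5) C(4)])
  have eg0: "eC (g b) = \<zero>\<^bsub>EC 0\<^esub> \<longleftrightarrow> b \<in> f ` carrier A" if "b \<in> carrier B" for b
    using mhom_inj_zero[OF C(4,1,2,5) gc[OF that]] S(8)[OF that] by simp
  \<comment> \<open>\<open>\<theta>0\<close> has to cancel \<open>dA 0 (t b)\<close> in the first
    component. It exists because \<open>eC (g b) = 0\<close> puts \<open>b\<close> in the image of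
    \<open>f\<close>, where \<open>t\<close> agrees with \<open>eA\<close>.\<close>
  obtain \<theta>0 where \<theta>0: "mhom R (EC 0) (EA (Suc 0)) \<theta>0"
    "\<And>b. b \<in> carrier B \<Longrightarrow> \<theta>0 (eC (g b)) = \<ominus>\<^bsub>EA (Suc 0)\<^esub> dA 0 (t b)"
  proof -
    have u: "mhom R B (EA (Suc 0)) (\<lambda>b. \<ominus>\<^bsub>EA (Suc 0)\<^esub> dA 0 (t b))"
      by (rule mhom_uminus[OF mhom_compose[OF t(1) A(3)] S(2) A(2)])
    have "\<ominus>\<^bsub>EA (Suc 0)\<^esub> dA 0 (t b) = \<zero>\<^bsub>EA (Suc 0)\<^esub>" if "b \<in> carrier B" "eC (g b) = \<zero>\<^bsub>EC 0\<^esub>" for b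
      using eg0[OF that(1)] that t(2) ddA(1) A(2) by auto
    from baer_factor[OF JA S(2) C(2) eg u this] show ?thesis using that by blast
  qed
  \<comment> \<open>The recursion is \<open>\<theta> dC = - dA \<theta>\<close>, which is what makes
    the square of the triangular differential vanish.\<close>
  have "\<exists>h. h 0 = \<theta>0 \<and> (\<forall>i. mhom R (EC i) (EA (Suc i)) (h i)) \<and>
    (\<forall>i. \<forall>z\<in>carrier (EC i). h (Suc i) (dC i z) = \<zero>\<^bsub>EA (Suc (Suc i))\<^esub> \<oplus>\<^bsub>EA (Suc (Suc i))\<^esub> \<ominus>\<^bsub>EA (Suc (Suc i))\<^esub> dA (Suc i) (h i z))"
  proof (rule lift_chain[OF C(2,3) _ JA mhom_uminus[OF A(3,2,2)] _ mhom_const_zero[OF A(2)] _ \<theta>0(1)])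
    fix z assume z: "z \<in> carrier (EC 0)" "dC 0 z = \<zero>\<^bsub>EC (Suc 0)\<^esub>"
    then obtain c where c: "c \<in> carrier C" "z = eC c" using C(6) by auto
    then obtain b where b: "b \<in> carrier B" "z = eC (g b)" using gs[OF c(1)] by auto
    have "dA (Suc 0) (\<ominus>\<^bsub>EA (Suc 0)\<^esub> dA 0 (t b)) = \<zero>\<^bsub>EA (Suc (Suc 0))\<^esub>"
      using mhom_neg[OF A(3,2,2)] Ac tc[OF b(1)] ddA(2) A(2) by simp
    then show "\<zero>\<^bsub>EA (Suc (Suc 0))\<^esub> \<oplus>\<^bsub>EA (Suc (Suc 0))\<^esub> \<ominus>\<^bsub>EA (Suc (Suc 0))\<^esub> dA (Suc 0) (\<theta>0 z) = \<zero>\<^bsub>EA (Suc (Suc 0))\<^esub>"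
      using b \<theta>0(2) A(2) by simp
  next
    fix i z assume z: "z \<in> carrier (EA (Suc i))"
    show "\<ominus>\<^bsub>EA (Suc (Suc (Suc i)))\<^esub> dA (Suc (Suc i)) (\<ominus>\<^bsub>EA (Suc (Suc i))\<^esub> dA (Suc i) z) = \<zero>\<^bsub>EA (Suc (Suc (Suc i)))\<^esub>"
      using z mhom_neg[OF A(3,2,2)] Ac ddA(2) A(2) by simp
  qed (use C(7) mhom_zero[OF A(3,2,2)] A(2) in simp_all)
  then obtain \<theta> where \<theta>: "\<theta> 0 = \<theta>0" "\<And>i. mhom R (EC i) (EA (Suc i)) (\<theta> i)"
    "\<And>i z. z \<in> carrier (EC i) \<Longrightarrow> \<theta> (Suc i) (dC i z) = \<zero>\<^bsub>EA (Suc (Suc i))\<^esub> \<oplus>\<^bsub>EA (Suc (Suc i))\<^esub> \<ominus>\<^bsub>EA (Suc (Suc i))\<^esub> dA (Suc i) (\<theta> i z)"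
    by blast
  have \<theta>c: "\<And>i v. v \<in> carrier (EC i) \<Longrightarrow> \<theta> i v \<in> carrier (EA (Suc i))" by (rule mhom_closed[OF \<theta>(2)])
  have \<theta>d: "\<theta> (Suc i) (dC i v) = \<ominus>\<^bsub>EA (Suc (Suc i))\<^esub> dA (Suc i) (\<theta> i v)" if "v \<in> carrier (EC i)" for i v
    using \<theta>(3)[OF that] \<theta>c[OF that] Ac A(2) by simp
  let ?E = "\<lambda>i. dsum (EA i) (EC i)" and ?D = "\<lambda>i (u, v). (dA i u \<oplus>\<^bsub>EA (Suc i)\<^esub> \<theta> i v, dC i v)"
  let ?e = "\<lambda>b. (t b, eC (g b))"
  have Em: "module R (?E i)" for i by (rule dsum_module[OF A(2) C(2)])
  have De: "?D 0 (?e b) = \<zero>\<^bsub>?E (Suc 0)\<^esub>" if b: "b \<in> carrier B" for b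
    using \<theta>0(2)[OF b] \<theta>(1) Ac tc[OF b] ddC(1) gc[OF b] A(2) by simp
  have DD: "?D (Suc i) (?D i z) = \<zero>\<^bsub>?E (Suc (Suc i))\<^esub>" if asm: "z \<in> carrier (?E i)" for i z
  proof -
    obtain u v where z: "z = (u, v)" "u \<in> carrier (EA i)" "v \<in> carrier (EC i)" using asm by auto
    show ?thesis using z mhom_add[OF A(3)] Ac \<theta>c \<theta>d ddA(2) ddC(2) A(2) by simp
  qed
  have ex0: "z \<in> ?e ` carrier B" if asm: "z \<in> carrier (?E 0)" "?D 0 z = \<zero>\<^bsub>?E (Suc 0)\<^esub>" for z
  proof -
    obtain u v where z: "z = (u, v)" "u \<in> carrier (EA 0)" "v \<in> carrier (EC 0)" using asm by auto
    have dv: "dC 0 v = \<zero>\<^bsub>EC (Suc 0)\<^esub>" and du: "dA 0 u \<oplus>\<^bsub>EA (Suc 0)\<^esub> \<theta> 0 v = \<zero>\<^bsub>EA (Suc 0)\<^esub>" using asm z by auto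
    obtain c where c: "c \<in> carrier C" "v = eC c" using C(6) z dv by auto
    then obtain b where b: "b \<in> carrier B" "v = eC (g b)" using gs[OF c(1)] by auto
    have "dA 0 (u \<ominus>\<^bsub>EA 0\<^esub> t b) = \<zero>\<^bsub>EA (Suc 0)\<^esub>"
      using du \<theta>0(2)[OF b(1)] \<theta>(1) b z Ac tc[OF b(1)] mhom_minus[OF A(3,2,2)] A(2) by (simp add: mod_minus_eq)
    then obtain a where a: "a \<in> carrier A" "u \<ominus>\<^bsub>EA 0\<^esub> t b = eA a"
      using A(6)[of "u \<ominus>\<^bsub>EA 0\<^esub> t b"] z tc[OF b(1)] A(2) by auto
    have "t (f a \<oplus>\<^bsub>B\<^esub> b) = u"
      using mhom_add[OF t(1) fc[OF a(1)] b(1)] t(2)[OF a(1)] mod_eq_from_minus[OF A(2) z(2) tc[OF b(1)] a(2)] by simp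
    moreover have "g (f a \<oplus>\<^bsub>B\<^esub> b) = g b"
      using mhom_add[OF S(5) fc[OF a(1)] b(1)] gf[OF a(1)] gc[OF b(1)] S(3) by simp
    moreover have "f a \<oplus>\<^bsub>B\<^esub> b \<in> carrier B" using fc[OF a(1)] b(1) S(2) by simp
    ultimately show ?thesis using z b by (intro image_eqI[of _ _ "f a \<oplus>\<^bsub>B\<^esub> b"]) auto
  qed
  have exS: "z \<in> ?D i ` carrier (?E i)" if asm: "z \<in> carrier (?E (Suc i))" "?D (Suc i) z = \<zero>\<^bsub>?E (Suc (Suc i))\<^esub>" for z i
  proof -
    obtain u v where z: "z = (u, v)" "u \<in> carrier (EA (Suc i))" "v \<in> carrier (EC (Suc i))" using asm by auto
    have dv: "dC (Suc i) v = \<zero>\<^bsub>EC (Suc (Suc i))\<^esub>"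
      and du: "dA (Suc i) u \<oplus>\<^bsub>EA (Suc (Suc i))\<^esub> \<theta> (Suc i) v = \<zero>\<^bsub>EA (Suc (Suc i))\<^esub>" using asm z by auto
    obtain w where w: "w \<in> carrier (EC i)" "v = dC i w" using C(7) z dv by auto
    have "dA (Suc i) (u \<ominus>\<^bsub>EA (Suc i)\<^esub> \<theta> i w) = \<zero>\<^bsub>EA (Suc (Suc i))\<^esub>"
      using du \<theta>d[OF w(1)] w z Ac \<theta>c[OF w(1)] mhom_minus[OF A(3,2,2)] A(2) by (simp add: mod_minus_eq)
    then obtain y where y: "y \<in> carrier (EA i)" "u \<ominus>\<^bsub>EA (Suc i)\<^esub> \<theta> i w = dA i y"
      using A(7)[of "u \<ominus>\<^bsub>EA (Suc i)\<^esub> \<theta> i w"] z \<theta>c[OF w(1)] A(2) by auto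
    have "u = dA i y \<oplus>\<^bsub>EA (Suc i)\<^esub> \<theta> i w" by (rule mod_eq_from_minus[OF A(2) z(2) \<theta>c[OF w(1)] y(2)])
    then show ?thesis using z w y by (intro image_eqI[of _ _ "(y, w)"]) auto
  qed
  have eh: "mhom R B (?E 0) ?e" using t(1) eg by (auto simp: mhom_def)
  have ei: "inj_on ?e (carrier B)"
  proof (rule mhom_inj_onI[OF eh S(2) Em])
    fix b assume b: "b \<in> carrier B" "?e b = \<zero>\<^bsub>?E 0\<^esub>"
    then obtain a where a: "a \<in> carrier A" "b = f a" using eg0 by auto
    then have "eA a = \<zero>\<^bsub>EA 0\<^esub>" using b t(2) by simp
    then show "b = \<zero>\<^bsub>B\<^esub>" using a mhom_inj_zero[OF A(4,1,2,5)] mhom_zero[OF S(4,1,2)] by auto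
  qed
  have Dh: "mhom R (?E i) (?E (Suc i)) (?D i)" for i
    using mhom_add[OF A(3)] mhom_add[OF C(3)] mhom_add[OF \<theta>(2)] mhom_smult[OF A(3)] mhom_smult[OF C(3)] mhom_smult[OF \<theta>(2)] Ac Cc \<theta>c A(2)
    by (auto simp: mhom_def mod_ac mod_r_distr)
  have "resolution B ?E ?D ?e"
    unfolding resolution_def
  proof (intro conjI allI ballI)
    show "?D 0 z = \<zero>\<^bsub>?E (Suc 0)\<^esub> \<longleftrightarrow> z \<in> ?e ` carrier B" if asm: "z \<in> carrier (?E 0)" for z
      using ex0[OF that] De by blast
    show "?D (Suc i) z = \<zero>\<^bsub>?E (Suc (Suc i))\<^esub> \<longleftrightarrow> z \<in> ?D i ` carrier (?E i)" if "z \<in> carrier (?E (Suc i))" for i z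
      using exS[OF that] DD by blast
  qed (use S Em Dh eh ei in auto)
  then have "baer_resolution B ?E ?D ?e" using dsum_baer[OF JA JC] by (simp add: baer_resolution_def)
  then show ?thesis using that[of \<theta> t] \<theta>(1,2) \<theta>d \<theta>0(2) t by simp
qed

text \<open>In the horseshoe resolution of \<open>B\<close> the entry \<open>\<theta>\<close>
  anticommutes with the differentials and preserves torsion, so it induces the connecting
  homomorphism. Besides three vanishing implications, the last two clauses express the end of the
  sequence where the torsion of \<open>B\<close> and \<open>C\<close> meets the first local
  cohomology of \<open>A\<close>.\<close>

lemma les:
  assumes X: "X \<subseteq> carrier R" and s: "ses A B C f g"
  shows les_C: "lc_zero X i B \<Longrightarrow> lc_zero X (Suc i) A \<Longrightarrow> lc_zero X i C"
    and les_B: "lc_zero X i A \<Longrightarrow> lc_zero X i C \<Longrightarrow> lc_zero X i B"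
    and les_A: "lc_zero X i C \<Longrightarrow> lc_zero X (Suc i) B \<Longrightarrow> lc_zero X (Suc i) A"
    and les_surj: "lc_zero X (Suc 0) A \<Longrightarrow> c \<in> torsion X C \<Longrightarrow> c \<in> g ` torsion X B"
    and les_A1: "lc_zero X (Suc 0) B \<Longrightarrow> (\<And>c. c \<in> torsion X C \<Longrightarrow> c \<in> g ` torsion X B) \<Longrightarrow> lc_zero X (Suc 0) A"
proof -
  note S = sesD[OF s]
  obtain EA dA eA where "chosen_injective_resolution R A = (EA, dA)" and rA: "baer_resolution A EA dA eA"
    by (rule chosen_baer_resolution[OF S(1)])
  obtain EC dC eC where "chosen_injective_resolution R C = (EC, dC)" and rC: "baer_resolution C EC dC eC"
    by (rule chosen_baer_resolution[OF S(3)])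
  obtain \<theta> t where \<theta>: "\<And>i. mhom R (EC i) (EA (Suc i)) (\<theta> i)" and t: "mhom R B (EA 0) t"
    and \<theta>d: "\<And>i v. v \<in> carrier (EC i) \<Longrightarrow> \<theta> (Suc i) (dC i v) = \<ominus>\<^bsub>EA (Suc (Suc i))\<^esub> dA (Suc i) (\<theta> i v)"
    and \<theta>0: "\<And>b. b \<in> carrier B \<Longrightarrow> \<theta> 0 (eC (g b)) = \<ominus>\<^bsub>EA (Suc 0)\<^esub> dA 0 (t b)"
    and tf: "\<And>a. a \<in> carrier A \<Longrightarrow> t (f a) = eA a"
    and rB: "baer_resolution B (\<lambda>i. dsum (EA i) (EC i)) (\<lambda>i (u, v). (dA i u \<oplus>\<^bsub>EA (Suc i)\<^esub> \<theta> i v, dC i v)) (\<lambda>b. (t b, eC (g b)))"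
    by (rule horseshoe[OF s rA rC]) (rule that)
  note A = resolutionD[OF baer_resolutionD(1)[OF rA]] and ddA = resolution_dd[OF baer_resolutionD(1)[OF rA]]
  note C = resolutionD[OF baer_resolutionD(1)[OF rC]] and ddC = resolution_dd[OF baer_resolutionD(1)[OF rC]]
  let ?E = "\<lambda>i. dsum (EA i) (EC i)" and ?D = "\<lambda>i (u, v). (dA i u \<oplus>\<^bsub>EA (Suc i)\<^esub> \<theta> i v, dC i v)"
  have lA: "lc_zero X i A \<longleftrightarrow> torsion_exact X EA dA i" and lB: "lc_zero X i B \<longleftrightarrow> torsion_exact X ?E ?D i" and lC: "lc_zero X i C \<longleftrightarrow> torsion_exact X EC dC i" for i
    using lc_zero_iff_torsion_exact[OF X rA] lc_zero_iff_torsion_exact[OF X rB] lc_zero_iff_torsion_exact[OF X rC] by auto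
  note [simp] = A(2) C(2) torsion_dsum[OF X A(2) C(2)]
  have Ac [simp]: "\<And>i u. u \<in> carrier (EA i) \<Longrightarrow> dA i u \<in> carrier (EA (Suc i))" by (rule mhom_closed[OF A(3)])
  have [simp]: "\<And>i u. u \<in> carrier (EC i) \<Longrightarrow> dC i u \<in> carrier (EC (Suc i))" by (rule mhom_closed[OF C(3)])
  have \<theta>c [simp]: "\<And>i u. u \<in> carrier (EC i) \<Longrightarrow> \<theta> i u \<in> carrier (EA (Suc i))" by (rule mhom_closed[OF \<theta>])
  have \<theta>t: "\<And>i u. u \<in> torsion X (EC i) \<Longrightarrow> \<theta> i u \<in> torsion X (EA (Suc i))" by (rule torsion_mhom[OF X \<theta> C(2) A(2)])
  have At: "\<And>i u. u \<in> torsion X (EA i) \<Longrightarrow> dA i u \<in> torsion X (EA (Suc i))" by (rule torsion_mhom[OF X A(3,2,2)])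
  have [simp]: "\<And>i. \<theta> i \<zero>\<^bsub>EC i\<^esub> = \<zero>\<^bsub>EA (Suc i)\<^esub>" by (rule mhom_zero[OF \<theta> C(2) A(2)])
  have [simp]: "\<And>i. dC i \<zero>\<^bsub>EC i\<^esub> = \<zero>\<^bsub>EC (Suc i)\<^esub>" by (rule mhom_zero[OF C(3,2,2)])
  have dAminus: "\<And>i u v. u \<in> carrier (EA i) \<Longrightarrow> v \<in> carrier (EA i) \<Longrightarrow> dA i (u \<ominus>\<^bsub>EA i\<^esub> v) = dA i u \<oplus>\<^bsub>EA (Suc i)\<^esub> \<ominus>\<^bsub>EA (Suc i)\<^esub> dA i v"
    using mhom_minus[OF A(3,2,2)] by (simp add: mod_minus_eq)
  have dAneg: "\<And>i u. u \<in> carrier (EA i) \<Longrightarrow> dA i (\<ominus>\<^bsub>EA i\<^esub> u) = \<ominus>\<^bsub>EA (Suc i)\<^esub> dA i u"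
    by (rule mhom_neg[OF A(3,2,2)])
  have tm: "\<And>i u v. u \<in> torsion X (EA i) \<Longrightarrow> v \<in> torsion X (EA i) \<Longrightarrow> u \<ominus>\<^bsub>EA i\<^esub> v \<in> torsion X (EA i)"
    by (rule submod_minus[OF A(2) torsion_submod[OF X A(2)]])
  have tn: "\<And>i u. u \<in> torsion X (EA i) \<Longrightarrow> \<ominus>\<^bsub>EA i\<^esub> u \<in> torsion X (EA i)"
    by (rule submod_neg[OF A(2) torsion_submod[OF X A(2)]])
  have tz: "\<And>i. \<zero>\<^bsub>EC i\<^esub> \<in> torsion X (EC i)" by (rule submod_zero[OF C(2) torsion_submod[OF X C(2)]])
  show "lc_zero X i C" if asm: "lc_zero X i B" "lc_zero X (Suc i) A"
    unfolding lC torsion_exact_def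
  proof (intro ballI impI)
    fix v assume v: "v \<in> torsion X (EC i)" "dC i v = \<zero>\<^bsub>EC (Suc i)\<^esub>"
    note vc = torsion_carrier[OF v(1)]
    have "\<ominus>\<^bsub>EA (Suc (Suc i))\<^esub> dA (Suc i) (\<theta> i v) = \<zero>\<^bsub>EA (Suc (Suc i))\<^esub>" using \<theta>d[OF vc] v(2) by simp
    then have "\<ominus>\<^bsub>EA (Suc (Suc i))\<^esub> (\<ominus>\<^bsub>EA (Suc (Suc i))\<^esub> dA (Suc i) (\<theta> i v)) = \<zero>\<^bsub>EA (Suc (Suc i))\<^esub>" by simp
    then have "dA (Suc i) (\<theta> i v) = \<zero>\<^bsub>EA (Suc (Suc i))\<^esub>" using vc by simp
    then obtain y where y: "y \<in> torsion X (EA i)" "\<theta> i v = dA i y"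
      using torsion_exactDS[OF asm(2)[unfolded lA] \<theta>t[OF v(1)]] by blast
    \<comment> \<open>Pairing \<open>v\<close> with the negative of a primitive \<open>y\<close> of
      \<open>\<theta> v\<close> gives a cocycle of the middle complex.\<close>
    have 1: "(\<ominus>\<^bsub>EA i\<^esub> y, v) \<in> torsion X (?E i)" using tn[OF y(1)] v(1) by simp
    have 2: "?D i (\<ominus>\<^bsub>EA i\<^esub> y, v) = \<zero>\<^bsub>?E (Suc i)\<^esub>" using y dAneg torsion_carrier[OF y(1)] v(2) by simp
    show "case i of 0 \<Rightarrow> v = \<zero>\<^bsub>EC 0\<^esub> | Suc j \<Rightarrow> v \<in> dC j ` torsion X (EC j)"
    proof (cases i)
      case 0
      then show ?thesis using torsion_exactD0[of X ?E ?D "(\<ominus>\<^bsub>EA i\<^esub> y, v)"] asm(1)[unfolded lB] 1 2 by simp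
    next
      case (Suc j)
      have "\<exists>q\<in>torsion X (?E j). (\<ominus>\<^bsub>EA i\<^esub> y, v) = ?D j q"
        using torsion_exactDS[of X ?E ?D j "(\<ominus>\<^bsub>EA i\<^esub> y, v)"] asm(1)[unfolded lB] 1 2 unfolding Suc by blast
      then show ?thesis using Suc by auto
    qed
  qed
  show "lc_zero X i B" if asm: "lc_zero X i A" "lc_zero X i C"
    unfolding lB torsion_exact_def
  proof (intro ballI impI)
    fix q assume q: "q \<in> torsion X (?E i)" "?D i q = \<zero>\<^bsub>?E (Suc i)\<^esub>"
    obtain u v where uv: "q = (u, v)" by force
    have u: "u \<in> torsion X (EA i)" and v: "v \<in> torsion X (EC i)" using q uv by auto
    have dv: "dC i v = \<zero>\<^bsub>EC (Suc i)\<^esub>" and du: "dA i u \<oplus>\<^bsub>EA (Suc i)\<^esub> \<theta> i v = \<zero>\<^bsub>EA (Suc i)\<^esub>" using q uv by auto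
    show "case i of 0 \<Rightarrow> q = \<zero>\<^bsub>?E 0\<^esub> | Suc j \<Rightarrow> q \<in> ?D j ` torsion X (?E j)"
    proof (cases i)
      case 0
      have v0: "v = \<zero>\<^bsub>EC 0\<^esub>" using torsion_exactD0[of X EC dC v] asm(2)[unfolded lC] v dv 0 by simp
      have "dA 0 u = \<zero>\<^bsub>EA (Suc 0)\<^esub>" using du v0 torsion_carrier[OF u] 0 by simp
      then have "u = \<zero>\<^bsub>EA 0\<^esub>" using torsion_exactD0[of X EA dA u] asm(1)[unfolded lA] u 0 by simp
      then show ?thesis using v0 uv 0 by simp
    next
      case (Suc j)
      obtain w where w: "w \<in> torsion X (EC j)" "v = dC j w" using torsion_exactDS[of X EC dC j v] asm(2)[unfolded lC] v dv Suc by auto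
      note wc = torsion_carrier[OF w(1)] and uc = torsion_carrier[OF u[unfolded Suc]]
      have "dA (Suc j) (u \<ominus>\<^bsub>EA (Suc j)\<^esub> \<theta> j w) = \<zero>\<^bsub>EA (Suc (Suc j))\<^esub>"
        using du \<theta>d[OF wc] w wc uc Suc by (simp add: dAminus)
      then obtain y where y: "y \<in> torsion X (EA j)" "u \<ominus>\<^bsub>EA (Suc j)\<^esub> \<theta> j w = dA j y"
        using torsion_exactDS[of X EA dA j "u \<ominus>\<^bsub>EA (Suc j)\<^esub> \<theta> j w"] asm(1)[unfolded lA] tm[OF u[unfolded Suc] \<theta>t[OF w(1)]] Suc by auto
      have "u = dA j y \<oplus>\<^bsub>EA (Suc j)\<^esub> \<theta> j w" using mod_eq_from_minus[OF A(2) uc \<theta>c[OF wc] y(2)] .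
      then have "q = ?D j (y, w)" using uv w by simp
      moreover have "(y, w) \<in> torsion X (?E j)" using y w by simp
      ultimately show ?thesis unfolding Suc nat.case by (rule image_eqI)
    qed
  qed
  \<comment> \<open>Exactness of the middle complex is applied to \<open>(u, 0)\<close>: up to a
    coboundary, \<open>u\<close> is the image of a cocycle \<open>v\<close> under the connecting
    map.\<close>
  have step: "\<exists>y v. y \<in> torsion X (EA i) \<and> v \<in> torsion X (EC i) \<and> dC i v = \<zero>\<^bsub>EC (Suc i)\<^esub> \<and> u = dA i y \<oplus>\<^bsub>EA (Suc i)\<^esub> \<theta> i v"
    if asm: "lc_zero X (Suc i) B" and u: "u \<in> torsion X (EA (Suc i))" and du: "dA (Suc i) u = \<zero>\<^bsub>EA (Suc (Suc i))\<^esub>" for i u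
  proof -
    have "\<exists>q\<in>torsion X (?E i). (u, \<zero>\<^bsub>EC (Suc i)\<^esub>) = ?D i q"
      by (rule torsion_exactDS[OF asm(1)[unfolded lB]]) (use u du tz in auto)
    then obtain y v where "(y, v) \<in> torsion X (?E i)" "(u, \<zero>\<^bsub>EC (Suc i)\<^esub>) = ?D i (y, v)" by force
    then show ?thesis by auto
  qed
  show "lc_zero X (Suc i) A" if asm: "lc_zero X i C" "lc_zero X (Suc i) B"
    unfolding lA torsion_exact_def nat.case
  proof (intro ballI impI)
    fix u assume u: "u \<in> torsion X (EA (Suc i))" and du: "dA (Suc i) u = \<zero>\<^bsub>EA (Suc (Suc i))\<^esub>"
    obtain y v where yv: "y \<in> torsion X (EA i)" "v \<in> torsion X (EC i)" "dC i v = \<zero>\<^bsub>EC (Suc i)\<^esub>" "u = dA i y \<oplus>\<^bsub>EA (Suc i)\<^esub> \<theta> i v"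
      using step[OF asm(2) u du] by blast
    show "u \<in> dA i ` torsion X (EA i)"
    proof (cases i)
      case 0
      have "v = \<zero>\<^bsub>EC 0\<^esub>" using torsion_exactD0[of X EC dC v] asm(1)[unfolded lC] yv 0 by simp
      then show ?thesis using yv torsion_carrier[OF yv(1)] 0 by auto
    next
      case (Suc j)
      obtain w where w: "w \<in> torsion X (EC j)" "v = dC j w" using torsion_exactDS[of X EC dC j v] asm(1)[unfolded lC] yv Suc by auto
      have "u = dA (Suc j) (y \<ominus>\<^bsub>EA (Suc j)\<^esub> \<theta> j w)"
        using yv(4) w \<theta>d[OF torsion_carrier[OF w(1)]] torsion_carrier[OF yv(1)] torsion_carrier[OF w(1)] Suc
        by (simp add: dAminus)
      then show ?thesis using tm[OF yv(1)[unfolded Suc] \<theta>t[OF w(1)]] Suc by auto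
    qed
  qed
  have tc: "\<And>b. b \<in> carrier B \<Longrightarrow> t b \<in> carrier (EA 0)" by (rule mhom_closed[OF t])
  show "c \<in> g ` torsion X B" if asm: "lc_zero X (Suc 0) A" and c: "c \<in> torsion X C"
  proof -
    obtain b where b: "b \<in> carrier B" "c = g b" using torsion_carrier[OF c] unfolding S(7)[symmetric] by auto
    have "\<theta> 0 (eC c) \<in> torsion X (EA (Suc 0))" by (rule \<theta>t[OF torsion_mhom[OF X C(4,1,2) c]])
    then have "\<ominus>\<^bsub>EA (Suc 0)\<^esub> (\<theta> 0 (eC c)) \<in> torsion X (EA (Suc 0))" by (rule tn)
    then have w: "dA 0 (t b) \<in> torsion X (EA (Suc 0))" using \<theta>0[OF b(1)] b tc by simp
    obtain y where y: "y \<in> torsion X (EA 0)" "dA 0 (t b) = dA 0 y"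
      using torsion_exactDS[OF asm(1)[unfolded lA] w] ddA(2)[OF tc[OF b(1)]] by blast
    have "dA 0 (t b \<ominus>\<^bsub>EA 0\<^esub> y) = \<zero>\<^bsub>EA (Suc 0)\<^esub>" using y tc[OF b(1)] torsion_carrier[OF y(1)] by (simp add: dAminus)
    then obtain a where a: "a \<in> carrier A" "t b \<ominus>\<^bsub>EA 0\<^esub> y = eA a"
      using A(6)[of "t b \<ominus>\<^bsub>EA 0\<^esub> y"] tc[OF b(1)] torsion_carrier[OF y(1)] by auto
    have fa: "f a \<in> carrier B" by (rule mhom_closed[OF S(4) a(1)])
    \<comment> \<open>Subtracting \<open>f a\<close> from the lift \<open>b\<close> replaces
      \<open>t b\<close> by the torsion element \<open>y\<close> and leaves the image in
      \<open>C\<close> unchanged.\<close>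
    let ?b = "b \<ominus>\<^bsub>B\<^esub> f a"
    have bc: "?b \<in> carrier B" using b fa S(2) by simp
    have "t ?b = t b \<ominus>\<^bsub>EA 0\<^esub> (t b \<ominus>\<^bsub>EA 0\<^esub> y)" using mhom_minus[OF t S(2) A(2) b(1) fa] tf[OF a(1)] a(2) by simp
    also have "\<dots> = y" using tc[OF b(1)] torsion_carrier[OF y(1)] by (simp add: mod_simps)
    finally have ty: "t ?b = y" .
    have "g (f a) = \<zero>\<^bsub>C\<^esub>" using S(8)[OF fa] a(1) by blast
    then have gb: "g ?b = c" using mhom_minus[OF S(5,2,3) b(1) fa] b mhom_closed[OF S(5) b(1)] S(3) by (simp add: mod_minus_eq)
    have "(t ?b, eC (g ?b)) \<in> torsion X (?E 0)" using ty gb y torsion_mhom[OF X C(4,1,2) c] by simp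
    then have "?b \<in> torsion X B"
      by (rule torsion_mhom_inj[OF X resolutionD(4,1,2,5)[OF baer_resolutionD(1)[OF rB]] bc])
    then show ?thesis using gb by blast
  qed
  show "lc_zero X (Suc 0) A" if asm: "lc_zero X (Suc 0) B" and surj: "\<And>c. c \<in> torsion X C \<Longrightarrow> c \<in> g ` torsion X B"
    unfolding lA torsion_exact_def nat.case
  proof (intro ballI impI)
    fix u assume u: "u \<in> torsion X (EA (Suc 0))" and du: "dA (Suc 0) u = \<zero>\<^bsub>EA (Suc (Suc 0))\<^esub>"
    obtain y v where yv: "y \<in> torsion X (EA 0)" "v \<in> torsion X (EC 0)" "dC 0 v = \<zero>\<^bsub>EC (Suc 0)\<^esub>" "u = dA 0 y \<oplus>\<^bsub>EA (Suc 0)\<^esub> \<theta> 0 v"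
      using step[OF asm(1) u du] by blast
    obtain c where c: "c \<in> carrier C" "v = eC c" using C(6) torsion_carrier[OF yv(2)] yv(3) by auto
    have "c \<in> torsion X C" by (rule torsion_mhom_inj[OF X C(4,1,2,5) c(1)]) (use yv c in simp)
    then obtain b where b: "b \<in> torsion X B" "c = g b" using surj by blast
    have tb: "t b \<in> torsion X (EA 0)" by (rule torsion_mhom[OF X t S(2) A(2) b(1)])
    have "u = dA 0 (y \<ominus>\<^bsub>EA 0\<^esub> t b)"
      using yv(4) c b \<theta>0[OF torsion_carrier[OF b(1)]] torsion_carrier[OF tb] torsion_carrier[OF yv(1)]
      by (simp add: dAminus)
    then show "u \<in> dA 0 ` torsion X (EA 0)" using tm[OF yv(1) tb] by blast
  qed
qed

section \<open>Degree zero and injective modules\<close>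

text \<open>The augmentation identifies \<open>N\<close> with the kernel of \<open>d 0\<close>, and
  it both preserves and reflects torsion.\<close>

lemma lc_zero_0_iff:
  assumes X: "X \<subseteq> carrier R" and N: "module R N"
  shows "lc_zero X 0 N \<longleftrightarrow> torsion X N = {\<zero>\<^bsub>N\<^esub>}"
proof -
  obtain E d e where "chosen_injective_resolution R N = (E, d)" and r: "baer_resolution N E d e"
    by (rule chosen_baer_resolution[OF N])
  note r' = resolutionD[OF baer_resolutionD(1)[OF r]]
  have "torsion_exact X E d 0 \<longleftrightarrow> (\<forall>z\<in>torsion X N. z = \<zero>\<^bsub>N\<^esub>)"
  proof
    assume t: "torsion_exact X E d 0"
    show "\<forall>z\<in>torsion X N. z = \<zero>\<^bsub>N\<^esub>"
    proof
      fix z assume z: "z \<in> torsion X N"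
      have "e z = \<zero>\<^bsub>E 0\<^esub>"
        using torsion_exactD0[OF t torsion_mhom[OF X r'(4,1,2) z]] resolution_dd(1)[OF baer_resolutionD(1)[OF r] torsion_carrier[OF z]] by simp
      then show "z = \<zero>\<^bsub>N\<^esub>" using mhom_inj_zero[OF r'(4,1,2,5) torsion_carrier[OF z]] by simp
    qed
  next
    assume t: "\<forall>z\<in>torsion X N. z = \<zero>\<^bsub>N\<^esub>"
    show "torsion_exact X E d 0"
      unfolding torsion_exact_def nat.case
    proof (intro ballI impI)
      fix z assume z: "z \<in> torsion X (E 0)" "d 0 z = \<zero>\<^bsub>E (Suc 0)\<^esub>"
      then obtain n where n: "n \<in> carrier N" "z = e n" using r'(6)[OF torsion_carrier[OF z(1)]] by blast
      then have "n \<in> torsion X N" using torsion_mhom_inj[OF X r'(4,1,2,5) n(1)] z by simp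
      then show "z = \<zero>\<^bsub>E 0\<^esub>" using t n mhom_zero[OF r'(4,1,2)] by simp
    qed
  qed
  then show ?thesis using lc_zero_iff_torsion_exact[OF X r] submod_zero[OF N torsion_submod[OF X N]] by blast
qed

text \<open>\<open>E\<close> is its own resolution, concentrated in degree zero. The zero terms are
  taken as the zero submodule of \<open>E\<close>, since all terms must share a type.\<close>

lemma lc_zero_baer:
  fixes E :: "('a, 'x) module"
  assumes X: "X \<subseteq> carrier R" and E: "baer E"
  shows "lc_zero X (Suc i) E"
proof -
  note Em = baer_module[OF E]
  let ?Z = "E\<lparr>carrier := {\<zero>\<^bsub>E\<^esub>}\<rparr>"
  have Z: "module R ?Z" by (rule submod_module[OF Em zero_submod[OF Em]])
  have Zb: "baer ?Z"
    by (rule baer_retract[where p="\<lambda>_. \<zero>\<^bsub>E\<^esub>", OF E Z mhom_incl]) (use Em in \<open>auto simp: mhom_def\<close>)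
  define F where "F i = (if i = 0 then E else ?Z)" for i :: nat
  define d where "d i z = \<zero>\<^bsub>E\<^esub>" for i :: nat and z :: 'x
  have F: "baer (F i)" "module R (F i)" for i using E Zb Em Z by (auto simp: F_def)
  have Fz: "\<zero>\<^bsub>F i\<^esub> = \<zero>\<^bsub>E\<^esub>" for i by (simp add: F_def)
  have "resolution E F d (\<lambda>x. x)"
    unfolding resolution_def
  proof (intro conjI allI ballI)
    fix i show "mhom R (F i) (F (Suc i)) (d i)"
      using mhom_const_zero[OF F(2), of "F i" "Suc i"] by (simp add: d_def[abs_def] Fz)
    fix z assume "z \<in> carrier (F (Suc i))"
    then show "d (Suc i) z = \<zero>\<^bsub>F (Suc (Suc i))\<^esub> \<longleftrightarrow> z \<in> d i ` carrier (F i)"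
      using mod_zero_closed[OF F(2), of i] by (auto simp: F_def d_def)
  qed (use F Em in \<open>auto simp: F_def d_def mhom_def\<close>)
  then have "baer_resolution E F d (\<lambda>x. x)" using F by (simp add: baer_resolution_def)
  moreover have "torsion_exact X F d (Suc i)"
  proof -
    have "z \<in> d i ` torsion X (F i)" if "z \<in> torsion X (F (Suc i))" for z
      using torsion_carrier[OF that] submod_zero[OF F(2) torsion_submod[OF X F(2)], of i] by (auto simp: F_def d_def)
    then show ?thesis by (simp add: torsion_exact_def)
  qed
  ultimately show ?thesis using lc_zero_iff_torsion_exact[OF X] by blast
qed

section \<open>Finitely generated modules\<close>

definition span :: "('a, 'x, 'm) module_scheme \<Rightarrow> 'x set \<Rightarrow> 'x set" where
  "span M S = submodule_generated R M S"

lemma span_submod: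
  assumes M: "module R M" and S: "S \<subseteq> carrier M"
  shows "submodule (span M S) R M" "S \<subseteq> span M S" "\<And>N. submodule N R M \<Longrightarrow> S \<subseteq> N \<Longrightarrow> span M S \<subseteq> N"
proof -
  have c: "carrier M \<in> {N. submodule N R M \<and> S \<subseteq> N}" using carrier_submod[OF M] S by simp
  note r = submod_rules[OF M]
  show "submodule (span M S) R M"
    unfolding span_def submodule_generated_def
    by (rule submodI[OF M]) (use c in \<open>auto intro: r(3,4,7)\<close>)
qed (auto simp: span_def submodule_generated_def)

lemma adjoin_submod:
  assumes M: "module R M" and N: "submodule N R M" and x: "x \<in> carrier M"
  shows "submodule {n \<oplus>\<^bsub>M\<^esub> r \<odot>\<^bsub>M\<^esub> x | n r. n \<in> N \<and> r \<in> carrier R} R M" (is "submodule ?A R M")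
    and "N \<subseteq> {n \<oplus>\<^bsub>M\<^esub> r \<odot>\<^bsub>M\<^esub> x | n r. n \<in> N \<and> r \<in> carrier R}"
    and "x \<in> {n \<oplus>\<^bsub>M\<^esub> r \<odot>\<^bsub>M\<^esub> x | n r. n \<in> N \<and> r \<in> carrier R}"
proof -
  note r = submod_rules[OF M N]
  show "submodule ?A R M"
  proof (rule submodI[OF M])
    show "?A \<subseteq> carrier M" using r(2) x M by auto
    show "\<zero>\<^bsub>M\<^esub> \<in> ?A" using r(3) x M by (intro CollectI exI[of _ "\<zero>\<^bsub>M\<^esub>"] exI[of _ \<zero>]) auto
  next
    fix u v assume "u \<in> ?A" "v \<in> ?A"
    then obtain n s m t where *: "n \<in> N" "s \<in> carrier R" "m \<in> N" "t \<in> carrier R" "u = n \<oplus>\<^bsub>M\<^esub> s \<odot>\<^bsub>M\<^esub> x" "v = m \<oplus>\<^bsub>M\<^esub> t \<odot>\<^bsub>M\<^esub> x"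
      by blast
    then have "u \<oplus>\<^bsub>M\<^esub> v = (n \<oplus>\<^bsub>M\<^esub> m) \<oplus>\<^bsub>M\<^esub> (s \<oplus> t) \<odot>\<^bsub>M\<^esub> x" using r(2) x M by (simp add: mod_ac mod_l_distr)
    then show "u \<oplus>\<^bsub>M\<^esub> v \<in> ?A" using * r(4) by blast
  next
    fix t u assume t: "t \<in> carrier R" and "u \<in> ?A"
    then obtain n s where *: "n \<in> N" "s \<in> carrier R" "u = n \<oplus>\<^bsub>M\<^esub> s \<odot>\<^bsub>M\<^esub> x" by blast
    then have "t \<odot>\<^bsub>M\<^esub> u = t \<odot>\<^bsub>M\<^esub> n \<oplus>\<^bsub>M\<^esub> (t \<otimes> s) \<odot>\<^bsub>M\<^esub> x" using r(2) x M t by (simp add: mod_r_distr mod_smult_assoc)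
    then show "t \<odot>\<^bsub>M\<^esub> u \<in> ?A" using * t r(7) by blast
  qed
  show "N \<subseteq> ?A"
  proof
    fix n assume n: "n \<in> N"
    then have "n = n \<oplus>\<^bsub>M\<^esub> \<zero> \<odot>\<^bsub>M\<^esub> x" using r(2) x M by simp
    then show "n \<in> ?A" using n by blast
  qed
  have "x = \<zero>\<^bsub>M\<^esub> \<oplus>\<^bsub>M\<^esub> \<one> \<odot>\<^bsub>M\<^esub> x" using x M by simp
  then show "x \<in> ?A" using r(3) by blast
qed

lemma span_insert:
  assumes M: "module R M" and S: "S \<subseteq> carrier M" and x: "x \<in> carrier M"
  shows "span M (insert x S) = {n \<oplus>\<^bsub>M\<^esub> r \<odot>\<^bsub>M\<^esub> x | n r. n \<in> span M S \<and> r \<in> carrier R}" (is "_ = ?A")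
proof
  note s = span_submod[OF M S]
  have S': "insert x S \<subseteq> carrier M" using S x by simp
  note s' = span_submod[OF M S'] and r' = submod_rules[OF M span_submod(1)[OF M S']]
  show "span M (insert x S) \<subseteq> ?A"
    using adjoin_submod[OF M s(1) x] s(2) by (intro s'(3)) auto
  have "span M S \<subseteq> span M (insert x S)" using s'(1,2) by (intro s(3)) auto
  then show "?A \<subseteq> span M (insert x S)" using s'(2) r'(4,7) by blast
qed

lemma span_empty: "module R M \<Longrightarrow> span M {} = {\<zero>\<^bsub>M\<^esub>}"
  using span_submod[of M "{}"] zero_submod[of M] submod_zero[of M "span M {}"] by auto

text \<open>Generators are adjoined one at a time, so that each stage is an extension of the
  previous one by a cyclic module.\<close>

lemma span_induct:
  assumes M: "module R M" and "finite S" "S \<subseteq> carrier M" and 0: "P {\<zero>\<^bsub>M\<^esub>}"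
    and step: "\<And>N x. submodule N R M \<Longrightarrow> P N \<Longrightarrow> x \<in> carrier M \<Longrightarrow> P {n \<oplus>\<^bsub>M\<^esub> r \<odot>\<^bsub>M\<^esub> x | n r. n \<in> N \<and> r \<in> carrier R}"
  shows "P (span M S)"
  using assms(2,3)
proof (induction S)
  case empty
  then show ?case using 0 span_empty[OF M] by simp
next
  case (insert x S)
  then show ?case using step[OF span_submod(1)[OF M, of S], of x] span_insert[OF M, of S x] by simp
qed

lemma quotient_cyclic:
  assumes M: "module R M" and N: "submodule N R M" and x: "x \<in> carrier M"
    and gen: "\<And>m. m \<in> carrier M \<Longrightarrow> \<exists>n\<in>N. \<exists>r\<in>carrier R. m = n \<oplus>\<^bsub>M\<^esub> r \<odot>\<^bsub>M\<^esub> x"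
  shows "carrier (quotient_module M N) = {r \<odot>\<^bsub>quotient_module M N\<^esub> (N +>\<^bsub>M\<^esub> x) | r. r \<in> carrier R}"
proof -
  note q = sesD[OF quotient_ses[OF M N]]
  let ?Q = "quotient_module M N"
  have sub: "N +>\<^bsub>M\<^esub> m \<in> {r \<odot>\<^bsub>?Q\<^esub> (N +>\<^bsub>M\<^esub> x) | r. r \<in> carrier R}" if m: "m \<in> carrier M" for m
  proof -
    obtain n r where nr: "n \<in> N" "r \<in> carrier R" "m = n \<oplus>\<^bsub>M\<^esub> r \<odot>\<^bsub>M\<^esub> x" using gen[OF m] by blast
    have n: "n \<in> carrier M" by (rule submod_carrier[OF M N nr(1)])
    have "N +>\<^bsub>M\<^esub> n = \<zero>\<^bsub>?Q\<^esub>" using q(8)[OF n] nr(1) by simp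
    then have "N +>\<^bsub>M\<^esub> m = r \<odot>\<^bsub>?Q\<^esub> (N +>\<^bsub>M\<^esub> x)"
      using nr mhom_add[OF q(5) n, of "r \<odot>\<^bsub>M\<^esub> x"] mhom_smult[OF q(5) nr(2) x] mhom_closed[OF q(5) x] M x q(3) by simp
    then show ?thesis using nr by blast
  qed
  show ?thesis
  proof
    show "carrier ?Q \<subseteq> {r \<odot>\<^bsub>?Q\<^esub> (N +>\<^bsub>M\<^esub> x) | r. r \<in> carrier R}"
      unfolding q(7)[symmetric] using sub by (rule image_subsetI)
    show "{r \<odot>\<^bsub>?Q\<^esub> (N +>\<^bsub>M\<^esub> x) | r. r \<in> carrier R} \<subseteq> carrier ?Q"
      using mod_smult_closed[OF q(3) _ mhom_closed[OF q(5) x]] by blast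
  qed
qed

section \<open>Vanishing on finitely generated modules\<close>

text \<open>\<open>C\<close> is \<open>R\<close> modulo the annihilator \<open>?K\<close> of
  \<open>x\<close>, and its cohomology in degree \<open>i\<close> sits between that of
  \<open>R\<close> in degree \<open>i\<close> and that of \<open>?K\<close> in degree
  \<open>i + 1\<close>.\<close>

lemma lc_zero_cyclic:
  assumes X: "X \<subseteq> carrier R" and C: "module R C" and x: "x \<in> carrier C"
    and gen: "carrier C = {r \<odot>\<^bsub>C\<^esub> x | r. r \<in> carrier R}"
    and R: "lc_zero X i (regular_module R)" and I: "\<And>I. ideal I R \<Longrightarrow> lc_zero X (Suc i) (ideal_module I)"
  shows "lc_zero X i C"
proof -
  let ?g = "\<lambda>r. r \<odot>\<^bsub>C\<^esub> x" and ?K = "{r \<in> carrier (regular_module R). r \<odot>\<^bsub>C\<^esub> x = \<zero>\<^bsub>C\<^esub>}"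
  have g: "mhom R (regular_module R) C ?g" by (rule smult_mhom(1)[OF C x])
  have K: "ideal ?K R" by (rule submodule_ideal[OF kernel_submod[OF g regular_module C]])
  have "?g ` carrier (regular_module R) = carrier C" using gen by auto
  from ses_kernel[OF regular_module C g this]
  have "ses (ideal_module ?K) (regular_module R) C (\<lambda>x. x) ?g" by (simp only: ideal_module_def)
  then show ?thesis by (rule les_C[OF X _ R I[OF K]])
qed

text \<open>Each added generator contributes a cyclic quotient, and vanishing for submodule and
  quotient gives vanishing for the extension.\<close>

lemma lc_zero_span:
  assumes X: "X \<subseteq> carrier R" and M: "module R M" and S: "finite S" "S \<subseteq> carrier M"
    and R: "lc_zero X i (regular_module R)" and I: "\<And>I. ideal I R \<Longrightarrow> lc_zero X (Suc i) (ideal_module I)"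
  shows "lc_zero X i (M\<lparr>carrier := span M S\<rparr>)"
proof (rule span_induct[OF M S])
  have Z: "module R (M\<lparr>carrier := {\<zero>\<^bsub>M\<^esub>}\<rparr>)" by (rule submod_module[OF M zero_submod[OF M]])
  show "lc_zero X i (M\<lparr>carrier := {\<zero>\<^bsub>M\<^esub>}\<rparr>)"
    by (rule lc_zero_cyclic[OF X Z, of "\<zero>\<^bsub>M\<^esub>"]) (use M R I in \<open>auto intro!: exI[of _ \<zero>]\<close>)
  fix N x assume N: "submodule N R M" and P: "lc_zero X i (M\<lparr>carrier := N\<rparr>)" and x: "x \<in> carrier M"
  let ?A = "{n \<oplus>\<^bsub>M\<^esub> r \<odot>\<^bsub>M\<^esub> x | n r. n \<in> N \<and> r \<in> carrier R}"
  let ?B = "M\<lparr>carrier := ?A\<rparr>"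
  note A = adjoin_submod[OF M N x]
  have B: "module R ?B" by (rule submod_module[OF M A(1)])
  have NB: "submodule N R ?B"
    by (rule submodI[OF B]) (use A(2) submod_rules[OF M N] in auto)
  note s = quotient_ses[OF B NB]
  have xB: "x \<in> carrier ?B" using A(3) by simp
  have "lc_zero X i (quotient_module ?B N)"
  proof (rule lc_zero_cyclic[OF X sesD(3)[OF s] mhom_closed[OF sesD(5)[OF s] xB] _ R I])
    show "carrier (quotient_module ?B N) = {r \<odot>\<^bsub>quotient_module ?B N\<^esub> (N +>\<^bsub>?B\<^esub> x) | r. r \<in> carrier R}"
      by (rule quotient_cyclic[OF B NB xB]) auto
  qed
  then show "lc_zero X i ?B" using les_B[OF X s] P by simp
qed

lemma span_regular_eq_genideal:
  assumes "A \<subseteq> carrier R" shows "span (regular_module R) A = Idl A"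
  using ideal_submodule submodule_ideal unfolding span_def submodule_generated_def genideal_def by blast

text \<open>The scalars \<open>c\<close> below are unique modulo \<open>p\<close> because the generating set \<open>Y\<close> is minimal among
  those that generate \<open>M\<close> locally at \<open>p\<close>.\<close>

lemma nonzero_hom:
  assumes M: "module R M" and S: "finite S" "S \<subseteq> carrier M" "span M S = carrier M"
    and faithful: "\<And>r. r \<in> carrier R \<Longrightarrow> (\<And>m. m \<in> carrier M \<Longrightarrow> r \<odot>\<^bsub>M\<^esub> m = \<zero>\<^bsub>M\<^esub>) \<Longrightarrow> r = \<zero>"
    and H: "module R H" and z: "z \<in> carrier H" "z \<noteq> \<zero>\<^bsub>H\<^esub>"
    and prime: "\<And>a b. a \<in> carrier R \<Longrightarrow> b \<in> carrier R \<Longrightarrow> (a \<otimes> b) \<odot>\<^bsub>H\<^esub> z = \<zero>\<^bsub>H\<^esub> \<Longrightarrow> a \<odot>\<^bsub>H\<^esub> z = \<zero>\<^bsub>H\<^esub> \<or> b \<odot>\<^bsub>H\<^esub> z = \<zero>\<^bsub>H\<^esub>"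
  shows "\<exists>\<phi>. mhom R M H \<phi> \<and> (\<exists>m\<in>carrier M. \<phi> m \<noteq> \<zero>\<^bsub>H\<^esub>)"
proof -
  \<comment> \<open>Let \<open>p\<close> be the annihilator of \<open>z\<close>, prime by
    assumption. The scalar \<open>s\<close> outside \<open>p\<close> is a common denominator that
    carries \<open>M\<close> into the span of \<open>Y\<close>.\<close>
  define G where "G Y \<longleftrightarrow> Y \<subseteq> S \<and> (\<exists>s\<in>carrier R. s \<odot>\<^bsub>H\<^esub> z \<noteq> \<zero>\<^bsub>H\<^esub> \<and> (\<forall>m\<in>carrier M. s \<odot>\<^bsub>M\<^esub> m \<in> span M Y))" for Y
  have "G S" unfolding G_def using S(3) z H M by (auto intro!: bexI[of _ \<one>])
  then obtain Y where Y: "G Y" "\<And>Z. card Z < card Y \<Longrightarrow> \<not> G Z"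
    using ex_has_least_nat[of G S card] by (metis not_less)
  then obtain s where YS: "Y \<subseteq> S" and s: "s \<in> carrier R" "s \<odot>\<^bsub>H\<^esub> z \<noteq> \<zero>\<^bsub>H\<^esub>" "\<And>m. m \<in> carrier M \<Longrightarrow> s \<odot>\<^bsub>M\<^esub> m \<in> span M Y"
    unfolding G_def by blast
  \<comment> \<open>Faithfulness enters here: if \<open>Y\<close> were empty, \<open>s\<close> would
    kill \<open>M\<close> and so be zero, although it lies outside \<open>p\<close>.\<close>
  have "Y \<noteq> {}"
  proof
    assume "Y = {}"
    then have "s = \<zero>" using s span_empty[OF M] by (intro faithful) auto
    then show False using s z H by simp
  qed
  then obtain y where y: "y \<in> Y" by blast
  define Y' where "Y' = Y - {y}"
  have Yeq: "Y = insert y Y'" using y by (auto simp: Y'_def)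
  have Y'c: "Y' \<subseteq> carrier M" and yc: "y \<in> carrier M" using YS S y by (auto simp: Y'_def)
  have nG: "\<not> G Y'" using y finite_subset[OF YS S(1)] unfolding Y'_def by (intro Y(2) card_Diff1_less) auto
  note N = span_submod(1)[OF M Y'c]
  note r = submod_rules[OF M N]
  \<comment> \<open>A scalar \<open>t\<close> outside \<open>p\<close> that moves \<open>y\<close>
    into the span of \<open>Y'\<close> would make \<open>t s\<close> a denominator for
    \<open>Y'\<close>, against the minimality of \<open>Y\<close>.\<close>
  have crit: "t \<odot>\<^bsub>H\<^esub> z = \<zero>\<^bsub>H\<^esub>" if t: "t \<in> carrier R" "t \<odot>\<^bsub>M\<^esub> y \<in> span M Y'" for t
  proof (rule ccontr)
    assume "t \<odot>\<^bsub>H\<^esub> z \<noteq> \<zero>\<^bsub>H\<^esub>"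
    then have ts: "(t \<otimes> s) \<odot>\<^bsub>H\<^esub> z \<noteq> \<zero>\<^bsub>H\<^esub>" using prime[OF t(1) s(1)] s(2) by blast
    have "(t \<otimes> s) \<odot>\<^bsub>M\<^esub> m \<in> span M Y'" if m: "m \<in> carrier M" for m
    proof -
      obtain n c where nc: "n \<in> span M Y'" "c \<in> carrier R" "s \<odot>\<^bsub>M\<^esub> m = n \<oplus>\<^bsub>M\<^esub> c \<odot>\<^bsub>M\<^esub> y"
        using s(3)[OF m] span_insert[OF M Y'c yc] Yeq by auto
      have "(t \<otimes> s) \<odot>\<^bsub>M\<^esub> m = t \<odot>\<^bsub>M\<^esub> n \<oplus>\<^bsub>M\<^esub> c \<odot>\<^bsub>M\<^esub> (t \<odot>\<^bsub>M\<^esub> y)"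
        using nc t s(1) m M yc r(2) by (simp add: mod_smult_assoc mod_r_distr) (simp add: m_comm flip: mod_smult_assoc)
      then show ?thesis using r(4,7) nc t by simp
    qed
    then have "G Y'" unfolding G_def using ts t s(1) YS Yeq by blast
    then show False using nG by blast
  qed
  have uniq: "c \<odot>\<^bsub>H\<^esub> z = c' \<odot>\<^bsub>H\<^esub> z"
    if c: "c \<in> carrier R" "c' \<in> carrier R" "n \<in> span M Y'" "n' \<in> span M Y'" "n \<oplus>\<^bsub>M\<^esub> c \<odot>\<^bsub>M\<^esub> y = n' \<oplus>\<^bsub>M\<^esub> c' \<odot>\<^bsub>M\<^esub> y" for c c' n n'
  proof -
    have "(c \<oplus> \<ominus> c') \<odot>\<^bsub>M\<^esub> y = \<ominus>\<^bsub>M\<^esub> n \<oplus>\<^bsub>M\<^esub> (n \<oplus>\<^bsub>M\<^esub> c \<odot>\<^bsub>M\<^esub> y) \<oplus>\<^bsub>M\<^esub> \<ominus>\<^bsub>M\<^esub> (c' \<odot>\<^bsub>M\<^esub> y)"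
      using c(1-4) yc M r(2) by (simp add: mod_l_distr mod_l_neg_smult)
    also have "\<dots> = n' \<ominus>\<^bsub>M\<^esub> n" unfolding c(5) using c(1-4) yc M r(2) by (simp add: mod_simps)
    finally have "(c \<oplus> \<ominus> c') \<odot>\<^bsub>H\<^esub> z = \<zero>\<^bsub>H\<^esub>" using crit[of "c \<oplus> \<ominus> c'"] c r(6) by simp
    then have "c \<odot>\<^bsub>H\<^esub> z \<ominus>\<^bsub>H\<^esub> c' \<odot>\<^bsub>H\<^esub> z = \<zero>\<^bsub>H\<^esub>" using c z H by (simp add: mod_l_distr mod_l_neg_smult mod_minus_eq)
    then show ?thesis using c z H by (simp add: mod_minus_eq_zero)
  qed
  \<comment> \<open>The homomorphism sends \<open>m\<close> to \<open>c z\<close>, where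
    \<open>c\<close> is a coefficient of \<open>y\<close> in an expression of \<open>s m\<close>; by
    \<open>uniq\<close> the element \<open>c z\<close> does not depend on the expression.\<close>
  define cf where "cf m = (SOME c. c \<in> carrier R \<and> (\<exists>n\<in>span M Y'. s \<odot>\<^bsub>M\<^esub> m = n \<oplus>\<^bsub>M\<^esub> c \<odot>\<^bsub>M\<^esub> y))" for m
  have cf: "cf m \<in> carrier R \<and> (\<exists>n\<in>span M Y'. s \<odot>\<^bsub>M\<^esub> m = n \<oplus>\<^bsub>M\<^esub> cf m \<odot>\<^bsub>M\<^esub> y)" if m: "m \<in> carrier M" for m
    unfolding cf_def by (rule someI_ex) (use s(3)[OF m] span_insert[OF M Y'c yc] Yeq in blast)
  have val: "cf m \<odot>\<^bsub>H\<^esub> z = c \<odot>\<^bsub>H\<^esub> z"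
    if "m \<in> carrier M" "c \<in> carrier R" "n \<in> span M Y'" "s \<odot>\<^bsub>M\<^esub> m = n \<oplus>\<^bsub>M\<^esub> c \<odot>\<^bsub>M\<^esub> y" for m c n
  proof -
    obtain n' where "n' \<in> span M Y'" "s \<odot>\<^bsub>M\<^esub> m = n' \<oplus>\<^bsub>M\<^esub> cf m \<odot>\<^bsub>M\<^esub> y" using cf[OF \<open>m \<in> carrier M\<close>] by blast
    then show ?thesis using uniq[of "cf m" c n' n] cf[OF \<open>m \<in> carrier M\<close>] that by simp
  qed
  have "mhom R M H (\<lambda>m. cf m \<odot>\<^bsub>H\<^esub> z)"
  proof (rule mhomI)
    fix m m' assume m: "m \<in> carrier M" "m' \<in> carrier M"
    obtain n n' where n: "n \<in> span M Y'" "s \<odot>\<^bsub>M\<^esub> m = n \<oplus>\<^bsub>M\<^esub> cf m \<odot>\<^bsub>M\<^esub> y" "n' \<in> span M Y'" "s \<odot>\<^bsub>M\<^esub> m' = n' \<oplus>\<^bsub>M\<^esub> cf m' \<odot>\<^bsub>M\<^esub> y"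
      using cf[OF m(1)] cf[OF m(2)] by blast
    have c: "cf m \<in> carrier R" "cf m' \<in> carrier R" using cf m by auto
    have "s \<odot>\<^bsub>M\<^esub> (m \<oplus>\<^bsub>M\<^esub> m') = (n \<oplus>\<^bsub>M\<^esub> n') \<oplus>\<^bsub>M\<^esub> (cf m \<oplus> cf m') \<odot>\<^bsub>M\<^esub> y"
      using m s(1) n c M yc r(2) by (simp add: mod_r_distr mod_l_distr mod_ac)
    from val[OF _ _ r(4)[OF n(1,3)] this] show "cf (m \<oplus>\<^bsub>M\<^esub> m') \<odot>\<^bsub>H\<^esub> z = cf m \<odot>\<^bsub>H\<^esub> z \<oplus>\<^bsub>H\<^esub> cf m' \<odot>\<^bsub>H\<^esub> z"
      using m c M H z by (simp add: mod_l_distr)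
  next
    fix t m assume t: "t \<in> carrier R" and m: "m \<in> carrier M"
    obtain n where n: "n \<in> span M Y'" "s \<odot>\<^bsub>M\<^esub> m = n \<oplus>\<^bsub>M\<^esub> cf m \<odot>\<^bsub>M\<^esub> y" using cf[OF m] by blast
    have c: "cf m \<in> carrier R" using cf m by auto
    have "s \<odot>\<^bsub>M\<^esub> (t \<odot>\<^bsub>M\<^esub> m) = t \<odot>\<^bsub>M\<^esub> (s \<odot>\<^bsub>M\<^esub> m)" using s(1) t m M by (simp add: m_comm flip: mod_smult_assoc)
    also have "\<dots> = t \<odot>\<^bsub>M\<^esub> n \<oplus>\<^bsub>M\<^esub> (t \<otimes> cf m) \<odot>\<^bsub>M\<^esub> y"
      using n t c M yc r(2) by (simp add: mod_r_distr mod_smult_assoc)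
    finally have "s \<odot>\<^bsub>M\<^esub> (t \<odot>\<^bsub>M\<^esub> m) = t \<odot>\<^bsub>M\<^esub> n \<oplus>\<^bsub>M\<^esub> (t \<otimes> cf m) \<odot>\<^bsub>M\<^esub> y" .
    from val[OF _ _ r(7)[OF t n(1)] this] show "cf (t \<odot>\<^bsub>M\<^esub> m) \<odot>\<^bsub>H\<^esub> z = t \<odot>\<^bsub>H\<^esub> (cf m \<odot>\<^bsub>H\<^esub> z)"
      using t m c M H z by (simp add: mod_smult_assoc)
  qed (use cf z H in auto)
  \<comment> \<open>At \<open>m = y\<close> the coefficient may be taken to be \<open>s\<close>, and
    \<open>s z\<close> is nonzero.\<close>
  moreover have "cf y \<odot>\<^bsub>H\<^esub> z = s \<odot>\<^bsub>H\<^esub> z"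
    by (rule val[OF yc s(1) r(3)]) (use s yc M in simp)
  ultimately show ?thesis using s(2) yc by metis
qed

section \<open>Homomorphism modules and acyclic resolutions\<close>

lemma Hom_simps [simp]:
  "carrier (Hom_module R M N) = mod_hom R M N" "\<zero>\<^bsub>Hom_module R M N\<^esub> = (\<lambda>x\<in>carrier M. \<zero>\<^bsub>N\<^esub>)"
  "\<phi> \<oplus>\<^bsub>Hom_module R M N\<^esub> \<psi> = (\<lambda>x\<in>carrier M. \<phi> x \<oplus>\<^bsub>N\<^esub> \<psi> x)" "r \<odot>\<^bsub>Hom_module R M N\<^esub> \<phi> = (\<lambda>x\<in>carrier M. r \<odot>\<^bsub>N\<^esub> \<phi> x)"
  by (simp_all add: Hom_module_def)

lemma mod_hom_ext:
  assumes "\<phi> \<in> mod_hom R M N" "\<psi> \<in> mod_hom R M N'" "\<And>x. x \<in> carrier M \<Longrightarrow> \<phi> x = \<psi> x"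
  shows "\<phi> = \<psi>"
  using assms by (intro extensionalityI[of _ "carrier M"]) (auto simp: mod_hom_iff)

lemma mod_hom_mhom: "\<phi> \<in> mod_hom R M N \<Longrightarrow> mhom R M N \<phi>"
  by (simp add: mod_hom_iff)

lemma mod_hom_closed: "\<phi> \<in> mod_hom R M N \<Longrightarrow> x \<in> carrier M \<Longrightarrow> \<phi> x \<in> carrier N"
  by (rule mhom_closed[OF mod_hom_mhom])

lemma mod_hom_restrict_eq: "\<phi> \<in> mod_hom R M N \<Longrightarrow> restrict \<phi> (carrier M) = \<phi>"
  by (simp add: mod_hom_iff extensional_restrict)

lemma mod_hom_arb: "\<phi> \<in> mod_hom R M N \<Longrightarrow> x \<notin> carrier M \<Longrightarrow> \<phi> x = undefined"
  by (simp add: mod_hom_iff extensional_def)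

lemma Hom_is_module:
  assumes M: "module R M" and N: "module R N"
  shows "module R (Hom_module R M N)"
proof (rule moduleI[OF is_cring])
  note cl = mod_hom_closed[of _ M N]
  note I = mhom_restrict_mod_hom[OF _ M, of N]
  show "abelian_group (Hom_module R M N)"
  proof (rule abelian_groupI)
    fix \<phi> assume ph: "\<phi> \<in> carrier (Hom_module R M N)"
    have "(\<lambda>x\<in>carrier M. \<ominus>\<^bsub>N\<^esub> \<phi> x) \<in> mod_hom R M N"
      using I[OF mhom_uminus[OF mod_hom_mhom M N]] ph by simp
    moreover have "(\<lambda>x\<in>carrier M. \<ominus>\<^bsub>N\<^esub> \<phi> x) \<oplus>\<^bsub>Hom_module R M N\<^esub> \<phi> = \<zero>\<^bsub>Hom_module R M N\<^esub>"
      using ph cl N by (auto simp: fun_eq_iff restrict_def)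
    ultimately show "\<exists>y\<in>carrier (Hom_module R M N). y \<oplus>\<^bsub>Hom_module R M N\<^esub> \<phi> = \<zero>\<^bsub>Hom_module R M N\<^esub>"
      by (intro bexI[of _ "\<lambda>x\<in>carrier M. \<ominus>\<^bsub>N\<^esub> \<phi> x"]) simp_all
    have "(\<lambda>x\<in>carrier M. \<phi> x) = \<phi>" using mod_hom_restrict_eq[of \<phi> M N] ph by simp
    moreover have "\<zero>\<^bsub>Hom_module R M N\<^esub> \<oplus>\<^bsub>Hom_module R M N\<^esub> \<phi> = (\<lambda>x\<in>carrier M. \<phi> x)"
      using ph cl N by (auto simp: fun_eq_iff restrict_def)
    ultimately show "\<zero>\<^bsub>Hom_module R M N\<^esub> \<oplus>\<^bsub>Hom_module R M N\<^esub> \<phi> = \<phi>" by simp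
  next
    show "\<zero>\<^bsub>Hom_module R M N\<^esub> \<in> carrier (Hom_module R M N)" using I[OF mhom_const_zero[OF N]] by simp
  next
    fix \<phi> \<psi> assume ph: "\<phi> \<in> carrier (Hom_module R M N)" "\<psi> \<in> carrier (Hom_module R M N)"
    show "\<phi> \<oplus>\<^bsub>Hom_module R M N\<^esub> \<psi> \<in> carrier (Hom_module R M N)"
      using I[OF mhom_lin[OF mod_hom_mhom mod_hom_mhom M N]] ph by simp
    show "\<phi> \<oplus>\<^bsub>Hom_module R M N\<^esub> \<psi> = \<psi> \<oplus>\<^bsub>Hom_module R M N\<^esub> \<phi>"
      using ph cl N by (auto simp: fun_eq_iff restrict_def mod_comm)
  next
    fix \<phi> \<psi> \<chi> assume "\<phi> \<in> carrier (Hom_module R M N)" "\<psi> \<in> carrier (Hom_module R M N)" "\<chi> \<in> carrier (Hom_module R M N)"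
    then show "\<phi> \<oplus>\<^bsub>Hom_module R M N\<^esub> \<psi> \<oplus>\<^bsub>Hom_module R M N\<^esub> \<chi> = \<phi> \<oplus>\<^bsub>Hom_module R M N\<^esub> (\<psi> \<oplus>\<^bsub>Hom_module R M N\<^esub> \<chi>)"
      using cl N by (auto simp: fun_eq_iff restrict_def mod_assoc)
  qed
  fix \<phi> assume ph: "\<phi> \<in> carrier (Hom_module R M N)"
  have "(\<lambda>x\<in>carrier M. \<phi> x) = \<phi>" using mod_hom_restrict_eq[of \<phi> M N] ph by simp
  moreover have "\<one> \<odot>\<^bsub>Hom_module R M N\<^esub> \<phi> = (\<lambda>x\<in>carrier M. \<phi> x)"
    using ph cl N by (auto simp: fun_eq_iff restrict_def)
  ultimately show "\<one> \<odot>\<^bsub>Hom_module R M N\<^esub> \<phi> = \<phi>" by simp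
next
  note cl = mod_hom_closed[of _ M N]
  fix r \<phi> assume r: "r \<in> carrier R" and ph: "\<phi> \<in> carrier (Hom_module R M N)"
  show "r \<odot>\<^bsub>Hom_module R M N\<^esub> \<phi> \<in> carrier (Hom_module R M N)"
    using mhom_restrict_mod_hom[OF mhom_smult_const[OF r mod_hom_mhom M N] M] ph by simp
  { fix s assume s: "s \<in> carrier R"
    show "(r \<oplus> s) \<odot>\<^bsub>Hom_module R M N\<^esub> \<phi> = r \<odot>\<^bsub>Hom_module R M N\<^esub> \<phi> \<oplus>\<^bsub>Hom_module R M N\<^esub> s \<odot>\<^bsub>Hom_module R M N\<^esub> \<phi>"
      using r s ph cl N by (auto simp: fun_eq_iff restrict_def mod_l_distr)
    show "(r \<otimes> s) \<odot>\<^bsub>Hom_module R M N\<^esub> \<phi> = r \<odot>\<^bsub>Hom_module R M N\<^esub> (s \<odot>\<^bsub>Hom_module R M N\<^esub> \<phi>)"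
      using r s ph cl N by (auto simp: fun_eq_iff restrict_def mod_smult_assoc) }
  fix \<psi> assume "\<psi> \<in> carrier (Hom_module R M N)"
  then show "r \<odot>\<^bsub>Hom_module R M N\<^esub> (\<phi> \<oplus>\<^bsub>Hom_module R M N\<^esub> \<psi>) = r \<odot>\<^bsub>Hom_module R M N\<^esub> \<phi> \<oplus>\<^bsub>Hom_module R M N\<^esub> r \<odot>\<^bsub>Hom_module R M N\<^esub> \<psi>"
    using r ph cl N by (auto simp: fun_eq_iff restrict_def mod_r_distr)
qed

lemma Hom_precompose:
  assumes f: "mhom R A B f" and A: "module R A" and B: "module R B" and E: "module R E"
  shows "mhom R (Hom_module R B E) (Hom_module R A E) (\<lambda>\<phi>. \<lambda>x\<in>carrier A. \<phi> (f x))"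
proof (rule mhomI)
  fix \<phi> assume "\<phi> \<in> carrier (Hom_module R B E)"
  then show "(\<lambda>x\<in>carrier A. \<phi> (f x)) \<in> carrier (Hom_module R A E)"
    using mhom_restrict_mod_hom[OF mhom_compose[OF f mod_hom_mhom] A] by simp
qed (use mhom_closed[OF f] in \<open>auto simp: fun_eq_iff restrict_def\<close>)

lemma Hom_postcompose:
  assumes f: "mhom R E F f" and A: "module R A"
  shows "mhom R (Hom_module R A E) (Hom_module R A F) (\<lambda>\<phi>. \<lambda>x\<in>carrier A. f (\<phi> x))"
proof (rule mhomI)
  fix \<phi> assume "\<phi> \<in> carrier (Hom_module R A E)"
  then show "(\<lambda>x\<in>carrier A. f (\<phi> x)) \<in> carrier (Hom_module R A F)"
    using mhom_restrict_mod_hom[OF mhom_compose[OF mod_hom_mhom f] A] by simp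
next
  fix \<phi> \<psi> assume "\<phi> \<in> carrier (Hom_module R A E)" "\<psi> \<in> carrier (Hom_module R A E)"
  then show "(\<lambda>x\<in>carrier A. f ((\<phi> \<oplus>\<^bsub>Hom_module R A E\<^esub> \<psi>) x)) = (\<lambda>x\<in>carrier A. f (\<phi> x)) \<oplus>\<^bsub>Hom_module R A F\<^esub> (\<lambda>x\<in>carrier A. f (\<psi> x))"
    using mhom_add[OF f] by (auto simp: fun_eq_iff restrict_def mod_hom_closed)
next
  fix r \<phi> assume "r \<in> carrier R" "\<phi> \<in> carrier (Hom_module R A E)"
  then show "(\<lambda>x\<in>carrier A. f ((r \<odot>\<^bsub>Hom_module R A E\<^esub> \<phi>) x)) = r \<odot>\<^bsub>Hom_module R A F\<^esub> (\<lambda>x\<in>carrier A. f (\<phi> x))"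
    using mhom_smult[OF f] by (auto simp: fun_eq_iff restrict_def mod_hom_closed)
qed

text \<open>Both the extension along \<open>f\<close> and the factorization through \<open>g\<close>
  are instances of \<open>baer_factor\<close>.\<close>

lemma Hom_ses:
  assumes s: "ses A B C f g" and E: "baer E"
  shows "ses (Hom_module R C E) (Hom_module R B E) (Hom_module R A E)
    (\<lambda>\<phi>. \<lambda>x\<in>carrier B. \<phi> (g x)) (\<lambda>\<phi>. \<lambda>x\<in>carrier A. \<phi> (f x))"
proof -
  note S = sesD[OF s] and Em = baer_module[OF E]
  let ?g = "\<lambda>\<phi>. \<lambda>x\<in>carrier B. \<phi> (g x)" and ?f = "\<lambda>\<phi>. \<lambda>x\<in>carrier A. \<phi> (f x)"
  note HA = Hom_is_module[OF S(1) Em] and HB = Hom_is_module[OF S(2) Em] and HC = Hom_is_module[OF S(3) Em]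
  have hg: "mhom R (Hom_module R C E) (Hom_module R B E) ?g" by (rule Hom_precompose[OF S(5,2,3) Em])
  have hf: "mhom R (Hom_module R B E) (Hom_module R A E) ?f" by (rule Hom_precompose[OF S(4,1,2) Em])
  have fc: "\<And>x. x \<in> carrier A \<Longrightarrow> f x \<in> carrier B" by (rule mhom_closed[OF S(4)])
  have gf: "\<And>x. x \<in> carrier A \<Longrightarrow> g (f x) = \<zero>\<^bsub>C\<^esub>" using S(8) fc by blast
  have gs: "\<exists>b\<in>carrier B. c = g b" if "c \<in> carrier C" for c using that unfolding S(7)[symmetric] by auto
  have inj: "inj_on ?g (carrier (Hom_module R C E))"
  proof (rule inj_onI)
    fix \<phi> \<psi> assume ph: "\<phi> \<in> carrier (Hom_module R C E)" "\<psi> \<in> carrier (Hom_module R C E)" and eq: "?g \<phi> = ?g \<psi>"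
    have "\<phi> c = \<psi> c" if c: "c \<in> carrier C" for c
    proof -
      obtain b where b: "b \<in> carrier B" "c = g b" using gs[OF c] by blast
      then show ?thesis using fun_cong[OF eq, of b] by simp
    qed
    then show "\<phi> = \<psi>" using ph by (intro mod_hom_ext) auto
  qed
  have surj: "?f ` carrier (Hom_module R B E) = carrier (Hom_module R A E)"
  proof
    show "?f ` carrier (Hom_module R B E) \<subseteq> carrier (Hom_module R A E)" using mhom_closed[OF hf] by blast
    show "carrier (Hom_module R A E) \<subseteq> ?f ` carrier (Hom_module R B E)"
    proof
      fix \<psi> assume "\<psi> \<in> carrier (Hom_module R A E)"
      then have ps: "\<psi> \<in> mod_hom R A E" by simp
      obtain h where h: "mhom R B E h" "\<And>x. x \<in> carrier A \<Longrightarrow> h (f x) = \<psi> x"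
        using baer_factor[OF E S(1,2,4) mod_hom_mhom[OF ps]] mhom_inj_zero[OF S(4,1,2,6)] mhom_zero[OF mod_hom_mhom[OF ps] S(1) Em] by blast
      have "\<psi> = ?f (restrict h (carrier B))"
        using mod_hom_arb[OF ps] h fc by (auto simp: fun_eq_iff restrict_def)
      moreover have "restrict h (carrier B) \<in> carrier (Hom_module R B E)" using mhom_restrict_mod_hom[OF h(1) S(2)] by simp
      ultimately show "\<psi> \<in> ?f ` carrier (Hom_module R B E)" by (rule image_eqI)
    qed
  qed
  have ker: "?f \<phi> = \<zero>\<^bsub>Hom_module R A E\<^esub> \<longleftrightarrow> \<phi> \<in> ?g ` carrier (Hom_module R C E)" if "\<phi> \<in> carrier (Hom_module R B E)" for \<phi>
  proof
    have ph: "\<phi> \<in> mod_hom R B E" using that by simp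
    assume 0: "?f \<phi> = \<zero>\<^bsub>Hom_module R A E\<^esub>"
    have van: "\<phi> x = \<zero>\<^bsub>E\<^esub>" if x: "x \<in> carrier B" "g x = \<zero>\<^bsub>C\<^esub>" for x
    proof -
      obtain a where "a \<in> carrier A" "x = f a" using S(8)[OF x(1)] x(2) by blast
      then show ?thesis using fun_cong[OF 0, of a] by simp
    qed
    obtain h where h: "mhom R C E h" "\<And>x. x \<in> carrier B \<Longrightarrow> h (g x) = \<phi> x"
      using baer_factor[OF E S(2,3,5) mod_hom_mhom[OF ph] van] by blast
    have "\<phi> = ?g (restrict h (carrier C))"
      using mod_hom_arb[OF ph] h mhom_closed[OF S(5)] by (auto simp: fun_eq_iff restrict_def)
    moreover have "restrict h (carrier C) \<in> carrier (Hom_module R C E)" using mhom_restrict_mod_hom[OF h(1) S(3)] by simp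
    ultimately show "\<phi> \<in> ?g ` carrier (Hom_module R C E)" by (rule image_eqI)
  next
    assume "\<phi> \<in> ?g ` carrier (Hom_module R C E)"
    then obtain \<psi> where ps: "\<psi> \<in> mod_hom R C E" "\<phi> = ?g \<psi>" by auto
    then show "?f \<phi> = \<zero>\<^bsub>Hom_module R A E\<^esub>"
      using gf fc mhom_zero[OF mod_hom_mhom[OF ps(1)] S(3) Em] by (auto simp: fun_eq_iff restrict_def)
  qed
  show ?thesis unfolding ses_def using HA HB HC hg hf inj surj ker by blast
qed

lemma Hom_regular:
  assumes E: "module R E"
  shows "mhom R E (Hom_module R (regular_module R) E) (\<lambda>e. \<lambda>r\<in>carrier R. r \<odot>\<^bsub>E\<^esub> e)"
    and "mhom R (Hom_module R (regular_module R) E) E (\<lambda>\<phi>. \<phi> \<one>)"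
    and "\<phi> \<in> mod_hom R (regular_module R) E \<Longrightarrow> (\<lambda>r\<in>carrier R. r \<odot>\<^bsub>E\<^esub> \<phi> \<one>) = \<phi>"
proof -
  show "mhom R E (Hom_module R (regular_module R) E) (\<lambda>e. \<lambda>r\<in>carrier R. r \<odot>\<^bsub>E\<^esub> e)"
  proof (rule mhomI)
    fix e assume "e \<in> carrier E"
    then show "(\<lambda>r\<in>carrier R. r \<odot>\<^bsub>E\<^esub> e) \<in> carrier (Hom_module R (regular_module R) E)"
      using mhom_restrict_mod_hom[OF smult_mhom(1)[OF E] regular_module] by simp
  qed (use E in \<open>auto simp: fun_eq_iff restrict_def mod_r_distr m_comm simp flip: mod_smult_assoc\<close>)
  show "mhom R (Hom_module R (regular_module R) E) E (\<lambda>\<phi>. \<phi> \<one>)"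
    by (rule mhomI) (auto simp: mod_hom_closed)
  assume ph: "\<phi> \<in> mod_hom R (regular_module R) E"
  have "r \<odot>\<^bsub>E\<^esub> \<phi> \<one> = \<phi> r" if "r \<in> carrier R" for r
    using mhom_smult[OF mod_hom_mhom[OF ph] that, of \<one>] that by simp
  then show "(\<lambda>r\<in>carrier R. r \<odot>\<^bsub>E\<^esub> \<phi> \<one>) = \<phi>"
    using mod_hom_arb[OF ph] by (auto simp: fun_eq_iff restrict_def)
qed

lemma Hom_regular_baer:
  assumes E: "baer E" shows "baer (Hom_module R (regular_module R) E)"
  by (rule baer_retract[OF E Hom_is_module[OF regular_module baer_module[OF E]]
        Hom_regular(2)[OF baer_module[OF E]] Hom_regular(1)[OF baer_module[OF E]]])
    (use Hom_regular(3)[OF baer_module[OF E]] in simp)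

lemma torsion_Hom_pointwise:
  assumes X: "X \<subseteq> carrier R" and M: "module R M" and E: "module R E" and ph: "\<phi> \<in> torsion X (Hom_module R M E)" and m: "m \<in> carrier M"
  shows "\<phi> m \<in> torsion X E"
proof -
  have c: "\<phi> m \<in> carrier E" using torsion_carrier[OF ph] m by (simp add: mod_hom_closed)
  have "\<exists>n::nat. (x [^] n) \<odot>\<^bsub>E\<^esub> \<phi> m = \<zero>\<^bsub>E\<^esub>" if x: "x \<in> X" for x
  proof -
    obtain n :: nat where n: "(x [^] n) \<odot>\<^bsub>Hom_module R M E\<^esub> \<phi> = \<zero>\<^bsub>Hom_module R M E\<^esub>" using ph x unfolding torsion_def by blast
    from fun_cong[OF n, of m] m show ?thesis by auto
  qed
  then show ?thesis using c by (simp add: torsion_def)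
qed

text \<open>Finitely many generators need only finitely many exponents, so one power of
  \<open>x\<close> kills all values of \<open>\<phi>\<close>. Together with
  \<open>torsion_Hom_pointwise\<close> this identifies the torsion of Hom(M, E) with the maps into
  the torsion of \<open>E\<close>.\<close>

lemma torsion_HomI:
  assumes X: "X \<subseteq> carrier R" and M: "module R M" and S: "finite S" "S \<subseteq> carrier M" "span M S = carrier M"
    and E: "module R E" and ph: "\<phi> \<in> mod_hom R M E" and t: "\<And>m. m \<in> carrier M \<Longrightarrow> \<phi> m \<in> torsion X E"
  shows "\<phi> \<in> torsion X (Hom_module R M E)"
proof -
  have "\<exists>n::nat. (x [^] n) \<odot>\<^bsub>Hom_module R M E\<^esub> \<phi> = \<zero>\<^bsub>Hom_module R M E\<^esub>" if x: "x \<in> X" for x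
  proof -
    have xc: "x \<in> carrier R" using x X by blast
    have "\<forall>s\<in>S. \<exists>n::nat. (x [^] n) \<odot>\<^bsub>E\<^esub> \<phi> s = \<zero>\<^bsub>E\<^esub>" using t x S(2) unfolding torsion_def by blast
    then obtain N :: "_ \<Rightarrow> nat" where N: "\<And>s. s \<in> S \<Longrightarrow> (x [^] N s) \<odot>\<^bsub>E\<^esub> \<phi> s = \<zero>\<^bsub>E\<^esub>" by metis
    \<comment> \<open>The sum serves as a common upper bound of the exponents.\<close>
    define n where "n = (\<Sum>s\<in>S. N s)"
    have "mhom R M E (\<lambda>m. (x [^] n) \<odot>\<^bsub>E\<^esub> \<phi> m)"
      by (rule mhom_smult_const[OF nat_pow_closed[OF xc] mod_hom_mhom[OF ph] M E])
    from kernel_submod[OF this M E] have K: "submodule {m \<in> carrier M. (x [^] n) \<odot>\<^bsub>E\<^esub> \<phi> m = \<zero>\<^bsub>E\<^esub>} R M" .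
    have "(x [^] n) \<odot>\<^bsub>E\<^esub> \<phi> s = \<zero>\<^bsub>E\<^esub>" if s: "s \<in> S" for s
      by (rule pow_kills_mono[OF E xc _ N[OF s]])
        (use s S mod_hom_closed[OF ph] in \<open>auto simp: n_def intro: member_le_sum\<close>)
    then have "span M S \<subseteq> {m \<in> carrier M. (x [^] n) \<odot>\<^bsub>E\<^esub> \<phi> m = \<zero>\<^bsub>E\<^esub>}"
      using S(2) by (intro span_submod(3)[OF M S(2) K]) blast
    then have "(x [^] n) \<odot>\<^bsub>E\<^esub> \<phi> m = \<zero>\<^bsub>E\<^esub>" if "m \<in> carrier M" for m using S(3) that by blast
    then show ?thesis by (intro exI[of _ n]) (auto simp: fun_eq_iff restrict_def)
  qed
  then show ?thesis using ph by (simp add: torsion_def)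
qed

section \<open>Acyclic resolutions\<close>

lemma lc_zero_iso:
  assumes X: "X \<subseteq> carrier R" and M: "module R M" and N: "module R N" and f: "mhom R M N f" "bij_betw f (carrier M) (carrier N)"
  shows "lc_zero X i M \<longleftrightarrow> lc_zero X i N"
proof -
  obtain E d e where "chosen_injective_resolution R N = (E, d)" and r: "baer_resolution N E d e"
    by (rule chosen_baer_resolution[OF N])
  have "baer_resolution M E d (\<lambda>x. e (f x))" using resolution_iso[OF baer_resolutionD(1)[OF r] M f] baer_resolutionD(2)[OF r] by (simp add: baer_resolution_def)
  then show ?thesis using lc_zero_iff_torsion_exact[OF X r] lc_zero_iff_torsion_exact[OF X] by blast
qed

text \<open>Dimension shifting along the sequences of cocycles \<open>Z i\<close>,
  \<open>K i\<close>, \<open>Z (i + 1)\<close>: acyclicity of \<open>K i\<close> trades one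
  cohomological degree for one step in the complex, until degree one is reached.\<close>

lemma lc_zero_acyclic_resolution:
  assumes X: "X \<subseteq> carrier R" and r: "resolution A K d e" and acyc: "\<And>i j. lc_zero X (Suc j) (K i)"
  shows "lc_zero X i A \<longleftrightarrow> torsion_exact X K d i"
proof -
  note r' = resolutionD[OF r] and dd = resolution_dd[OF r]
  define Z where "Z i = (K i)\<lparr>carrier := {z \<in> carrier (K i). d i z = \<zero>\<^bsub>K (Suc i)\<^esub>}\<rparr>" for i
  have Zs: "submodule {z \<in> carrier (K i). d i z = \<zero>\<^bsub>K (Suc i)\<^esub>} R (K i)" for i by (rule kernel_submod[OF r'(3,2,2)])
  have Zm: "module R (Z i)" for i unfolding Z_def by (rule submod_module[OF r'(2) Zs])
  have Zc: "carrier (Z i) = {z \<in> carrier (K i). d i z = \<zero>\<^bsub>K (Suc i)\<^esub>}" for i by (simp add: Z_def)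
  have Zz: "\<zero>\<^bsub>Z i\<^esub> = \<zero>\<^bsub>K i\<^esub>" for i by (simp add: Z_def)
  have dZ: "mhom R (K i) (Z (Suc i)) (d i)" for i
    unfolding Z_def by (rule mhom_corestrict[OF r'(3)]) (use mhom_closed[OF r'(3)] dd(2) in simp)
  have im: "d i ` carrier (K i) = carrier (Z (Suc i))" for i
    unfolding Zc using r'(7)[of _ i] mhom_closed[OF r'(3)] dd(2) by blast
  have s: "ses (Z i) (K i) (Z (Suc i)) (\<lambda>x. x) (d i)" for i
    using ses_kernel[OF r'(2) Zm dZ im] by (simp only: Z_def) simp
  have torZ: "z \<in> torsion X (Z i) \<longleftrightarrow> z \<in> torsion X (K i) \<and> d i z = \<zero>\<^bsub>K (Suc i)\<^esub>" for z i
    by (auto simp: torsion_def Z_def)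
  have sh: "lc_zero X (Suc j) (Z (Suc i)) \<longleftrightarrow> lc_zero X (Suc (Suc j)) (Z i)" for i j
    using les_A[OF X s _ acyc] les_C[OF X s acyc] by blast
  have shift: "lc_zero X (Suc (j + n)) (Z i) \<longleftrightarrow> lc_zero X (Suc j) (Z (i + n))" for i j n
  proof (induction n arbitrary: j i)
    case (Suc n)
    show ?case using Suc[of "Suc j" i] sh[of j "i + n"] by simp
  qed simp
  \<comment> \<open>The first local cohomology of \<open>Z j\<close> is the cokernel of the torsion
    of \<open>K j\<close> in the torsion of \<open>Z (j + 1)\<close>, which is the cohomology of the
    torsion complex in degree \<open>j + 1\<close>.\<close>
  have one: "lc_zero X (Suc 0) (Z j) \<longleftrightarrow> torsion_exact X K d (Suc j)" for j
  proof
    assume "lc_zero X (Suc 0) (Z j)"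
    then have "z \<in> d j ` torsion X (K j)" if "z \<in> torsion X (Z (Suc j))" for z using les_surj[OF X s _ that] by blast
    then show "torsion_exact X K d (Suc j)" by (simp add: torsion_exact_def torZ)
  next
    assume "torsion_exact X K d (Suc j)"
    then show "lc_zero X (Suc 0) (Z j)"
      by (intro les_A1[OF X s acyc]) (auto simp: torsion_exact_def torZ)
  qed
  have eZ: "mhom R A (Z 0) e" unfolding Z_def by (rule mhom_corestrict[OF r'(4)]) (use mhom_closed[OF r'(4)] dd(1) in simp)
  have "e ` carrier A = carrier (Z 0)" unfolding Zc using r'(6) mhom_closed[OF r'(4)] dd(1) by blast
  then have iso: "lc_zero X i A \<longleftrightarrow> lc_zero X i (Z 0)" for i
    using r'(5) by (intro lc_zero_iso[OF X r'(1) Zm eZ]) (simp add: bij_betw_def)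
  show ?thesis
  proof (cases i)
    case 0
    have "\<zero>\<^bsub>Z 0\<^esub> \<in> torsion X (Z 0)" by (rule submod_zero[OF Zm torsion_submod[OF X Zm]])
    then have "torsion X (Z 0) = {\<zero>\<^bsub>Z 0\<^esub>} \<longleftrightarrow> (\<forall>z\<in>torsion X (Z 0). z = \<zero>\<^bsub>K 0\<^esub>)" unfolding Zz by blast
    also have "\<dots> \<longleftrightarrow> torsion_exact X K d 0" unfolding torsion_exact_def nat.case using torZ[of _ 0] by blast
    finally show ?thesis using 0 iso[of 0] lc_zero_0_iff[OF X Zm] by simp
  next
    case (Suc j)
    then show ?thesis using iso[of i] shift[of 0 j 0] one[of j] by simp
  qed
qed

section \<open>Splitting and vanishing of cohomology\<close>

text \<open>The injective kernel has a retraction \<open>\<rho>\<close>. The map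
  \<open>c - \<rho> c\<close> vanishes on the kernel and factors through \<open>d\<close>, which
  gives a section; so the image of \<open>d\<close> is a retract of \<open>C\<close> and injective
  in turn.\<close>

lemma split_step:
  fixes C :: "('a, 'x) module" and C' :: "('a, 'y) module"
  assumes C: "baer C" and C': "module R C'" and d: "mhom R C C' d"
    and Z: "baer (C\<lparr>carrier := {z \<in> carrier C. d z = \<zero>\<^bsub>C'\<^esub>}\<rparr>)"
  shows "\<exists>s. mhom R (C'\<lparr>carrier := d ` carrier C\<rparr>) C s \<and> (\<forall>b\<in>d ` carrier C. d (s b) = b)"
    and "baer (C'\<lparr>carrier := d ` carrier C\<rparr>)"
proof -
  note Cm = baer_module[OF C]
  let ?Z = "{z \<in> carrier C. d z = \<zero>\<^bsub>C'\<^esub>}" and ?B = "C'\<lparr>carrier := d ` carrier C\<rparr>"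
  have Zs: "submodule ?Z R C" by (rule kernel_submod[OF d Cm C'])
  have B: "module R ?B" by (rule submod_module[OF C' image_submod[OF d Cm C']])
  have dB: "mhom R C ?B d" by (rule mhom_corestrict[OF d]) simp
  have idZ: "mhom R (C\<lparr>carrier := ?Z\<rparr>) (C\<lparr>carrier := ?Z\<rparr>) (\<lambda>x. x)" by (simp add: mhom_def)
  obtain \<rho> where \<rho>: "mhom R C (C\<lparr>carrier := ?Z\<rparr>) \<rho>" "\<forall>x\<in>?Z. \<rho> x = x"
    using baer_extend[OF Z Cm Zs idZ] by blast
  have \<rho>': "mhom R C C \<rho>" by (rule mhom_codomain_mono[OF \<rho>(1)]) auto
  have \<rho>d: "d (\<rho> x) = \<zero>\<^bsub>C'\<^esub>" if "x \<in> carrier C" for x using mhom_closed[OF \<rho>(1) that] by simp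
  have u: "mhom R C C (\<lambda>c. c \<ominus>\<^bsub>C\<^esub> \<rho> c)" by (intro mhom_diff \<rho>' Cm) (simp add: mhom_def)
  have "c \<ominus>\<^bsub>C\<^esub> \<rho> c = \<zero>\<^bsub>C\<^esub>" if "c \<in> carrier C" "d c = \<zero>\<^bsub>?B\<^esub>" for c
  proof -
    have "\<rho> c = c" using \<rho>(2) that by simp
    then show ?thesis using that Cm by simp
  qed
  from baer_factor[OF C Cm B dB u this] obtain s where
    s: "mhom R ?B C s" "\<And>c. c \<in> carrier C \<Longrightarrow> s (d c) = c \<ominus>\<^bsub>C\<^esub> \<rho> c" by blast
  have ds: "d (s b) = b" if b: "b \<in> d ` carrier C" for b
  proof -
    obtain c where c: "c \<in> carrier C" "b = d c" using b by blast
    show ?thesis using s(2)[OF c(1)] c mhom_minus[OF d Cm C' c(1) mhom_closed[OF \<rho>' c(1)]] \<rho>d[OF c(1)] C' mhom_closed[OF d c(1)]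
      by (simp add: mod_minus_eq)
  qed
  show "\<exists>s. mhom R ?B C s \<and> (\<forall>b\<in>d ` carrier C. d (s b) = b)" using s(1) ds by blast
  show "baer ?B" by (rule baer_retract[OF C B s(1) dB]) (use ds in simp)
qed

lemma is_zero_quotient:
  assumes M: "module R M" and N: "submodule N R M"
  shows "is_zero_module (quotient_module M N) \<longleftrightarrow> carrier M \<subseteq> N"
proof -
  note s = sesD[OF quotient_ses[OF M N]]
  have "carrier (quotient_module M N) = {\<zero>\<^bsub>quotient_module M N\<^esub>} \<longleftrightarrow> (\<forall>x\<in>carrier M. N +>\<^bsub>M\<^esub> x = \<zero>\<^bsub>quotient_module M N\<^esub>)"
    unfolding s(7)[symmetric] using mod_zero_closed[OF M] by auto
  also have "\<dots> \<longleftrightarrow> carrier M \<subseteq> N" using s(8) by auto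
  finally show ?thesis by (simp add: is_zero_module_def)
qed

text \<open>This translates the cohomology modules of the definitions into the elementwise exactness
  used in the proof.\<close>

lemma is_zero_cohomology:
  fixes C :: "nat \<Rightarrow> ('a, 'c) module"
  assumes C: "\<And>i. module R (C i)" and d: "\<And>i. mhom R (C i) (C (Suc i)) (d i)"
    and dd: "\<And>i z. z \<in> carrier (C i) \<Longrightarrow> d (Suc i) (d i z) = \<zero>\<^bsub>C (Suc (Suc i))\<^esub>"
  shows "is_zero_module (cohomology C d i) \<longleftrightarrow>
    (\<forall>z\<in>carrier (C i). d i z = \<zero>\<^bsub>C (Suc i)\<^esub> \<longrightarrow> (case i of 0 \<Rightarrow> z = \<zero>\<^bsub>C 0\<^esub> | Suc j \<Rightarrow> z \<in> d j ` carrier (C j)))"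
proof -
  let ?Z = "a_kernel (C i) (C (Suc i)) (d i)"
  have Zeq: "?Z = {z \<in> carrier (C i). d i z = \<zero>\<^bsub>C (Suc i)\<^esub>}" by (simp add: a_kernel_def')
  have Z: "submodule ?Z R (C i)" unfolding Zeq by (rule kernel_submod[OF d C C])
  have Zm: "module R ((C i)\<lparr>carrier := ?Z\<rparr>)" by (rule submod_module[OF C Z])
  have B: "submodule (coboundaries C d i) R (C i)"
  proof (cases i)
    case 0 then show ?thesis using zero_submod[OF C] by (simp add: coboundaries_def)
  next
    case (Suc j) then show ?thesis using image_submod[OF d C C] by (simp add: coboundaries_def)
  qed
  have BZ: "coboundaries C d i \<subseteq> ?Z"
  proof (cases i)
    case 0 then show ?thesis unfolding Zeq using mhom_zero[OF d C C] C by (simp add: coboundaries_def)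
  next
    case (Suc j) then show ?thesis unfolding Zeq using dd mhom_closed[OF d] by (auto simp: coboundaries_def)
  qed
  have "submodule (coboundaries C d i) R ((C i)\<lparr>carrier := ?Z\<rparr>)"
    by (rule submodI[OF Zm]) (use BZ submod_rules[OF C B] in auto)
  then have "is_zero_module (cohomology C d i) \<longleftrightarrow> ?Z \<subseteq> coboundaries C d i"
    using is_zero_quotient[OF Zm] by (simp add: cohomology_def)
  also have "\<dots> \<longleftrightarrow> (\<forall>z\<in>carrier (C i). d i z = \<zero>\<^bsub>C (Suc i)\<^esub> \<longrightarrow> (case i of 0 \<Rightarrow> z = \<zero>\<^bsub>C 0\<^esub> | Suc j \<Rightarrow> z \<in> d j ` carrier (C j)))"
    unfolding Zeq by (cases i) (auto simp: coboundaries_def)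
  finally show ?thesis .
qed

end

section \<open>Cohomological dimension over Noetherian rings\<close>

locale noeth_cring = cring R + noetherian_ring R for R (structure)

context noeth_cring
begin

text \<open>By the Noetherian property a nonempty chain of ideals contains its union, so Zorn's
  lemma applies to every nonempty family.\<close>

lemma ideal_maximal:
  assumes "F \<noteq> {}" "\<And>I. I \<in> F \<Longrightarrow> ideal I R"
  shows "\<exists>I\<in>F. \<forall>J\<in>F. I \<subseteq> J \<longrightarrow> J = I"
proof (rule subset_Zorn)
  fix C assume C: "subset.chain F C"
  show "\<exists>U\<in>F. \<forall>X\<in>C. X \<subseteq> U"
  proof (cases "C = {}")
    case False
    have "subset.chain {I. ideal I R} C" using C assms(2) by (auto simp: subset.chain_def)
    then have "\<Union>C \<in> C" by (rule ideal_chain_is_trivial[OF False])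
    then show ?thesis using C by (intro bexI[of _ "\<Union>C"]) (auto simp: subset.chain_def)
  qed (use assms in auto)
qed

text \<open>The colon ideals \<open>(I : x^k)\<close> increase with \<open>k\<close> and become
  stationary. This is the Artin-Rees property for a single element: an element
  \<open>r x^(n+j)\<close> of \<open>I\<close> is \<open>x^j\<close> times the element
  \<open>r x^n\<close> of \<open>I\<close>.\<close>

lemma colon_stabilizes:
  assumes I: "ideal I R" and x: "x \<in> carrier R"
  obtains n :: nat where "\<And>k r. r \<in> carrier R \<Longrightarrow> r \<otimes> x [^] (k::nat) \<in> I \<Longrightarrow> r \<otimes> x [^] n \<in> I"
proof -
  define Q where "Q k = {r \<in> carrier R. r \<otimes> x [^] (k::nat) \<in> I}" for k
  have Q: "ideal (Q k) R" for k
    using annihilator_ideal[OF regular_module ideal_submodule[OF I], of "x [^] k"] x by (simp add: Q_def)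
  have mono: "Q k \<subseteq> Q l" if "k \<le> l" for k l
  proof
    fix r assume r: "r \<in> Q k"
    have "r \<otimes> x [^] l = x [^] (l - k) \<otimes> (r \<otimes> x [^] k)"
      using r x that by (simp add: Q_def nat_pow_mult m_lcomm)
    then show "r \<in> Q l" using r ideal.I_l_closed[OF I, of "r \<otimes> x [^] k" "x [^] (l - k)"] x by (simp add: Q_def)
  qed
  obtain n where n: "\<And>k. Q n \<subseteq> Q k \<Longrightarrow> Q k = Q n"
    using ideal_maximal[of "range Q"] Q by auto
  have "Q k \<subseteq> Q n" for k
    using mono[of k "max k n"] n[OF mono[of n "max k n"]] by simp
  then show ?thesis using that[of n] by (auto simp: Q_def)
qed

section \<open>Torsion submodules of injective modules\<close>

text \<open>One power \<open>x^n\<close> kills the image of \<open>f\<close>, and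
  \<open>x^k R\<close> meets \<open>I\<close> inside \<open>x^n I\<close> for large
  \<open>k\<close>. So \<open>f\<close> extends by zero to \<open>I + x^k R\<close> and then to
  \<open>R\<close>, and \<open>x^k\<close> kills the image of the unit.\<close>

lemma torsion_baer_single:
  assumes E: "baer E" and x: "x \<in> carrier R"
  shows "baer (E\<lparr>carrier := torsion {x} E\<rparr>)"
proof -
  note Em = baer_module[OF E]
  have X: "{x} \<subseteq> carrier R" using x by simp
  let ?T = "E\<lparr>carrier := torsion {x} E\<rparr>"
  note T = torsion_submod[OF X Em]
  show ?thesis
    unfolding baer_def
  proof (intro conjI allI impI)
    show "module R ?T" by (rule submod_module[OF Em T])
    fix I f assume I: "ideal I R" and f: "mhom R (ideal_module I) ?T f"
    note Ic = ideal.Icarr[OF I]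
    have fE: "mhom R (ideal_module I) E f" by (rule mhom_codomain_mono[OF f submod_subset[OF Em T]])
    have ft: "f r \<in> torsion {x} E" if "r \<in> I" for r using mhom_closed[OF f] that by simp
    have fc: "f r \<in> carrier E" if "r \<in> I" for r using torsion_carrier[OF ft[OF that]] .
    note Im = ideal_module[OF I]
    \<comment> \<open>The kernels of the maps \<open>x^n f\<close> increase and exhaust
      \<open>I\<close>; stationarity gives one exponent for all of \<open>I\<close>.\<close>
    define K where "K n = {r \<in> I. (x [^] (n::nat)) \<odot>\<^bsub>E\<^esub> f r = \<zero>\<^bsub>E\<^esub>}" for n
    have K: "ideal (K n) R" for n
    proof -
      have "submodule (K n) R (ideal_module I)"
        using kernel_submod[OF mhom_smult_const[OF nat_pow_closed[OF x] fE Im Em] Im Em] by (simp add: K_def)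
      from submod_rules[OF Im this] show ?thesis
        by (intro submodule_ideal submodI[OF regular_module]) (auto simp: Ic)
    qed
    have Kmono: "K k \<subseteq> K l" if "k \<le> l" for k l
      using pow_kills_mono[OF Em x fc _ that] by (auto simp: K_def)
    obtain n where n: "\<And>k. K n \<subseteq> K k \<Longrightarrow> K k = K n"
      using ideal_maximal[of "range K"] K by auto
    have kill: "(x [^] n) \<odot>\<^bsub>E\<^esub> f r = \<zero>\<^bsub>E\<^esub>" if r: "r \<in> I" for r
    proof -
      obtain m :: nat where "r \<in> K m" using ft[OF r] r by (auto simp: torsion_def K_def)
      then have "r \<in> K n" using Kmono[of m "max m n"] n[OF Kmono[of n "max m n"]] by auto
      then show ?thesis by (simp add: K_def)
    qed
    obtain q :: nat where q: "\<And>k r. r \<in> carrier R \<Longrightarrow> r \<otimes> x [^] (k::nat) \<in> I \<Longrightarrow> r \<otimes> x [^] q \<in> I"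
      using colon_stabilizes[OF I x] by blast
    define k where "k = q + n"
    \<comment> \<open>\<open>I + x^k R\<close> is presented as an image of the direct sum of
      \<open>I\<close> and \<open>R\<close>, so that \<open>baer_factor\<close> treats
      well-definedness and extension at once.\<close>
    let ?B = "dsum (ideal_module I) (regular_module R)"
    have B: "module R ?B" by (rule dsum_module[OF Im regular_module])
    have p: "mhom R ?B (regular_module R) (\<lambda>(a, r). a \<oplus> r \<otimes> x [^] k)"
      using x Ic by (auto simp: mhom_def l_distr r_distr a_ac m_assoc)
    have u: "mhom R ?B E (\<lambda>(a, r). f a)"
      using mhom_add[OF fE] mhom_smult[OF fE] fc by (auto simp: mhom_def)
    \<comment> \<open>If \<open>a = - r x^k\<close> lies in \<open>I\<close>, then
      \<open>r x^q\<close> already does, and \<open>f\<close> kills its multiple by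
      \<open>x^n\<close>.\<close>
    have ker: "(\<lambda>(a, r). f a) z = \<zero>\<^bsub>E\<^esub>"
      if "z \<in> carrier ?B" "(\<lambda>(a, r). a \<oplus> r \<otimes> x [^] k) z = \<zero>\<^bsub>regular_module R\<^esub>" for z
    proof -
      obtain a r where z: "z = (a, r)" "a \<in> I" "r \<in> carrier R" using \<open>z \<in> carrier ?B\<close> by auto
      have "a \<oplus> r \<otimes> x [^] k = \<zero>" using that z by simp
      then have a: "a = \<ominus> (r \<otimes> x [^] k)"
        using z x Ic minus_equality[of a "r \<otimes> x [^] k"] by simp
      have na: "\<ominus> a \<in> I" using additive_subgroup.a_inv_closed[OF ideal.axioms(1)[OF I] z(2)] .
      then have "r \<otimes> x [^] k \<in> I" using a z x by simp
      then have rq: "r \<otimes> x [^] q \<in> I" using q[OF z(3)] by blast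
      have "\<ominus> a = x [^] n \<otimes> (r \<otimes> x [^] q)"
        using a z x by (simp add: k_def m_lcomm m_comm nat_pow_mult[symmetric])
      then have "f (\<ominus> a) = (x [^] n) \<odot>\<^bsub>E\<^esub> f (r \<otimes> x [^] q)"
        using mhom_smult[OF fE, of "x [^] n" "r \<otimes> x [^] q"] rq x by simp
      then have "f (\<ominus> a) = \<zero>\<^bsub>E\<^esub>" using kill[OF rq] by simp
      moreover have "a = (\<ominus> \<one>) \<otimes> (\<ominus> a)" using Ic[OF z(2)] by (simp add: l_minus)
      ultimately have "f a = \<zero>\<^bsub>E\<^esub>" using mhom_smult[OF fE, of "\<ominus> \<one>" "\<ominus> a"] na Em by simp
      then show ?thesis using z by simp
    qed
    from baer_factor[OF E B regular_module p u ker] obtain h where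
      h: "mhom R (regular_module R) E h" "\<forall>z\<in>carrier ?B. h ((\<lambda>(a, r). a \<oplus> r \<otimes> x [^] k) z) = (\<lambda>(a, r). f a) z" by blast
    have I0: "\<zero> \<in> I" by (rule additive_subgroup.zero_closed[OF ideal.axioms(1)[OF I]])
    have hf: "h (a \<oplus> r \<otimes> x [^] k) = f a" if "a \<in> I" "r \<in> carrier R" for a r
      using h(2)[rule_format, of "(a, r)"] that by simp
    have hs: "h r = r \<odot>\<^bsub>E\<^esub> h \<one>" if "r \<in> carrier R" for r
      using mhom_smult[OF h(1), of r \<one>] that by simp
    have h1: "h \<one> \<in> carrier E" using mhom_closed[OF h(1), of \<one>] by simp
    have "f r = r \<odot>\<^bsub>E\<^esub> h \<one>" if "r \<in> I" for r
      using hf[OF that zero_closed] hs[OF Ic[OF that]] x Ic[OF that] by simp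
    moreover have "(x [^] k) \<odot>\<^bsub>E\<^esub> h \<one> = \<zero>\<^bsub>E\<^esub>"
      using hf[OF I0 one_closed] hs[of "x [^] k"] x mhom_zero[OF fE Im Em] by simp
    ultimately show "\<exists>e\<in>carrier ?T. \<forall>r\<in>I. f r = r \<odot>\<^bsub>?T\<^esub> e"
      using h1 by (intro bexI[of _ "h \<one>"]) (auto simp: torsion_def)
  qed
qed

lemma torsion_insert: "torsion (insert x X) E = torsion {x} (E\<lparr>carrier := torsion X E\<rparr>)"
  by (auto simp: torsion_def)

text \<open>By \<open>torsion_insert\<close> the elements of \<open>X\<close> are treated one after
  another, each time inside an injective module.\<close>

lemma torsion_baer:
  assumes "finite X" "X \<subseteq> carrier R" and E: "baer E"
  shows "baer (E\<lparr>carrier := torsion X E\<rparr>)"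
  using assms(1,2)
proof (induction X)
  case empty
  have "torsion {} E = carrier E" by (auto simp: torsion_def)
  then show ?case using E by simp
next
  case (insert x X)
  then have "baer ((E\<lparr>carrier := torsion X E\<rparr>)\<lparr>carrier := torsion {x} (E\<lparr>carrier := torsion X E\<rparr>)\<rparr>)"
    by (intro torsion_baer_single) auto
  then show ?case unfolding torsion_insert[of x X] by simp
qed

section \<open>Vanishing beyond the number of generators\<close>

text \<open>For stationary annihilators of the powers of \<open>x\<close>, sending
  \<open>x^(n+k)\<close> to \<open>x^n w\<close> is well defined; \<open>v\<close> is the image of
  the unit under an extension. In other words, the fraction \<open>w / x^k\<close> in the
  localization at \<open>x\<close> comes from an element of \<open>E\<close>.\<close>

lemma baer_almost_divisible:
  assumes E: "baer E" and x: "x \<in> carrier R" and w: "w \<in> carrier E"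
  obtains v n where "v \<in> carrier E" "(x [^] (n + k :: nat)) \<odot>\<^bsub>E\<^esub> v = (x [^] n) \<odot>\<^bsub>E\<^esub> w"
proof -
  note Em = baer_module[OF E]
  obtain n :: nat where n: "\<And>k r. r \<in> carrier R \<Longrightarrow> r \<otimes> x [^] (k::nat) \<in> {\<zero>} \<Longrightarrow> r \<otimes> x [^] n \<in> {\<zero>}"
    using colon_stabilizes[OF zeroideal x] by blast
  have p: "mhom R (regular_module R) (regular_module R) (\<lambda>r. r \<otimes> x [^] (n + k))"
    using x by (auto simp: mhom_def l_distr m_assoc)
  have u: "mhom R (regular_module R) E (\<lambda>r. r \<odot>\<^bsub>E\<^esub> ((x [^] n) \<odot>\<^bsub>E\<^esub> w))"
    using smult_mhom(1)[OF Em, of "(x [^] n) \<odot>\<^bsub>E\<^esub> w"] x w Em by simp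
  have "r \<odot>\<^bsub>E\<^esub> ((x [^] n) \<odot>\<^bsub>E\<^esub> w) = \<zero>\<^bsub>E\<^esub>"
    if "r \<in> carrier (regular_module R)" "r \<otimes> x [^] (n + k) = \<zero>\<^bsub>regular_module R\<^esub>" for r
    using n[of r "n + k"] that x w Em by (simp flip: mod_smult_assoc)
  from baer_factor[OF E regular_module regular_module p u this] obtain h where
    h: "mhom R (regular_module R) E h" "\<And>r. r \<in> carrier R \<Longrightarrow> h (r \<otimes> x [^] (n + k)) = r \<odot>\<^bsub>E\<^esub> ((x [^] n) \<odot>\<^bsub>E\<^esub> w)"
    by auto
  have "h (x [^] (n + k)) = (x [^] (n + k)) \<odot>\<^bsub>E\<^esub> h \<one>"
    using mhom_smult[OF h(1), of "x [^] (n + k)" \<one>] x by simp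
  then have "(x [^] (n + k)) \<odot>\<^bsub>E\<^esub> h \<one> = (x [^] n) \<odot>\<^bsub>E\<^esub> w" using h(2)[of \<one>] x w Em by simp
  then show ?thesis using that[of "h \<one>" n] mhom_closed[OF h(1), of \<one>] by simp
qed

text \<open>Passing to \<open>x\<close>-torsion costs one degree. A primitive \<open>y\<close> of
  \<open>z\<close> satisfies \<open>x^k y = d w\<close>; dividing \<open>w\<close> by
  \<open>x^k\<close> up to torsion gives \<open>v\<close>, and \<open>y - d v\<close> is a torsion
  primitive of \<open>z\<close>.\<close>

lemma torsion_single_exact:
  fixes C :: "nat \<Rightarrow> ('a, 'c) module"
  assumes C: "\<And>i. baer (C i)" and d: "\<And>i. mhom R (C i) (C (Suc i)) (d i)"
    and dd: "\<And>i z. z \<in> carrier (C i) \<Longrightarrow> d (Suc i) (d i z) = \<zero>\<^bsub>C (Suc (Suc i))\<^esub>"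
    and ex: "\<And>j z. m \<le> j \<Longrightarrow> z \<in> carrier (C (Suc j)) \<Longrightarrow> d (Suc j) z = \<zero>\<^bsub>C (Suc (Suc j))\<^esub> \<Longrightarrow> \<exists>y\<in>carrier (C j). z = d j y"
    and x: "x \<in> carrier R" and j: "Suc m \<le> j"
    and z: "z \<in> torsion {x} (C (Suc j))" "d (Suc j) z = \<zero>\<^bsub>C (Suc (Suc j))\<^esub>"
  shows "\<exists>y\<in>torsion {x} (C j). z = d j y"
proof -
  note Cm = baer_module[OF C]
  obtain l where l: "j = Suc l" "m \<le> l" using j by (cases j) auto
  have dc: "\<And>i z. z \<in> carrier (C i) \<Longrightarrow> d i z \<in> carrier (C (Suc i))" by (rule mhom_closed[OF d])
  obtain y where y: "y \<in> carrier (C j)" "z = d j y" using ex[of j z] j torsion_carrier[OF z(1)] z(2) by auto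
  obtain k :: nat where k: "(x [^] k) \<odot>\<^bsub>C (Suc j)\<^esub> z = \<zero>\<^bsub>C (Suc j)\<^esub>" using z(1) by (auto simp: torsion_def)
  have xy: "(x [^] k) \<odot>\<^bsub>C j\<^esub> y \<in> carrier (C (Suc l))" using y x l Cm by simp
  have "d (Suc l) ((x [^] k) \<odot>\<^bsub>C j\<^esub> y) = \<zero>\<^bsub>C (Suc (Suc l))\<^esub>"
    using mhom_smult[OF d, of "x [^] k" y j] y x k l by simp
  then obtain w where w: "w \<in> carrier (C l)" "(x [^] k) \<odot>\<^bsub>C j\<^esub> y = d l w" using ex[OF l(2) xy] by blast
  obtain v n where v: "v \<in> carrier (C l)" "(x [^] (n + k :: nat)) \<odot>\<^bsub>C l\<^esub> v = (x [^] n) \<odot>\<^bsub>C l\<^esub> w"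
    using baer_almost_divisible[OF C x w(1)] by blast
  let ?y = "y \<ominus>\<^bsub>C j\<^esub> d l v"
  have dv: "d l v \<in> carrier (C j)" using dc[OF v(1)] l by simp
  have "(x [^] (n + k)) \<odot>\<^bsub>C j\<^esub> d l v = (x [^] n) \<odot>\<^bsub>C j\<^esub> d l w"
    using mhom_smult[OF d, of "x [^] (n + k)" v l] mhom_smult[OF d, of "x [^] n" w l] v w x l by simp
  moreover have "(x [^] (n + k)) \<odot>\<^bsub>C j\<^esub> y = (x [^] n) \<odot>\<^bsub>C j\<^esub> d l w"
    using w(2) y x Cm by (simp add: mod_smult_assoc flip: nat_pow_mult)
  ultimately have "(x [^] (n + k)) \<odot>\<^bsub>C j\<^esub> ?y = \<zero>\<^bsub>C j\<^esub>"
    using y dv x Cm mhom_closed[OF d w(1)] l by (simp add: mod_minus_eq mod_r_distr mod_r_neg_smult)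
  then have "?y \<in> torsion {x} (C j)" using y dv Cm by (auto simp: torsion_def)
  moreover have "d j ?y = z"
    using mhom_minus[OF d Cm Cm y(1) dv] dd[OF v(1)] l y dc[OF y(1)] Cm by (simp add: mod_minus_eq)
  ultimately show ?thesis by blast
qed

text \<open>The resolution is exact in positive degrees, and each generator costs one more degree.
  The induction can continue because the terms of the torsion subcomplexes stay injective.\<close>

lemma lc_zero_large:
  assumes "finite X" "X \<subseteq> carrier R" and N: "module R N" and i: "card X < i"
  shows "lc_zero X i N"
proof -
  obtain E d e where "chosen_injective_resolution R N = (E, d)" and r: "baer_resolution N E d e"
    by (rule chosen_baer_resolution[OF N])
  note r' = resolutionD[OF baer_resolutionD(1)[OF r]] and dd = resolution_dd(2)[OF baer_resolutionD(1)[OF r]] and J = baer_resolutionD(2)[OF r]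
  have "\<forall>j\<ge>card X. \<forall>z\<in>torsion X (E (Suc j)). d (Suc j) z = \<zero>\<^bsub>E (Suc (Suc j))\<^esub> \<longrightarrow> (\<exists>y\<in>torsion X (E j). z = d j y)"
    using assms(1,2)
  proof (induction X)
    case empty
    have "torsion {} (E j) = carrier (E j)" for j by (auto simp: torsion_def)
    then show ?case using r'(7) by auto
  next
    case (insert x X)
    then have X: "X \<subseteq> carrier R" and x: "x \<in> carrier R" by auto
    let ?C = "\<lambda>i. (E i)\<lparr>carrier := torsion X (E i)\<rparr>"
    have C: "baer (?C i)" for i by (rule torsion_baer[OF insert(1) X J])
    have d: "mhom R (?C i) (?C (Suc i)) (d i)" for i
      by (rule mhom_corestrict[OF mhom_restrict[OF r'(3)]])
        (use submod_subset[OF r'(2) torsion_submod[OF X r'(2)]] torsion_mhom[OF X r'(3,2,2)] in auto)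
    have ex: "\<exists>y\<in>carrier (?C j). z = d j y"
      if "card X \<le> j" "z \<in> carrier (?C (Suc j))" "d (Suc j) z = \<zero>\<^bsub>?C (Suc (Suc j))\<^esub>" for j z
      using insert(3)[OF X] that by simp
    have D: "d (Suc i) (d i z) = \<zero>\<^bsub>?C (Suc (Suc i))\<^esub>" if "z \<in> carrier (?C i)" for i z
      using dd[of z i] torsion_carrier[of z X "E i"] that by simp
    show ?case
    proof (intro allI impI ballI)
      fix j z assume "card (insert x X) \<le> j" and z: "z \<in> torsion (insert x X) (E (Suc j))" "d (Suc j) z = \<zero>\<^bsub>E (Suc (Suc j))\<^esub>"
      then have j: "Suc (card X) \<le> j" using insert by simp
      have "\<exists>y\<in>torsion {x} (?C j). z = d j y"
        by (rule torsion_single_exact[where C="?C" and d=d, OF C d D ex x j]) (use z in \<open>auto simp: torsion_insert[of x X]\<close>)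
      then show "\<exists>y\<in>torsion (insert x X) (E j). z = d j y" by (simp add: torsion_insert[of x X])
    qed
  qed
  moreover obtain j where "i = Suc j" "card X \<le> j" using i by (cases i) auto
  ultimately have "torsion_exact X E d i" by (auto simp: torsion_exact_def)
  then show ?thesis using lc_zero_iff_torsion_exact[OF assms(2) r] by simp
qed

section \<open>Right exactness in the top degree\<close>

text \<open>When \<open>x\<close> is adjoined to \<open>N\<close>, a submodule \<open>K\<close> is
  controlled by \<open>K \<inter> N\<close> and by the ideal of coefficients of \<open>x\<close>
  occurring in \<open>K\<close>; both are finitely generated.\<close>

lemma fg_submodule:
  assumes M: "module R M" and S: "finite S" "S \<subseteq> carrier M" and K: "submodule K R M" "K \<subseteq> span M S"
  shows "\<exists>T. finite T \<and> T \<subseteq> carrier M \<and> K = span M T"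
proof -
  have "\<forall>K. submodule K R M \<longrightarrow> K \<subseteq> span M S \<longrightarrow> (\<exists>T. finite T \<and> T \<subseteq> carrier M \<and> K = span M T)"
  proof (rule span_induct[OF M S])
    show "\<forall>K. submodule K R M \<longrightarrow> K \<subseteq> {\<zero>\<^bsub>M\<^esub>} \<longrightarrow> (\<exists>T. finite T \<and> T \<subseteq> carrier M \<and> K = span M T)"
    proof (intro allI impI)
      fix K assume "submodule K R M" "K \<subseteq> {\<zero>\<^bsub>M\<^esub>}"
      then have "K = span M {}" using submod_zero[OF M] span_empty[OF M] by auto
      then show "\<exists>T. finite T \<and> T \<subseteq> carrier M \<and> K = span M T" by blast
    qed
  next
    fix N x assume N: "submodule N R M" and x: "x \<in> carrier M"
      and IH: "\<forall>K. submodule K R M \<longrightarrow> K \<subseteq> N \<longrightarrow> (\<exists>T. finite T \<and> T \<subseteq> carrier M \<and> K = span M T)"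
    show "\<forall>K. submodule K R M \<longrightarrow> K \<subseteq> {n \<oplus>\<^bsub>M\<^esub> r \<odot>\<^bsub>M\<^esub> x | n r. n \<in> N \<and> r \<in> carrier R} \<longrightarrow> (\<exists>T. finite T \<and> T \<subseteq> carrier M \<and> K = span M T)"
    proof (intro allI impI)
      fix K assume K: "submodule K R M" and sub: "K \<subseteq> {n \<oplus>\<^bsub>M\<^esub> r \<odot>\<^bsub>M\<^esub> x | n r. n \<in> N \<and> r \<in> carrier R}"
      note k = submod_rules[OF M K] and n = submod_rules[OF M N]
      \<comment> \<open>The ideal of coefficients at \<open>x\<close> of the elements of
        \<open>L\<close>.\<close>
      define I where "I L = {r \<in> carrier R. \<exists>n\<in>N. n \<oplus>\<^bsub>M\<^esub> r \<odot>\<^bsub>M\<^esub> x \<in> L}" for L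
      have I: "ideal (I L) R" if L: "submodule L R M" for L
      proof (rule submodule_ideal, rule submodI[OF regular_module])
        note l = submod_rules[OF M L]
        have "\<zero>\<^bsub>M\<^esub> \<oplus>\<^bsub>M\<^esub> \<zero> \<odot>\<^bsub>M\<^esub> x \<in> L" using l(3) x M by simp
        then show "\<zero>\<^bsub>regular_module R\<^esub> \<in> I L" using n(3) by (auto simp: I_def)
        fix r assume "r \<in> I L"
        then obtain u where u: "r \<in> carrier R" "u \<in> N" "u \<oplus>\<^bsub>M\<^esub> r \<odot>\<^bsub>M\<^esub> x \<in> L" by (auto simp: I_def)
        { fix t assume "t \<in> I L"
          then obtain v where v: "t \<in> carrier R" "v \<in> N" "v \<oplus>\<^bsub>M\<^esub> t \<odot>\<^bsub>M\<^esub> x \<in> L" by (auto simp: I_def)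
          have "(u \<oplus>\<^bsub>M\<^esub> v) \<oplus>\<^bsub>M\<^esub> (r \<oplus> t) \<odot>\<^bsub>M\<^esub> x = (u \<oplus>\<^bsub>M\<^esub> r \<odot>\<^bsub>M\<^esub> x) \<oplus>\<^bsub>M\<^esub> (v \<oplus>\<^bsub>M\<^esub> t \<odot>\<^bsub>M\<^esub> x)"
            using u v x n(2) M by (simp add: mod_ac mod_l_distr)
          then have "(u \<oplus>\<^bsub>M\<^esub> v) \<oplus>\<^bsub>M\<^esub> (r \<oplus> t) \<odot>\<^bsub>M\<^esub> x \<in> L" using l(4)[OF u(3) v(3)] by simp
          then show "r \<oplus>\<^bsub>regular_module R\<^esub> t \<in> I L" using u v n(4)[OF u(2) v(2)] unfolding I_def by auto }
        fix t assume t: "t \<in> carrier R"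
        have "t \<odot>\<^bsub>M\<^esub> u \<oplus>\<^bsub>M\<^esub> (t \<otimes> r) \<odot>\<^bsub>M\<^esub> x = t \<odot>\<^bsub>M\<^esub> (u \<oplus>\<^bsub>M\<^esub> r \<odot>\<^bsub>M\<^esub> x)"
          using u t x n(2) M by (simp add: mod_r_distr mod_smult_assoc)
        then have "t \<odot>\<^bsub>M\<^esub> u \<oplus>\<^bsub>M\<^esub> (t \<otimes> r) \<odot>\<^bsub>M\<^esub> x \<in> L" using l(7)[OF t u(3)] by simp
        then show "t \<odot>\<^bsub>regular_module R\<^esub> r \<in> I L" using u t n(7)[OF t u(2)] unfolding I_def by auto
      qed (auto simp: I_def)
      have "submodule (K \<inter> N) R M" by (rule submodI[OF M]) (use k n in auto)
      then obtain T where T: "finite T" "T \<subseteq> carrier M" "K \<inter> N = span M T" using IH by auto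
      obtain A where A: "A \<subseteq> carrier R" "finite A" "I K = Idl A" using finetely_gen[OF I[OF K]] by blast
      have AI: "A \<subseteq> I K" using genideal_self[OF A(1)] A(3) by simp
      have "\<forall>a\<in>A. \<exists>n\<in>N. n \<oplus>\<^bsub>M\<^esub> a \<odot>\<^bsub>M\<^esub> x \<in> K" using AI by (auto simp: I_def)
      \<comment> \<open>Lifts to \<open>K\<close> of the generators of the coefficient ideal;
        generators of \<open>K \<inter> N\<close> will complete them to a generating set.\<close>
      then obtain \<nu> where \<nu>: "\<And>a. a \<in> A \<Longrightarrow> \<nu> a \<in> N \<and> \<nu> a \<oplus>\<^bsub>M\<^esub> a \<odot>\<^bsub>M\<^esub> x \<in> K" by metis
      let ?T = "T \<union> (\<lambda>a. \<nu> a \<oplus>\<^bsub>M\<^esub> a \<odot>\<^bsub>M\<^esub> x) ` A"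
      have Tc: "?T \<subseteq> carrier M" using T \<nu> k(2) by auto
      note s = span_submod[OF M Tc] and l = submod_rules[OF M span_submod(1)[OF M Tc]]
      have TK: "T \<subseteq> K" using span_submod(2)[OF M T(2)] T(3) by blast
      have "A \<subseteq> I (span M ?T)"
      proof
        fix a assume a: "a \<in> A"
        then have "\<nu> a \<oplus>\<^bsub>M\<^esub> a \<odot>\<^bsub>M\<^esub> x \<in> span M ?T" using s(2) by blast
        then show "a \<in> I (span M ?T)" using \<nu>[OF a] A(1) a unfolding I_def by blast
      qed
      then have IK: "I K \<subseteq> I (span M ?T)" using genideal_minimal[OF I[OF s(1)]] A(3) by simp
      have KN: "K \<inter> N \<subseteq> span M ?T" unfolding T(3) using s(2) by (intro span_submod(3)[OF M T(2) s(1)]) auto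
      have "K \<subseteq> span M ?T"
      proof
        fix q assume q: "q \<in> K"
        then obtain u r where ur: "u \<in> N" "r \<in> carrier R" "q = u \<oplus>\<^bsub>M\<^esub> r \<odot>\<^bsub>M\<^esub> x" using sub by blast
        then have "r \<in> I K" using q by (auto simp: I_def)
        then obtain v where v: "v \<in> N" "v \<oplus>\<^bsub>M\<^esub> r \<odot>\<^bsub>M\<^esub> x \<in> span M ?T" using IK by (auto simp: I_def)
        have sK: "span M ?T \<subseteq> K" by (rule s(3)[OF K]) (use TK \<nu> in auto)
        have "q \<ominus>\<^bsub>M\<^esub> (v \<oplus>\<^bsub>M\<^esub> r \<odot>\<^bsub>M\<^esub> x) = u \<ominus>\<^bsub>M\<^esub> v" using ur v n(2) x M by (simp add: mod_simps)
        then have "q \<ominus>\<^bsub>M\<^esub> (v \<oplus>\<^bsub>M\<^esub> r \<odot>\<^bsub>M\<^esub> x) \<in> K \<inter> N" using k(6)[OF q, of "v \<oplus>\<^bsub>M\<^esub> r \<odot>\<^bsub>M\<^esub> x"] v sK n(6)[OF ur(1) v(1)] by auto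
        then have "q \<ominus>\<^bsub>M\<^esub> (v \<oplus>\<^bsub>M\<^esub> r \<odot>\<^bsub>M\<^esub> x) \<in> span M ?T" using KN by blast
        from l(4)[OF this v(2)] show "q \<in> span M ?T"
          using mod_eq_from_minus[OF M k(2)[OF q] l(2)[OF v(2)] refl] by simp
      qed
      moreover have "span M ?T \<subseteq> K" by (rule s(3)[OF K]) (use TK \<nu> in auto)
      ultimately have Keq: "K = span M ?T" by (rule equalityI)
      have fin: "finite ?T" using T(1) A(2) by simp
      show "\<exists>T. finite T \<and> T \<subseteq> carrier M \<and> K = span M T" by (intro exI[of _ ?T] conjI fin Tc Keq)
    qed
  qed
  then show ?thesis using K by blast
qed

text \<open>Descending induction on the degree: ideals in degree \<open>j\<close> are finitely
  generated modules, and their vanishing needs only ideals in degree \<open>j + 1\<close>.\<close>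

lemma lc_zero_ideals:
  assumes X: "finite X" "X \<subseteq> carrier R" and v: "\<And>j. i \<le> j \<Longrightarrow> lc_zero X j (regular_module R)" and j: "i \<le> j"
    and I: "ideal I R"
  shows "lc_zero X j (ideal_module I)"
proof -
  \<comment> \<open>\<open>n\<close> is the distance to the degree \<open>Suc (card X)\<close>; the
    second alternative covers degrees that are already beyond the number of generators.\<close>
  have "lc_zero X j (ideal_module I)" if "j + n = Suc (card X) \<or> card X < j" "i \<le> j" "ideal I R" for n j I
    using that
  proof (induction n arbitrary: j I)
    case 0
    then show ?case by (intro lc_zero_large[OF X ideal_module]) auto
  next
    case (Suc n)
    show ?case
    proof (cases "card X < j")
      case True
      then show ?thesis using Suc.prems by (intro lc_zero_large[OF X ideal_module]) auto
    next
      case False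
      then have IH: "\<And>I. ideal I R \<Longrightarrow> lc_zero X (Suc j) (ideal_module I)" using Suc.IH[of "Suc j"] Suc.prems by auto
      obtain A where A: "A \<subseteq> carrier R" "finite A" "I = Idl A" using finetely_gen[OF Suc.prems(3)] by blast
      have "lc_zero X j ((regular_module R)\<lparr>carrier := span (regular_module R) A\<rparr>)"
        by (rule lc_zero_span[OF X(2) regular_module A(2) _ v[OF Suc.prems(2)] IH]) (use A in auto)
      then show ?thesis using span_regular_eq_genideal[OF A(1)] A(3) by (simp add: ideal_module_def)
    qed
  qed
  from this[of j "Suc (card X) - j" I] show ?thesis using j I by (cases "card X < j") auto
qed

lemma lc_zero_fg:
  assumes X: "finite X" "X \<subseteq> carrier R" and v: "\<And>j. i \<le> j \<Longrightarrow> lc_zero X j (regular_module R)"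
    and M: "module R M" and S: "finite S" "S \<subseteq> carrier M" and j: "i \<le> j"
  shows "lc_zero X j (M\<lparr>carrier := span M S\<rparr>)"
  by (rule lc_zero_span[OF X(2) M S v[OF j] lc_zero_ideals[OF X v]]) (use j in auto)

lemma lc_zero_fg_submodule:
  assumes X: "finite X" "X \<subseteq> carrier R" and v: "\<And>j. i \<le> j \<Longrightarrow> lc_zero X j (regular_module R)"
    and M: "module R M" and S: "finite S" "S \<subseteq> carrier M" and K: "submodule K R M" "K \<subseteq> span M S" and j: "i \<le> j"
  shows "lc_zero X j (M\<lparr>carrier := K\<rparr>)"
proof -
  obtain T where "finite T" "T \<subseteq> carrier M" "K = span M T" using fg_submodule[OF M S K] by blast
  then show ?thesis using lc_zero_fg[OF X v M _ _ j] by simp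
qed

lemma lc_zero_zero_module:
  fixes Z :: "('a, 'z) module"
  assumes X: "X \<subseteq> carrier R" and Z: "module R Z" "carrier Z = {\<zero>\<^bsub>Z\<^esub>}"
  shows "lc_zero X (Suc i) Z"
proof (rule lc_zero_baer[OF X])
  show "baer Z" unfolding baer_def
  proof (intro conjI allI impI)
    fix I f assume "ideal I R" and f: "mhom R (ideal_module I) Z f"
    then have "f r = r \<odot>\<^bsub>Z\<^esub> \<zero>\<^bsub>Z\<^esub>" if "r \<in> I" for r
      using mhom_closed[OF f, of r] that Z ideal.Icarr[of I R r] by simp
    then show "\<exists>e\<in>carrier Z. \<forall>r\<in>I. f r = r \<odot>\<^bsub>Z\<^esub> e" using Z by blast
  qed (rule Z(1))
qed

text \<open>With \<open>J\<close> the annihilator of \<open>c\<close>, the isomorphism from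
  \<open>R/J\<close> to \<open>C\<close> is used as a surjection with zero kernel, so that the long
  exact sequence transfers the vanishing.\<close>

lemma lc_zero_cyclic_quotient:
  assumes X: "X \<subseteq> carrier R" and C: "module R C" and c: "c \<in> carrier C"
    and gen: "carrier C = {r \<odot>\<^bsub>C\<^esub> c | r. r \<in> carrier R}"
    and vJ: "lc_zero X i (quotient_module (regular_module R) {r \<in> carrier R. r \<odot>\<^bsub>C\<^esub> c = \<zero>\<^bsub>C\<^esub>})"
  shows "lc_zero X i C"
proof -
  let ?R = "regular_module R"
  define J where "J = {r \<in> carrier R. r \<odot>\<^bsub>C\<^esub> c = \<zero>\<^bsub>C\<^esub>}"
  let ?q = "quotient_module ?R J"
  have J: "ideal J R" using annihilator_ideal[OF C zero_submod[OF C] c] by (simp add: J_def)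
  note s = sesD[OF quotient_ses[OF regular_module ideal_submodule[OF J]]]
  have u: "mhom R ?R C (\<lambda>r. r \<odot>\<^bsub>C\<^esub> c)" by (rule smult_mhom(1)[OF C c])
  define h where "h y = (SOME r. r \<in> carrier R \<and> y = J +>\<^bsub>?R\<^esub> r) \<odot>\<^bsub>C\<^esub> c" for y
  have h: "h (J +>\<^bsub>?R\<^esub> r) = r \<odot>\<^bsub>C\<^esub> c" if r: "r \<in> carrier R" for r
  proof -
    define r' where "r' = (SOME t. t \<in> carrier R \<and> J +>\<^bsub>?R\<^esub> r = J +>\<^bsub>?R\<^esub> t)"
    have r': "r' \<in> carrier R \<and> J +>\<^bsub>?R\<^esub> r = J +>\<^bsub>?R\<^esub> r'"
      unfolding r'_def by (rule someI[of _ r]) (use r in simp)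
    then have "r \<ominus>\<^bsub>?R\<^esub> r' \<in> J" using coset_eq_iff[OF regular_module ideal_submodule[OF J], of r r'] r by simp
    then have "(r \<ominus>\<^bsub>?R\<^esub> r') \<odot>\<^bsub>C\<^esub> c = \<zero>\<^bsub>C\<^esub>" by (simp add: J_def)
    then have "r \<odot>\<^bsub>C\<^esub> c \<ominus>\<^bsub>C\<^esub> r' \<odot>\<^bsub>C\<^esub> c = \<zero>\<^bsub>C\<^esub>" using mhom_minus[OF u regular_module C, of r r'] r r' by simp
    then have "r \<odot>\<^bsub>C\<^esub> c = r' \<odot>\<^bsub>C\<^esub> c" using r r' c C by (simp add: mod_minus_eq_zero)
    then show ?thesis by (simp add: h_def r'_def)
  qed
  have surjq: "\<exists>r\<in>carrier R. y = J +>\<^bsub>?R\<^esub> r" if "y \<in> carrier ?q" for y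
    using that unfolding s(7)[symmetric] by auto
  have hh: "mhom R ?q C h"
  proof (rule mhomI)
    fix y y' assume y: "y \<in> carrier ?q" "y' \<in> carrier ?q"
    obtain r r' where r: "r \<in> carrier R" "y = J +>\<^bsub>?R\<^esub> r" "r' \<in> carrier R" "y' = J +>\<^bsub>?R\<^esub> r'"
      using surjq[OF y(1)] surjq[OF y(2)] by blast
    have "y \<oplus>\<^bsub>?q\<^esub> y' = J +>\<^bsub>?R\<^esub> (r \<oplus> r')" using mhom_add[OF s(5), of r r'] r by simp
    then show "h (y \<oplus>\<^bsub>?q\<^esub> y') = h y \<oplus>\<^bsub>C\<^esub> h y'" using r h c C by (simp add: mod_l_distr)
  next
    fix t y assume t: "t \<in> carrier R" and y: "y \<in> carrier ?q"
    obtain r where r: "r \<in> carrier R" "y = J +>\<^bsub>?R\<^esub> r" using surjq[OF y] by blast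
    have "t \<odot>\<^bsub>?q\<^esub> y = J +>\<^bsub>?R\<^esub> (t \<otimes> r)" using mhom_smult[OF s(5) t, of r] r by simp
    then show "h (t \<odot>\<^bsub>?q\<^esub> y) = t \<odot>\<^bsub>C\<^esub> h y" using r t h c C by (simp add: mod_smult_assoc)
  next
    fix y assume "y \<in> carrier ?q"
    from surjq[OF this] show "h y \<in> carrier C" using h c C by auto
  qed
  have him: "h ` carrier ?q = carrier C"
  proof
    show "h ` carrier ?q \<subseteq> carrier C" using mhom_closed[OF hh] by blast
    show "carrier C \<subseteq> h ` carrier ?q"
    proof
      fix y assume "y \<in> carrier C"
      then obtain r where r: "r \<in> carrier R" "y = r \<odot>\<^bsub>C\<^esub> c" using gen by auto
      have "J +>\<^bsub>?R\<^esub> r \<in> carrier ?q" using mhom_closed[OF s(5), of r] r by simp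
      then show "y \<in> h ` carrier ?q" using h[OF r(1)] r(2) by (intro image_eqI[of _ _ "J +>\<^bsub>?R\<^esub> r"]) auto
    qed
  qed
  have ker: "{y \<in> carrier ?q. h y = \<zero>\<^bsub>C\<^esub>} = {\<zero>\<^bsub>?q\<^esub>}"
  proof -
    have "y = \<zero>\<^bsub>?q\<^esub>" if y: "y \<in> carrier ?q" "h y = \<zero>\<^bsub>C\<^esub>" for y
    proof -
      obtain r where r: "r \<in> carrier R" "y = J +>\<^bsub>?R\<^esub> r" using surjq[OF y(1)] by blast
      then have "r \<in> J" using h y(2) by (simp add: J_def)
      then show ?thesis using s(8)[of r] r by simp
    qed
    then show ?thesis using s(3) mhom_zero[OF hh s(3) C] by auto
  qed
  have "lc_zero X (Suc i) (?q\<lparr>carrier := {\<zero>\<^bsub>?q\<^esub>}\<rparr>)"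
    using submod_module[OF s(3) zero_submod[OF s(3)]] by (intro lc_zero_zero_module[OF X]) auto
  then show ?thesis using les_C[OF X ses_kernel[OF s(3) C hh him]] vJ[folded J_def] ker by simp
qed

text \<open>Maximality of \<open>I\<close> forces nonzero cohomology in degree \<open>i\<close> on
  every nonzero submodule of \<open>R/I\<close>. This makes \<open>I\<close> prime, and it is
  violated by the image of \<open>M\<close>, which inherits vanishing from \<open>M\<close>.\<close>

lemma lc_zero_regular_from_faithful:
  assumes X: "finite X" "X \<subseteq> carrier R"
    and M: "module R M" and S: "finite S" "S \<subseteq> carrier M" "span M S = carrier M"
    and faithful: "\<And>r. r \<in> carrier R \<Longrightarrow> (\<And>m. m \<in> carrier M \<Longrightarrow> r \<odot>\<^bsub>M\<^esub> m = \<zero>\<^bsub>M\<^esub>) \<Longrightarrow> r = \<zero>"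
    and v: "\<And>j. i < j \<Longrightarrow> lc_zero X j (regular_module R)" and vM: "lc_zero X i M" and i: "0 < i"
  shows "lc_zero X i (regular_module R)"
proof (rule ccontr)
  assume neg: "\<not> lc_zero X i (regular_module R)"
  have v': "\<And>j. Suc i \<le> j \<Longrightarrow> lc_zero X j (regular_module R)" using v by simp
  let ?R = "regular_module R"
  let ?q = "\<lambda>I. quotient_module ?R I"
  have q: "ses (ideal_module I) ?R (?q I) (\<lambda>x. x) (\<lambda>r. I +>\<^bsub>?R\<^esub> r)" if "ideal I R" for I
    using quotient_ses[OF regular_module ideal_submodule[OF that]] by (simp add: ideal_module_def)
  have zero: "lc_zero X i (ideal_module {\<zero>})"
    using lc_zero_zero_module[OF X(2) ideal_module[OF zeroideal], of "i - 1"] i by simp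
  define F where "F = {I. ideal I R \<and> \<not> lc_zero X i (?q I)}"
  have "{\<zero>} \<in> F" using les_B[OF X(2) q[OF zeroideal] zero] neg zeroideal by (auto simp: F_def)
  then have "\<exists>I\<in>F. \<forall>J\<in>F. I \<subseteq> J \<longrightarrow> J = I" by (intro ideal_maximal) (auto simp: F_def)
  then obtain I where IF: "I \<in> F" and mx: "\<forall>J\<in>F. I \<subseteq> J \<longrightarrow> J = I" by (rule bexE)
  have I: "ideal I R" "\<not> lc_zero X i (?q I)" using IF by (simp_all add: F_def)
  have max: "lc_zero X i (?q J)" if "ideal J R" "I \<subseteq> J" "J \<noteq> I" for J
  proof (rule ccontr)
    assume "\<not> lc_zero X i (?q J)"
    then have "J \<in> F" using that by (simp add: F_def)
    then show False using mx that by blast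
  qed
  let ?Q = "?q I" and ?u = "I +>\<^bsub>?R\<^esub> \<one>"
  note s = sesD[OF q[OF I(1)]]
  have uc: "?u \<in> carrier ?Q" using mhom_closed[OF s(5), of \<one>] by simp
  have ru: "r \<odot>\<^bsub>?Q\<^esub> ?u = I +>\<^bsub>?R\<^esub> r" if "r \<in> carrier R" for r using mhom_smult[OF s(5) that, of \<one>] that by simp
  have annu: "r \<odot>\<^bsub>?Q\<^esub> ?u = \<zero>\<^bsub>?Q\<^esub> \<longleftrightarrow> r \<in> I" if "r \<in> carrier R" for r using ru[OF that] s(8)[of r] that by simp
  have Qgen: "\<exists>r\<in>carrier R. y = r \<odot>\<^bsub>?Q\<^esub> ?u" if y: "y \<in> carrier ?Q" for y
  proof -
    have "y \<in> (\<lambda>r. I +>\<^bsub>?R\<^esub> r) ` carrier ?R" using y s(7) by simp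
    then obtain r where "r \<in> carrier R" "y = I +>\<^bsub>?R\<^esub> r" by auto
    then show ?thesis using ru by blast
  qed
  have ann: "lc_zero X i (?q J)" if J: "J = {r \<in> carrier R. P r}" "ideal J R" "\<And>r. r \<in> I \<Longrightarrow> P r" and a: "a \<in> carrier R" "a \<notin> I" "P a" for J P a
    by (rule max[OF J(2)]) (use J a ideal.Icarr[OF I(1)] in auto)
  \<comment> \<open>The quotient of \<open>R/I\<close> by a nonzero submodule \<open>T\<close> is
    \<open>R/J\<close> for a strictly larger ideal \<open>J\<close>, so its cohomology vanishes; if
    that of \<open>T\<close> did too, that of \<open>R/I\<close> would.\<close>
  have notT: "\<not> lc_zero X i (?Q\<lparr>carrier := T\<rparr>)" if T: "submodule T R ?Q" "T \<noteq> {\<zero>\<^bsub>?Q\<^esub>}" for T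
  proof
    assume vT: "lc_zero X i (?Q\<lparr>carrier := T\<rparr>)"
    note t = sesD[OF quotient_ses[OF s(3) T(1)]]
    let ?P = "quotient_module ?Q T" and ?w = "T +>\<^bsub>?Q\<^esub> ?u"
    obtain y where y: "y \<in> T" "y \<noteq> \<zero>\<^bsub>?Q\<^esub>" using T submod_zero[OF s(3) T(1)] by blast
    obtain a where a: "a \<in> carrier R" "y = a \<odot>\<^bsub>?Q\<^esub> ?u" using Qgen[OF submod_carrier[OF s(3) T(1) y(1)]] by blast
    have aI: "a \<notin> I" using annu[OF a(1)] a y by simp
    have wc: "?w \<in> carrier ?P" by (rule mhom_closed[OF t(5) uc])
    have rw: "r \<odot>\<^bsub>?P\<^esub> ?w = \<zero>\<^bsub>?P\<^esub> \<longleftrightarrow> r \<odot>\<^bsub>?Q\<^esub> ?u \<in> T" if "r \<in> carrier R" for r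
      using mhom_smult[OF t(5) that uc] t(8)[of "r \<odot>\<^bsub>?Q\<^esub> ?u"] that uc s(3) by simp
    have "lc_zero X i ?P"
    proof (rule lc_zero_cyclic_quotient[OF X(2) t(3) wc])
      show "carrier ?P = {r \<odot>\<^bsub>?P\<^esub> ?w | r. r \<in> carrier R}"
      proof (rule quotient_cyclic[OF s(3) T(1) uc])
        fix m assume m: "m \<in> carrier ?Q"
        obtain r where "r \<in> carrier R" "m = r \<odot>\<^bsub>?Q\<^esub> ?u" using Qgen[OF m] by blast
        then show "\<exists>n\<in>T. \<exists>r\<in>carrier R. m = n \<oplus>\<^bsub>?Q\<^esub> r \<odot>\<^bsub>?Q\<^esub> ?u"
          using submod_zero[OF s(3) T(1)] m s(3) by (intro bexI[of _ "\<zero>\<^bsub>?Q\<^esub>"] bexI[of _ r]) auto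
      qed
      show "lc_zero X i (?q {r \<in> carrier R. r \<odot>\<^bsub>?P\<^esub> ?w = \<zero>\<^bsub>?P\<^esub>})"
      proof (rule ann[OF refl _ _ a(1) aI])
        show "ideal {r \<in> carrier R. r \<odot>\<^bsub>?P\<^esub> ?w = \<zero>\<^bsub>?P\<^esub>} R"
          using annihilator_ideal[OF t(3) zero_submod[OF t(3)] wc] by simp
        show "r \<odot>\<^bsub>?P\<^esub> ?w = \<zero>\<^bsub>?P\<^esub>" if "r \<in> I" for r
        proof -
          have "r \<odot>\<^bsub>?Q\<^esub> ?u = \<zero>\<^bsub>?Q\<^esub>" using annu[OF ideal.Icarr[OF I(1) that]] that by blast
          then show ?thesis using rw[OF ideal.Icarr[OF I(1) that]] submod_zero[OF s(3) T(1)] by simp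
        qed
        show "a \<odot>\<^bsub>?P\<^esub> ?w = \<zero>\<^bsub>?P\<^esub>" using rw[OF a(1)] a(2) y(1) by simp
      qed
    qed
    then show False using les_B[OF X(2) quotient_ses[OF s(3) T(1)] vT] I(2) by blast
  qed
  have prime: "a \<odot>\<^bsub>?Q\<^esub> ?u = \<zero>\<^bsub>?Q\<^esub> \<or> b \<odot>\<^bsub>?Q\<^esub> ?u = \<zero>\<^bsub>?Q\<^esub>"
    if ab: "a \<in> carrier R" "b \<in> carrier R" "(a \<otimes> b) \<odot>\<^bsub>?Q\<^esub> ?u = \<zero>\<^bsub>?Q\<^esub>" for a b
  proof (rule ccontr)
    assume n: "\<not> ?thesis"
    \<comment> \<open>The submodule generated by the class of \<open>b\<close> is
      \<open>R/J\<close>, where \<open>J\<close> contains \<open>I\<close> and also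
      \<open>a\<close>; its vanishing contradicts \<open>notT\<close>.\<close>
    let ?c = "b \<odot>\<^bsub>?Q\<^esub> ?u"
    have cc: "?c \<in> carrier ?Q" using ab uc s(3) by simp
    have g: "mhom R ?R ?Q (\<lambda>r. r \<odot>\<^bsub>?Q\<^esub> ?c)" by (rule smult_mhom(1)[OF s(3) cc])
    let ?T = "(\<lambda>r. r \<odot>\<^bsub>?Q\<^esub> ?c) ` carrier ?R"
    have T: "submodule ?T R ?Q" by (rule image_submod[OF g regular_module s(3)])
    have cT: "?c \<in> ?T" using cc s(3) by (intro image_eqI[of _ _ \<one>]) auto
    have Tm: "module R (?Q\<lparr>carrier := ?T\<rparr>)" by (rule submod_module[OF s(3) T])
    have "lc_zero X i (?Q\<lparr>carrier := ?T\<rparr>)"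
    proof (rule lc_zero_cyclic_quotient[OF X(2) Tm])
      show "?c \<in> carrier (?Q\<lparr>carrier := ?T\<rparr>)" using cT by simp
      show "carrier (?Q\<lparr>carrier := ?T\<rparr>) = {r \<odot>\<^bsub>?Q\<lparr>carrier := ?T\<rparr>\<^esub> ?c | r. r \<in> carrier R}" by auto
      show "lc_zero X i (?q {r \<in> carrier R. r \<odot>\<^bsub>?Q\<lparr>carrier := ?T\<rparr>\<^esub> ?c = \<zero>\<^bsub>?Q\<lparr>carrier := ?T\<rparr>\<^esub>})"
      proof (rule ann[OF refl _ _ ab(1)])
        show "ideal {r \<in> carrier R. r \<odot>\<^bsub>?Q\<lparr>carrier := ?T\<rparr>\<^esub> ?c = \<zero>\<^bsub>?Q\<lparr>carrier := ?T\<rparr>\<^esub>} R"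
          using annihilator_ideal[OF s(3) zero_submod[OF s(3)] cc] by simp
        show "a \<notin> I" using n annu[OF ab(1)] by blast
        show "a \<odot>\<^bsub>?Q\<lparr>carrier := ?T\<rparr>\<^esub> ?c = \<zero>\<^bsub>?Q\<lparr>carrier := ?T\<rparr>\<^esub>"
          using ab uc s(3) by (simp add: mod_smult_assoc)
        fix r assume r: "r \<in> I"
        have rc: "r \<in> carrier R" by (rule ideal.Icarr[OF I(1) r])
        have "r \<odot>\<^bsub>?Q\<^esub> ?c = b \<odot>\<^bsub>?Q\<^esub> (r \<odot>\<^bsub>?Q\<^esub> ?u)" using rc ab uc s(3) by (simp add: m_comm flip: mod_smult_assoc)
        then show "r \<odot>\<^bsub>?Q\<lparr>carrier := ?T\<rparr>\<^esub> ?c = \<zero>\<^bsub>?Q\<lparr>carrier := ?T\<rparr>\<^esub>" using iffD2[OF annu[OF rc] r] ab s(3) by simp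
      qed
    qed
    moreover have "?T \<noteq> {\<zero>\<^bsub>?Q\<^esub>}" using cT n by blast
    ultimately show False using notT[OF T] by blast
  qed
  have u0: "?u \<noteq> \<zero>\<^bsub>?Q\<^esub>"
  proof
    assume u0: "?u = \<zero>\<^bsub>?Q\<^esub>"
    have "y = \<zero>\<^bsub>?Q\<^esub>" if "y \<in> carrier ?Q" for y using Qgen[OF that] u0 s(3) by auto
    then have "carrier ?Q = {\<zero>\<^bsub>?Q\<^esub>}" using mod_zero_closed[OF s(3)] by blast
    then show False using lc_zero_zero_module[OF X(2) s(3), of "i - 1"] i I(2) by simp
  qed
  obtain \<phi> m where \<phi>: "mhom R M ?Q \<phi>" "m \<in> carrier M" "\<phi> m \<noteq> \<zero>\<^bsub>?Q\<^esub>"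
    using nonzero_hom[OF M S faithful s(3) uc u0 prime] by blast
  let ?T = "\<phi> ` carrier M"
  have T: "submodule ?T R ?Q" by (rule image_submod[OF \<phi>(1) M s(3)])
  have Tm: "module R (?Q\<lparr>carrier := ?T\<rparr>)" by (rule submod_module[OF s(3) T])
  have \<phi>': "mhom R M (?Q\<lparr>carrier := ?T\<rparr>) \<phi>" by (rule mhom_corestrict[OF \<phi>(1)]) simp
  have "ses (M\<lparr>carrier := {x \<in> carrier M. \<phi> x = \<zero>\<^bsub>?Q\<lparr>carrier := ?T\<rparr>\<^esub>}\<rparr>) M (?Q\<lparr>carrier := ?T\<rparr>) (\<lambda>x. x) \<phi>"
    by (rule ses_kernel[OF M Tm \<phi>']) simp
  \<comment> \<open>In degree \<open>i + 1\<close> the cohomology of every finitely generated module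
    vanishes, in particular that of the kernel of \<open>\<phi>\<close>; so vanishing in degree
    \<open>i\<close> passes from \<open>M\<close> to its image.\<close>
  moreover have "lc_zero X (Suc i) (M\<lparr>carrier := {x \<in> carrier M. \<phi> x = \<zero>\<^bsub>?Q\<lparr>carrier := ?T\<rparr>\<^esub>}\<rparr>)"
    using lc_zero_fg_submodule[OF X v' M S(1,2) kernel_submod[OF \<phi>' M Tm]] S(3) by auto
  ultimately have "lc_zero X i (?Q\<lparr>carrier := ?T\<rparr>)" by (rule les_C[OF X(2) _ vM])
  moreover have "?T \<noteq> {\<zero>\<^bsub>?Q\<^esub>}" using \<phi>(2,3) by blast
  ultimately show False using notT[OF T] by blast
qed

section \<open>Acyclicity of Hom and the grade\<close>

text \<open>Hom from \<open>R\<close> into \<open>E\<close> is a copy of \<open>E\<close> and hence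
  acyclic. The sequence for \<open>C = R/?K\<close> thus shifts degree \<open>j + 1\<close> of
  Hom(C, E) to degree \<open>j\<close> of Hom(?K, E); only degree one needs a separate
  argument.\<close>

lemma lc_zero_Hom_cyclic:
  fixes E :: "('a, 'c) module"
  assumes X: "finite X" "X \<subseteq> carrier R" and C: "module R C" and x: "x \<in> carrier C"
    and gen: "carrier C = {r \<odot>\<^bsub>C\<^esub> x | r. r \<in> carrier R}" and E: "baer E"
    and prev: "\<And>I. 0 < j \<Longrightarrow> ideal I R \<Longrightarrow> lc_zero X j (Hom_module R (ideal_module I) E)"
  shows "lc_zero X (Suc j) (Hom_module R C E)"
proof -
  note Em = baer_module[OF E]
  let ?R = "regular_module R"
  let ?g = "\<lambda>r. r \<odot>\<^bsub>C\<^esub> x" and ?K = "{r \<in> carrier ?R. r \<odot>\<^bsub>C\<^esub> x = \<zero>\<^bsub>C\<^esub>}"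
  have g: "mhom R ?R C ?g" by (rule smult_mhom(1)[OF C x])
  have K: "ideal ?K R" by (rule submodule_ideal[OF kernel_submod[OF g regular_module C]])
  have "?g ` carrier ?R = carrier C" using gen by auto
  from ses_kernel[OF regular_module C g this]
  have s: "ses (ideal_module ?K) ?R C (\<lambda>x. x) ?g" by (simp only: ideal_module_def)
  note hs = Hom_ses[OF s E]
  have HR: "lc_zero X (Suc k) (Hom_module R ?R E)" for k by (rule lc_zero_baer[OF X(2) Hom_regular_baer[OF E]])
  show ?thesis
  proof (cases j)
    case 0
    \<comment> \<open>A torsion homomorphism on \<open>?K\<close> takes values in the torsion of
      \<open>E\<close>. That submodule is injective, so the map is multiplication by a torsion
      element \<open>e\<close> and extends to a torsion map on \<open>R\<close>.\<close>
    have "c \<in> (\<lambda>\<phi>. \<lambda>x\<in>carrier (ideal_module ?K). \<phi> x) ` torsion X (Hom_module R ?R E)"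
      if c: "c \<in> torsion X (Hom_module R (ideal_module ?K) E)" for c
    proof -
      have cm: "c \<in> mod_hom R (ideal_module ?K) E" using torsion_carrier[OF c] by simp
      have cT: "mhom R (ideal_module ?K) (E\<lparr>carrier := torsion X E\<rparr>) c"
        by (rule mhom_corestrict[OF mod_hom_mhom[OF cm] torsion_Hom_pointwise[OF X(2) ideal_module[OF K] Em c]])
      obtain e where e: "e \<in> torsion X E" "\<And>r. r \<in> ?K \<Longrightarrow> c r = r \<odot>\<^bsub>E\<^esub> e"
        using baerD[OF torsion_baer[OF X E] K cT] by auto
      let ?p = "\<lambda>r\<in>carrier R. r \<odot>\<^bsub>E\<^esub> e"
      have p: "?p \<in> torsion X (Hom_module R ?R E)"
        using torsion_mhom[OF X(2) Hom_regular(1)[OF Em] Em Hom_is_module[OF regular_module Em] e(1)] .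
      have "c = (\<lambda>x\<in>carrier (ideal_module ?K). ?p x)"
        using mod_hom_arb[OF cm] e(2) by (auto simp: fun_eq_iff restrict_def)
      then show ?thesis using p by (rule image_eqI)
    qed
    then show ?thesis unfolding 0 by (rule les_A1[OF X(2) hs HR])
  next
    case (Suc k)
    have "lc_zero X (Suc k) (Hom_module R (ideal_module ?K) E)" using prev[OF _ K] Suc by simp
    then show ?thesis unfolding Suc by (rule les_A[OF X(2) hs _ HR])
  qed
qed

text \<open>Adjoining a generator gives a short exact sequence with cyclic quotient; Hom into
  \<open>E\<close> reverses it and keeps it exact.\<close>

lemma lc_zero_Hom_span:
  fixes E :: "('a, 'c) module" and M :: "('a, 'y, 'm) module_scheme"
  assumes X: "finite X" "X \<subseteq> carrier R" and M: "module R M" and S: "finite S" "S \<subseteq> carrier M" and E: "baer E"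
    and prev: "\<And>I. 0 < j \<Longrightarrow> ideal I R \<Longrightarrow> lc_zero X j (Hom_module R (ideal_module I) E)"
  shows "lc_zero X (Suc j) (Hom_module R (M\<lparr>carrier := span M S\<rparr>) E)"
proof (rule span_induct[OF M S])
  note Em = baer_module[OF E]
  let ?Z = "M\<lparr>carrier := {\<zero>\<^bsub>M\<^esub>}\<rparr>"
  have Z: "module R ?Z" by (rule submod_module[OF M zero_submod[OF M]])
  show "lc_zero X (Suc j) (Hom_module R ?Z E)"
  proof (rule lc_zero_zero_module[OF X(2) Hom_is_module[OF Z Em]])
    have all0: "\<phi> = \<zero>\<^bsub>Hom_module R ?Z E\<^esub>" if ph: "\<phi> \<in> mod_hom R ?Z E" for \<phi>
      using mhom_zero[OF mod_hom_mhom[OF ph] Z Em] mod_hom_arb[OF ph] by (auto simp: fun_eq_iff restrict_def)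
    show "carrier (Hom_module R ?Z E) = {\<zero>\<^bsub>Hom_module R ?Z E\<^esub>}"
    proof
      show "carrier (Hom_module R ?Z E) \<subseteq> {\<zero>\<^bsub>Hom_module R ?Z E\<^esub>}"
        unfolding Hom_simps(1) by (intro subsetI all0[THEN singleton_iff[THEN iffD2]])
      show "{\<zero>\<^bsub>Hom_module R ?Z E\<^esub>} \<subseteq> carrier (Hom_module R ?Z E)"
        using mod_zero_closed[OF Hom_is_module[OF Z Em]] by (simp only: insert_subset empty_subsetI simp_thms)
    qed
  qed
  fix N x assume N: "submodule N R M" and P: "lc_zero X (Suc j) (Hom_module R (M\<lparr>carrier := N\<rparr>) E)" and x: "x \<in> carrier M"
  let ?A = "{n \<oplus>\<^bsub>M\<^esub> r \<odot>\<^bsub>M\<^esub> x | n r. n \<in> N \<and> r \<in> carrier R}"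
  let ?B = "M\<lparr>carrier := ?A\<rparr>"
  note A = adjoin_submod[OF M N x]
  have B: "module R ?B" by (rule submod_module[OF M A(1)])
  have NB: "submodule N R ?B"
    by (rule submodI[OF B]) (use A(2) submod_rules[OF M N] in auto)
  note s = quotient_ses[OF B NB]
  have xB: "x \<in> carrier ?B" using A(3) by simp
  have gen: "carrier (quotient_module ?B N) = {r \<odot>\<^bsub>quotient_module ?B N\<^esub> (N +>\<^bsub>?B\<^esub> x) | r. r \<in> carrier R}"
    by (rule quotient_cyclic[OF B NB xB]) auto
  have "lc_zero X (Suc j) (Hom_module R (quotient_module ?B N) E)"
    by (rule lc_zero_Hom_cyclic[OF X sesD(3)[OF s] mhom_closed[OF sesD(5)[OF s] xB] gen E prev])
  then show "lc_zero X (Suc j) (Hom_module R ?B E)" using les_B[OF X(2) Hom_ses[OF s E]] P by simp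
qed

text \<open>An ideal is built from cyclic modules, whose Hom modules in degree \<open>j + 1\<close>
  are governed by ideals in degree \<open>j\<close>. In degree one nothing earlier is
  needed.\<close>

lemma lc_zero_Hom_ideal:
  fixes E :: "('a, 'c) module"
  assumes X: "finite X" "X \<subseteq> carrier R" and E: "baer E" and I: "ideal I R"
  shows "lc_zero X (Suc j) (Hom_module R (ideal_module I) E)"
  using I
proof (induction j arbitrary: I)
  case 0
  obtain A where A: "A \<subseteq> carrier R" "finite A" "I = Idl A" using finetely_gen[OF 0] by blast
  have "lc_zero X (Suc 0) (Hom_module R ((regular_module R)\<lparr>carrier := span (regular_module R) A\<rparr>) E)"
    by (rule lc_zero_Hom_span[OF X regular_module A(2) _ E]) (use A in auto)
  then show ?case using span_regular_eq_genideal[OF A(1)] A(3) by (simp add: ideal_module_def)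
next
  case (Suc j)
  obtain A where A: "A \<subseteq> carrier R" "finite A" "I = Idl A" using finetely_gen[OF Suc.prems] by blast
  have "lc_zero X (Suc (Suc j)) (Hom_module R ((regular_module R)\<lparr>carrier := span (regular_module R) A\<rparr>) E)"
    by (rule lc_zero_Hom_span[OF X regular_module A(2) _ E Suc.IH]) (use A in auto)
  then show ?case using span_regular_eq_genideal[OF A(1)] A(3) by (simp add: ideal_module_def)
qed

lemma lc_zero_Hom:
  fixes E :: "('a, 'c) module"
  assumes X: "finite X" "X \<subseteq> carrier R" and M: "module R M" and S: "finite S" "S \<subseteq> carrier M" "span M S = carrier M" and E: "baer E"
  shows "lc_zero X (Suc j) (Hom_module R M E)"
proof -
  have "lc_zero X j (Hom_module R (ideal_module I) E)" if "0 < j" "ideal I R" for I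
    using lc_zero_Hom_ideal[OF X E that(2), of "j - 1"] that(1) by simp
  from lc_zero_Hom_span[OF X M S(1,2) E this] S(3) show ?thesis by simp
qed

section \<open>The lowest nonvanishing degree\<close>

text \<open>This finds an associated prime. Among the annihilators of nonzero elements take a
  maximal one, that of \<open>z\<close>: the annihilator of \<open>b z\<close> contains it, so the
  two agree if \<open>b z\<close> is nonzero.\<close>

lemma exists_prime_annihilator:
  assumes H: "module R H" and h: "h \<in> carrier H" "h \<noteq> \<zero>\<^bsub>H\<^esub>"
  obtains z where "z \<in> carrier H" "z \<noteq> \<zero>\<^bsub>H\<^esub>"
    "\<And>a b. a \<in> carrier R \<Longrightarrow> b \<in> carrier R \<Longrightarrow> (a \<otimes> b) \<odot>\<^bsub>H\<^esub> z = \<zero>\<^bsub>H\<^esub> \<Longrightarrow> a \<odot>\<^bsub>H\<^esub> z = \<zero>\<^bsub>H\<^esub> \<or> b \<odot>\<^bsub>H\<^esub> z = \<zero>\<^bsub>H\<^esub>"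
proof -
  define ann where "ann z = {r \<in> carrier R. r \<odot>\<^bsub>H\<^esub> z = \<zero>\<^bsub>H\<^esub>}" for z
  let ?F = "ann ` {z \<in> carrier H. z \<noteq> \<zero>\<^bsub>H\<^esub>}"
  have "\<exists>I\<in>?F. \<forall>J\<in>?F. I \<subseteq> J \<longrightarrow> J = I"
  proof (rule ideal_maximal)
    show "?F \<noteq> {}" using h by blast
    show "ideal I R" if "I \<in> ?F" for I using that annihilator_ideal[OF H zero_submod[OF H]] by (auto simp: ann_def)
  qed
  then obtain z where z: "z \<in> carrier H" "z \<noteq> \<zero>\<^bsub>H\<^esub>" and max: "\<And>w. w \<in> carrier H \<Longrightarrow> w \<noteq> \<zero>\<^bsub>H\<^esub> \<Longrightarrow> ann z \<subseteq> ann w \<Longrightarrow> ann w = ann z"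
    by blast
  show ?thesis
  proof (rule that[OF z])
    fix a b assume ab: "a \<in> carrier R" "b \<in> carrier R" "(a \<otimes> b) \<odot>\<^bsub>H\<^esub> z = \<zero>\<^bsub>H\<^esub>"
    show "a \<odot>\<^bsub>H\<^esub> z = \<zero>\<^bsub>H\<^esub> \<or> b \<odot>\<^bsub>H\<^esub> z = \<zero>\<^bsub>H\<^esub>"
    proof (cases "b \<odot>\<^bsub>H\<^esub> z = \<zero>\<^bsub>H\<^esub>")
      case False
      have "r \<odot>\<^bsub>H\<^esub> (b \<odot>\<^bsub>H\<^esub> z) = b \<odot>\<^bsub>H\<^esub> (r \<odot>\<^bsub>H\<^esub> z)" if "r \<in> carrier R" for r
        using that ab z H by (simp add: m_comm flip: mod_smult_assoc)
      then have "ann z \<subseteq> ann (b \<odot>\<^bsub>H\<^esub> z)" using ab H by (auto simp: ann_def)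
      then have eq: "ann (b \<odot>\<^bsub>H\<^esub> z) = ann z" using False ab z H by (intro max) auto
      have "a \<in> ann (b \<odot>\<^bsub>H\<^esub> z)" using ab z H by (simp add: ann_def mod_smult_assoc)
      then show ?thesis unfolding eq by (simp add: ann_def)
    qed simp
  qed
qed

text \<open>Below \<open>g\<close> cocycles and coboundaries of the torsion complex are injective,
  so every differential there has a section on its image. In degree \<open>g\<close> the
  coboundaries are still injective and split off the cocycles; the cohomology is thereby realized as
  a submodule \<open>H\<close> of \<open>E g\<close>.\<close>

lemma torsion_exact_Hom:
  fixes E :: "nat \<Rightarrow> ('a, 'c) module"
  assumes X: "finite X" "X \<subseteq> carrier R" and M: "module R M" and S: "finite S" "S \<subseteq> carrier M" "span M S = carrier M"
    and faithful: "\<And>r. r \<in> carrier R \<Longrightarrow> (\<And>m. m \<in> carrier M \<Longrightarrow> r \<odot>\<^bsub>M\<^esub> m = \<zero>\<^bsub>M\<^esub>) \<Longrightarrow> r = \<zero>"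
    and E: "\<And>i. baer (E i)" and d: "\<And>i. mhom R (E i) (E (Suc i)) (d i)"
    and dd: "\<And>i z. z \<in> carrier (E i) \<Longrightarrow> d (Suc i) (d i z) = \<zero>\<^bsub>E (Suc (Suc i))\<^esub>"
    and t: "\<And>i. i < g \<Longrightarrow> torsion_exact X E d i"
  shows torsion_exact_Hom_below: "i < g \<Longrightarrow> torsion_exact X (\<lambda>i. Hom_module R M (E i)) (\<lambda>i \<phi>. \<lambda>x\<in>carrier M. d i (\<phi> x)) i"
    and torsion_exact_Hom_at: "torsion_exact X (\<lambda>i. Hom_module R M (E i)) (\<lambda>i \<phi>. \<lambda>x\<in>carrier M. d i (\<phi> x)) g \<Longrightarrow> torsion_exact X E d g"
proof -
  note Em = baer_module[OF E]
  let ?K = "\<lambda>i. Hom_module R M (E i)" and ?d = "\<lambda>i \<phi>. \<lambda>x\<in>carrier M. d i (\<phi> x)"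
  define C where "C i = (E i)\<lparr>carrier := torsion X (E i)\<rparr>" for i
  have C: "baer (C i)" for i unfolding C_def by (rule torsion_baer[OF X E])
  note Cm = baer_module[OF C]
  have Cc: "carrier (C i) = torsion X (E i)" and Cz: "\<zero>\<^bsub>C i\<^esub> = \<zero>\<^bsub>E i\<^esub>" for i by (simp_all add: C_def)
  have dt: "\<And>i z. z \<in> torsion X (E i) \<Longrightarrow> d i z \<in> torsion X (E (Suc i))" by (rule torsion_mhom[OF X(2) d Em Em])
  have ddt: "\<And>i z. z \<in> torsion X (E i) \<Longrightarrow> d (Suc i) (d i z) = \<zero>\<^bsub>E (Suc (Suc i))\<^esub>" by (rule dd[OF torsion_carrier])
  have dC: "mhom R (C i) (C (Suc i)) (d i)" for i
    unfolding C_def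
    by (rule mhom_corestrict[OF mhom_restrict[OF d]]) (use dt torsion_carrier in auto)
  define Z where "Z i = {z \<in> carrier (C i). d i z = \<zero>\<^bsub>C (Suc i)\<^esub>}" for i
  have Zs: "submodule (Z i) R (C i)" for i unfolding Z_def by (rule kernel_submod[OF dC Cm Cm])
  have ZB: "Z (Suc j) = d j ` carrier (C j)" if "Suc j < g" for j
    using t[OF that] ddt dt unfolding Z_def Cc Cz torsion_exact_def by auto
  have Z0: "Z 0 = {\<zero>\<^bsub>C 0\<^esub>}" if "0 < g"
    using t[OF that] submod_zero[OF Cm Zs, of 0] unfolding torsion_exact_def Z_def Cc Cz by auto
  \<comment> \<open>Below \<open>g\<close> the cocycles in degree \<open>j + 1\<close> are the
    coboundaries, which are injective once the cocycles in degree \<open>j\<close> are; the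
    induction starts with the zero module.\<close>
  have Zb: "baer ((C i)\<lparr>carrier := Z i\<rparr>)" if "i < g" for i
    using that
  proof (induction i)
    case 0
    let ?Z = "(C 0)\<lparr>carrier := {\<zero>\<^bsub>C 0\<^esub>}\<rparr>"
    have "baer ?Z"
      by (rule baer_retract[where p="\<lambda>_. \<zero>\<^bsub>C 0\<^esub>", OF C submod_module[OF Cm zero_submod[OF Cm]] mhom_incl])
        (use Cm[of 0] in \<open>auto simp: mhom_def\<close>)
    then show ?case using Z0 0 by simp
  next
    case (Suc j)
    then have "baer ((C (Suc j))\<lparr>carrier := d j ` carrier (C j)\<rparr>)"
      by (intro split_step(2)[OF C Cm dC]) (simp flip: Z_def)
    then show ?case using ZB[OF Suc.prems] by simp
  qed
  have sec: "\<exists>s. mhom R ((C (Suc j))\<lparr>carrier := d j ` carrier (C j)\<rparr>) (C j) s \<and> (\<forall>b\<in>d j ` carrier (C j). d j (s b) = b)"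
    and Bb: "baer ((C (Suc j))\<lparr>carrier := d j ` carrier (C j)\<rparr>)" if "j < g" for j
    using split_step[OF C Cm dC, of j] Zb[OF that] by (simp_all flip: Z_def)
  have pt: "\<phi> m \<in> torsion X (E i)" if "\<phi> \<in> torsion X (?K i)" "m \<in> carrier M" for \<phi> m i
    by (rule torsion_Hom_pointwise[OF X(2) M Em that])
  show "torsion_exact X ?K ?d i" if i: "i < g"
    unfolding torsion_exact_def
  proof (intro ballI impI)
    fix \<phi> assume ph: "\<phi> \<in> torsion X (?K i)" and d0: "?d i \<phi> = \<zero>\<^bsub>?K (Suc i)\<^esub>"
    have phm: "\<phi> \<in> mod_hom R M (E i)" using torsion_carrier[OF ph] by simp
    have dphi: "d i (\<phi> m) = \<zero>\<^bsub>E (Suc i)\<^esub>" if "m \<in> carrier M" for m using fun_cong[OF d0, of m] that by simp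
    have phZ: "\<phi> m \<in> Z i" if "m \<in> carrier M" for m using pt[OF ph that] dphi[OF that] by (simp add: Z_def Cc Cz)
    show "case i of 0 \<Rightarrow> \<phi> = \<zero>\<^bsub>?K 0\<^esub> | Suc j \<Rightarrow> \<phi> \<in> ?d j ` torsion X (?K j)"
    proof (cases i)
      case 0
      have "\<phi> m = \<zero>\<^bsub>E 0\<^esub>" if "m \<in> carrier M" for m using phZ[OF that] Z0 i 0 by (simp add: Cz)
      then have "\<phi> = \<zero>\<^bsub>?K 0\<^esub>" using mod_hom_arb[OF phm] by (auto simp: fun_eq_iff restrict_def)
      then show ?thesis using 0 by simp
    next
      case (Suc j)
      then have j: "j < g" using i by simp
      let ?B = "(C (Suc j))\<lparr>carrier := d j ` carrier (C j)\<rparr>"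
      obtain s where s: "mhom R ?B (C j) s" "\<And>b. b \<in> d j ` carrier (C j) \<Longrightarrow> d j (s b) = b" using sec[OF j] by blast
      have phB: "\<phi> m \<in> d j ` carrier (C j)" if "m \<in> carrier M" for m using phZ[OF that] ZB i Suc by simp
      have "mhom R M (C (Suc j)) \<phi>"
        unfolding C_def by (rule mhom_corestrict) (use mod_hom_mhom[OF phm] pt[OF ph] Suc in auto)
      then have "mhom R M ?B \<phi>" by (rule mhom_corestrict) (rule phB)
      then have sph: "mhom R M (C j) (\<lambda>m. s (\<phi> m))" by (rule mhom_compose[OF _ s(1)])
      \<comment> \<open>Composing \<open>\<phi>\<close> with the section of \<open>d j\<close> gives
        its primitive.\<close>
      let ?p = "\<lambda>m\<in>carrier M. s (\<phi> m)"
      have pm: "?p \<in> mod_hom R M (E j)"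
        by (rule mhom_restrict_mod_hom[OF mhom_codomain_mono[OF sph[unfolded C_def]] M]) (use torsion_carrier in auto)
      have "?p \<in> torsion X (?K j)"
        by (rule torsion_HomI[OF X(2) M S Em pm]) (use mhom_closed[OF sph] Cc in simp)
      moreover have "\<phi> = ?d j ?p"
        using mod_hom_arb[OF phm] s(2)[OF phB] by (auto simp: fun_eq_iff restrict_def)
      ultimately show ?thesis unfolding Suc nat.case by (intro image_eqI)
    qed
  qed
  show "torsion_exact X E d g" if tK: "torsion_exact X ?K ?d g"
  proof (rule ccontr)
    assume neg: "\<not> torsion_exact X E d g"
    note Zm = submod_module[OF Cm Zs]
    \<comment> \<open>A map from \<open>M\<close> into cocycles is a torsion cocycle of the Hom
      complex, hence a coboundary by \<open>tK\<close>, so its values are coboundaries. It vanishes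
      if \<open>H\<close> meets the coboundaries only in zero.\<close>
    have hom0: "\<phi> m = \<zero>\<^bsub>E g\<^esub>"
      if H: "submodule H R ((C g)\<lparr>carrier := Z g\<rparr>)" and ph: "mhom R M ((C g)\<lparr>carrier := H\<rparr>) \<phi>" and m: "m \<in> carrier M"
        and int: "\<And>j z. g = Suc j \<Longrightarrow> z \<in> H \<Longrightarrow> z \<in> d j ` carrier (C j) \<Longrightarrow> z = \<zero>\<^bsub>E g\<^esub>" for H \<phi> m
    proof -
      have HZ: "H \<subseteq> Z g" using submod_subset[OF Zm H] by simp
      have phH: "\<phi> m \<in> H" if "m \<in> carrier M" for m using mhom_closed[OF ph that] by simp
      have phT: "\<phi> m \<in> torsion X (E g)" "d g (\<phi> m) = \<zero>\<^bsub>E (Suc g)\<^esub>" if "m \<in> carrier M" for m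
        using phH[OF that] HZ by (auto simp: Z_def Cc Cz)
      have "mhom R M (C g) \<phi>" by (rule mhom_codomain_mono[OF ph]) (use HZ in \<open>auto simp: Z_def\<close>)
      then have phE: "mhom R M (E g) \<phi>" unfolding C_def by (rule mhom_codomain_mono) (use torsion_carrier in auto)
      let ?p = "restrict \<phi> (carrier M)"
      have pT: "?p \<in> torsion X (?K g)"
        by (rule torsion_HomI[OF X(2) M S Em mhom_restrict_mod_hom[OF phE M]]) (use phT in simp)
      have p0: "?d g ?p = \<zero>\<^bsub>?K (Suc g)\<^esub>" using phT by (auto simp: fun_eq_iff restrict_def)
      show ?thesis
      proof (cases g)
        case 0
        then have "?p = \<zero>\<^bsub>?K 0\<^esub>" using torsion_exactD0[of X ?K ?d ?p] tK pT p0 by simp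
        from fun_cong[OF this, of m] show ?thesis using m 0 by simp
      next
        case (Suc j)
        obtain \<psi> where ps: "\<psi> \<in> torsion X (?K j)" "?p = ?d j \<psi>"
          using torsion_exactDS[of X ?K ?d j ?p] tK pT p0 unfolding Suc by blast
        have "\<phi> m = d j (\<psi> m)" using fun_cong[OF ps(2), of m] m by simp
        then have "\<phi> m \<in> d j ` carrier (C j)" using pt[OF ps(1) m] by (simp add: Cc)
        then show ?thesis using int[OF Suc phH[OF m]] by blast
      qed
    qed
    \<comment> \<open>\<open>H\<close> is a complement of the coboundaries in the cocycles
      \<open>Z g\<close>; in degree zero it is all of \<open>Z g\<close>.\<close>
    have "\<exists>H. submodule H R ((C g)\<lparr>carrier := Z g\<rparr>) \<and> (\<exists>h\<in>H. h \<noteq> \<zero>\<^bsub>E g\<^esub>) \<and>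
        (\<forall>j z. g = Suc j \<longrightarrow> z \<in> H \<longrightarrow> z \<in> d j ` carrier (C j) \<longrightarrow> z = \<zero>\<^bsub>E g\<^esub>)"
    proof (cases g)
      case 0
      have "\<exists>h\<in>Z g. h \<noteq> \<zero>\<^bsub>E g\<^esub>" using neg unfolding torsion_exact_def Z_def Cc Cz 0 by auto
      then show ?thesis using carrier_submod[OF Zm[of g]] 0 by (intro exI[of _ "Z g"]) auto
    next
      case (Suc j)
      then have j: "j < g" by simp
      let ?B = "d j ` carrier (C j)" and ?ZM = "(C g)\<lparr>carrier := Z g\<rparr>"
      obtain z where z: "z \<in> Z g" "z \<notin> ?B" using neg unfolding torsion_exact_def Z_def Cc Cz Suc by auto
      have BZ: "?B \<subseteq> Z g" using ddt dt unfolding Z_def Cc Cz Suc by auto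
      have Bs: "submodule ?B R (C g)" using image_submod[OF dC Cm Cm, of j] Suc by simp
      have BsZ: "submodule ?B R ?ZM" by (rule submodI[OF Zm]) (use BZ submod_rules[OF Cm Bs] in auto)
      have Bbaer: "baer ((C g)\<lparr>carrier := ?B\<rparr>)" using Bb[OF j] Suc by simp
      \<comment> \<open>The coboundaries are injective, so the identity on them extends to a
        retraction of the cocycles. Its kernel is the complement, which contains the nonzero element
        \<open>z - \<rho> z\<close>.\<close>
      have "mhom R (?ZM\<lparr>carrier := ?B\<rparr>) ((C g)\<lparr>carrier := ?B\<rparr>) (\<lambda>x. x)" by (simp add: mhom_def)
      from baer_extend[OF Bbaer Zm BsZ this]
      obtain \<rho> where \<rho>: "mhom R ?ZM ((C g)\<lparr>carrier := ?B\<rparr>) \<rho>" "\<And>x. x \<in> ?B \<Longrightarrow> \<rho> x = x" by blast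
      have \<rho>Z: "mhom R ?ZM ?ZM \<rho>" using \<rho>(1) BZ by (auto simp: mhom_def)
      let ?H = "{z \<in> carrier ?ZM. \<rho> z = \<zero>\<^bsub>?ZM\<^esub>}"
      have H: "submodule ?H R ?ZM" by (rule kernel_submod[OF \<rho>Z Zm Zm])
      have zc: "z \<in> carrier ?ZM" using z by simp
      have \<rho>z: "\<rho> z \<in> ?B" using mhom_closed[OF \<rho>(1) zc] by simp
      have \<rho>zc: "\<rho> z \<in> carrier ?ZM" using \<rho>z BZ by auto
      let ?h = "z \<ominus>\<^bsub>?ZM\<^esub> \<rho> z"
      have hc: "?h \<in> carrier ?ZM" by (rule mod_minus_closed[OF Zm zc \<rho>zc])
      have "\<rho> ?h = \<rho> z \<ominus>\<^bsub>?ZM\<^esub> \<rho> (\<rho> z)" by (rule mhom_minus[OF \<rho>Z Zm Zm zc \<rho>zc])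
      also have "\<dots> = \<zero>\<^bsub>?ZM\<^esub>" using \<rho>(2)[OF \<rho>z] mod_minus_self[OF Zm \<rho>zc] by simp
      finally have hH: "?h \<in> ?H" using hc by simp
      have h0: "?h \<noteq> \<zero>\<^bsub>?ZM\<^esub>" using mod_minus_eq_zero[OF Zm zc \<rho>zc] z \<rho>z by auto
      have "w = \<zero>\<^bsub>E g\<^esub>" if "w \<in> ?H" "w \<in> ?B" for w using that \<rho>(2)[of w] by (simp add: Cz)
      then show ?thesis using H hH h0 Suc by (intro exI[of _ ?H]) (auto simp: Cz)
    qed
    then obtain H h where H: "submodule H R ((C g)\<lparr>carrier := Z g\<rparr>)" and h: "h \<in> H" "h \<noteq> \<zero>\<^bsub>E g\<^esub>"
      and int: "\<And>j z. g = Suc j \<Longrightarrow> z \<in> H \<Longrightarrow> z \<in> d j ` carrier (C j) \<Longrightarrow> z = \<zero>\<^bsub>E g\<^esub>" by blast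
    let ?H = "(C g)\<lparr>carrier := H\<rparr>"
    have Hm: "module R ?H" using submod_module[OF Zm H] by simp
    obtain z where z: "z \<in> carrier ?H" "z \<noteq> \<zero>\<^bsub>?H\<^esub>"
      "\<And>a b. a \<in> carrier R \<Longrightarrow> b \<in> carrier R \<Longrightarrow> (a \<otimes> b) \<odot>\<^bsub>?H\<^esub> z = \<zero>\<^bsub>?H\<^esub> \<Longrightarrow> a \<odot>\<^bsub>?H\<^esub> z = \<zero>\<^bsub>?H\<^esub> \<or> b \<odot>\<^bsub>?H\<^esub> z = \<zero>\<^bsub>?H\<^esub>"
      using exists_prime_annihilator[OF Hm, of h] h by (auto simp: Cz)
    obtain \<phi> m where ph: "mhom R M ?H \<phi>" "m \<in> carrier M" "\<phi> m \<noteq> \<zero>\<^bsub>?H\<^esub>"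
      using nonzero_hom[OF M S faithful Hm z] by blast
    have "\<phi> m = \<zero>\<^bsub>E g\<^esub>" by (rule hom0[OF H ph(1,2) int])
    then show False using ph(3) by (simp add: Cz)
  qed
qed

section \<open>Semidualizing modules\<close>

text \<open>Noetherian induction takes the place of expanding powers of sums. A maximal
  counterexample \<open>I\<close> misses some generator \<open>x\<close>; with \<open>s\<close> the
  last power of \<open>x\<close> outside \<open>I\<close>, the ideals \<open>I + R s\<close> and
  \<open>(I : s)\<close> are strictly larger and have their product inside \<open>I\<close>.\<close>

lemma ideal_power_subset:
  assumes X: "X \<subseteq> carrier R" and J: "ideal J R" and pow: "\<And>x. x \<in> X \<Longrightarrow> \<exists>k::nat. x [^] k \<in> J"
  shows "\<exists>n::nat. (Idl X) [^]\<^bsub>ideals_set R\<^esub> n \<subseteq> J"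
proof (rule ccontr)
  assume neg: "\<not> ?thesis"
  let ?a = "Idl X"
  interpret P: comm_monoid "ideals_set R" by (rule ideals_set_is_comm_monoid)
  have a: "ideal ?a R" by (rule genideal_ideal[OF X])
  then have ac: "?a \<in> carrier (ideals_set R)" by (simp add: ideals_set_def)
  define F where "F = {J. ideal J R \<and> (\<forall>x\<in>X. \<exists>k::nat. x [^] k \<in> J) \<and> \<not> (\<exists>n::nat. ?a [^]\<^bsub>ideals_set R\<^esub> n \<subseteq> J)}"
  have "F \<noteq> {}" using J pow neg by (auto simp: F_def)
  then have "\<exists>I\<in>F. \<forall>J\<in>F. I \<subseteq> J \<longrightarrow> J = I" by (rule ideal_maximal) (simp add: F_def)
  then obtain I where IF: "I \<in> F" and mx: "\<forall>J\<in>F. I \<subseteq> J \<longrightarrow> J = I" by (rule bexE)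
  have I: "ideal I R" and pI: "\<And>x. x \<in> X \<Longrightarrow> \<exists>k::nat. x [^] k \<in> I" and nI: "\<And>n::nat. \<not> ?a [^]\<^bsub>ideals_set R\<^esub> n \<subseteq> I"
    using IF by (auto simp: F_def)
  have bigger: "\<exists>n::nat. ?a [^]\<^bsub>ideals_set R\<^esub> n \<subseteq> J" if "ideal J R" "I \<subseteq> J" "J \<noteq> I" for J
  proof (rule ccontr)
    assume "\<not> ?thesis"
    then have "J \<in> F" using that(1,2) pI by (fastforce simp: F_def)
    then show False using mx that by blast
  qed
  have "\<not> ?a \<subseteq> I" using nI[of 1] ac by simp
  then obtain x where x: "x \<in> X" "x \<notin> I" using genideal_minimal[OF I, of X] by blast
  have xc: "x \<in> carrier R" using x X by blast
  \<comment> \<open>The least exponent makes \<open>x^(k-1)\<close> an element outside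
    \<open>I\<close> whose multiple by \<open>x\<close> lies in \<open>I\<close>.\<close>
  define k where "k = (LEAST k::nat. x [^] k \<in> I)"
  have k: "x [^] k \<in> I" unfolding k_def by (rule LeastI_ex[OF pI[OF x(1)]])
  have "k \<noteq> 0"
  proof
    assume "k = 0"
    then have "\<one> \<in> I" using k by simp
    then show False using ideal.I_l_closed[OF I, of \<one> x] xc x by simp
  qed
  then obtain l where l: "k = Suc l" by (cases k) auto
  let ?s = "x [^] l"
  have sc: "?s \<in> carrier R" using xc by simp
  have sI: "?s \<notin> I" using not_less_Least[of l "\<lambda>k. x [^] k \<in> I"] l unfolding k_def by auto
  let ?R = "regular_module R"
  have sR: "?s \<in> carrier ?R" using sc by simp
  note Is = ideal_submodule[OF I]
  let ?J1 = "{n \<oplus>\<^bsub>?R\<^esub> r \<odot>\<^bsub>?R\<^esub> ?s | n r. n \<in> I \<and> r \<in> carrier R}"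
  note J1 = adjoin_submod[OF regular_module Is sR]
  let ?J2 = "{r \<in> carrier R. r \<odot>\<^bsub>?R\<^esub> ?s \<in> I}"
  have J2: "ideal ?J2 R" by (rule annihilator_ideal[OF regular_module Is sR])
  obtain n :: nat where n: "?a [^]\<^bsub>ideals_set R\<^esub> n \<subseteq> ?J1"
    using bigger[OF submodule_ideal[OF J1(1)] J1(2)] J1(3) sI by blast
  have "I \<subseteq> ?J2"
  proof
    fix r assume r: "r \<in> I"
    then show "r \<in> ?J2" using ideal.I_r_closed[OF I r sc] ideal.Icarr[OF I r] by simp
  qed
  moreover have "x \<in> ?J2" using k l xc by (simp add: m_comm)
  ultimately obtain m :: nat where m: "?a [^]\<^bsub>ideals_set R\<^esub> m \<subseteq> ?J2" using bigger[OF J2] x(2) by blast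
  have "?a [^]\<^bsub>ideals_set R\<^esub> (n + m) = (?a [^]\<^bsub>ideals_set R\<^esub> n) \<cdot> (?a [^]\<^bsub>ideals_set R\<^esub> m)"
    using P.nat_pow_mult[OF ac, of n m] by (simp add: ideals_set_def)
  moreover have "(?a [^]\<^bsub>ideals_set R\<^esub> n) \<cdot> (?a [^]\<^bsub>ideals_set R\<^esub> m) \<subseteq> I"
  proof
    fix q assume "q \<in> (?a [^]\<^bsub>ideals_set R\<^esub> n) \<cdot> (?a [^]\<^bsub>ideals_set R\<^esub> m)"
    then show "q \<in> I"
    proof (induction q rule: ideal_prod.induct)
      case (prod i j)
      obtain u r where u: "u \<in> I" "r \<in> carrier R" "i = u \<oplus> r \<otimes> ?s" using n prod(1) by auto
      have j: "j \<in> carrier R" "j \<otimes> ?s \<in> I" using m prod(2) by auto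
      have uc: "u \<in> carrier R" by (rule ideal.Icarr[OF I u(1)])
      have "i \<otimes> j = u \<otimes> j \<oplus> r \<otimes> (j \<otimes> ?s)" using u uc j sc by (simp add: l_distr r_distr m_ac)
      moreover have "u \<otimes> j \<in> I" by (rule ideal.I_r_closed[OF I u(1) j(1)])
      moreover have "r \<otimes> (j \<otimes> ?s) \<in> I" by (rule ideal.I_l_closed[OF I j(2) u(2)])
      ultimately show ?case using additive_subgroup.a_closed[OF ideal.axioms(1)[OF I]] by simp
    next
      case (sum p q)
      then show ?case using additive_subgroup.a_closed[OF ideal.axioms(1)[OF I]] by simp
    qed
  qed
  ultimately show False using nI[of "n + m"] by simp
qed

text \<open>The nontrivial inclusion applies \<open>ideal_power_subset\<close> to the annihilator of
  \<open>z\<close>, which contains a power of each generator.\<close>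

lemma torsion_module_eq:
  assumes X: "X \<subseteq> carrier R" and C: "module R C"
  shows "torsion_module R (Idl X) C = C\<lparr>carrier := torsion X C\<rparr>"
proof -
  let ?a = "Idl X"
  interpret P: comm_monoid "ideals_set R" by (rule ideals_set_is_comm_monoid)
  have "(\<exists>n::nat. \<forall>r\<in>?a [^]\<^bsub>ideals_set R\<^esub> n. r \<odot>\<^bsub>C\<^esub> z = \<zero>\<^bsub>C\<^esub>) \<longleftrightarrow> (\<forall>x\<in>X. \<exists>n::nat. (x [^] n) \<odot>\<^bsub>C\<^esub> z = \<zero>\<^bsub>C\<^esub>)"
    if z: "z \<in> carrier C" for z
  proof
    assume "\<exists>n::nat. \<forall>r\<in>?a [^]\<^bsub>ideals_set R\<^esub> n. r \<odot>\<^bsub>C\<^esub> z = \<zero>\<^bsub>C\<^esub>"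
    then obtain n :: nat where n: "\<And>r. r \<in> ?a [^]\<^bsub>ideals_set R\<^esub> n \<Longrightarrow> r \<odot>\<^bsub>C\<^esub> z = \<zero>\<^bsub>C\<^esub>" by blast
    have "x [^] k \<in> ?a [^]\<^bsub>ideals_set R\<^esub> k" if x: "x \<in> X" for x and k :: nat
    proof (induction k)
      case 0 then show ?case by (simp add: ideals_set_def)
    next
      case (Suc k)
      have "x \<in> ?a" using genideal_self[OF X] x by blast
      from ideal_prod.prod[OF Suc this, of R] show ?case by (simp add: ideals_set_def)
    qed
    then show "\<forall>x\<in>X. \<exists>n::nat. (x [^] n) \<odot>\<^bsub>C\<^esub> z = \<zero>\<^bsub>C\<^esub>" using n by blast
  next
    assume t: "\<forall>x\<in>X. \<exists>n::nat. (x [^] n) \<odot>\<^bsub>C\<^esub> z = \<zero>\<^bsub>C\<^esub>"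
    let ?J = "{r \<in> carrier R. r \<odot>\<^bsub>C\<^esub> z \<in> {\<zero>\<^bsub>C\<^esub>}}"
    have "\<exists>k::nat. x [^] k \<in> ?J" if "x \<in> X" for x using t that X by auto
    from ideal_power_subset[OF X annihilator_ideal[OF C zero_submod[OF C] z] this]
    show "\<exists>n::nat. \<forall>r\<in>?a [^]\<^bsub>ideals_set R\<^esub> n. r \<odot>\<^bsub>C\<^esub> z = \<zero>\<^bsub>C\<^esub>" by auto
  qed
  then have "{z \<in> carrier C. \<exists>n::nat. \<forall>r\<in>?a [^]\<^bsub>ideals_set R\<^esub> n. r \<odot>\<^bsub>C\<^esub> z = \<zero>\<^bsub>C\<^esub>} = torsion X C"
    unfolding torsion_def by blast
  then show ?thesis by (simp add: torsion_module_def)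
qed

lemma local_cohomology_zero_iff:
  assumes X: "X \<subseteq> carrier R" and N: "module R N"
  shows "is_zero_module (local_cohomology R (Idl X) i N) \<longleftrightarrow> lc_zero X i N"
proof -
  obtain E d e where ch: "chosen_injective_resolution R N = (E, d)" and r: "baer_resolution N E d e"
    by (rule chosen_baer_resolution[OF N])
  note r' = resolutionD[OF baer_resolutionD(1)[OF r]] and dd = resolution_dd(2)[OF baer_resolutionD(1)[OF r]]
  let ?C = "\<lambda>k. (E k)\<lparr>carrier := torsion X (E k)\<rparr>"
  have Cm: "module R (?C k)" for k by (rule submod_module[OF r'(2) torsion_submod[OF X r'(2)]])
  have dC: "mhom R (?C k) (?C (Suc k)) (d k)" for k
    by (rule mhom_corestrict[OF mhom_restrict[OF r'(3)]])
      (use submod_subset[OF r'(2) torsion_submod[OF X r'(2)]] torsion_mhom[OF X r'(3,2,2)] in auto)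
  have "local_cohomology R (Idl X) i N = cohomology ?C d i"
    unfolding local_cohomology_def ch using torsion_module_eq[OF X r'(2)] by simp
  moreover have "is_zero_module (cohomology ?C d i) \<longleftrightarrow> torsion_exact X E d i"
    using is_zero_cohomology[of ?C d i, OF Cm dC] dd[OF torsion_carrier] by (cases i) (simp_all add: torsion_exact_def)
  ultimately show ?thesis using lc_zero_iff_torsion_exact[OF X r] by simp
qed

section \<open>Comparison of the module with the ring\<close>

text \<open>Equality of cohomological dimensions, phrased without a supremum. From \<open>R\<close>
  to \<open>M\<close> vanishing spreads to finitely generated modules; from \<open>M\<close> to
  \<open>R\<close> it is obtained by descending through the degrees.\<close>

lemma lc_zero_sup_eq:
  assumes X: "finite X" "X \<subseteq> carrier R"
    and M: "module R M" and S: "finite S" "S \<subseteq> carrier M" "span M S = carrier M"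
    and faithful: "\<And>r. r \<in> carrier R \<Longrightarrow> (\<And>m. m \<in> carrier M \<Longrightarrow> r \<odot>\<^bsub>M\<^esub> m = \<zero>\<^bsub>M\<^esub>) \<Longrightarrow> r = \<zero>"
  shows "(\<forall>i>n. lc_zero X i M) \<longleftrightarrow> (\<forall>i>n. lc_zero X i (regular_module R))"
proof
  assume v: "\<forall>i>n. lc_zero X i (regular_module R)"
  have "lc_zero X i (M\<lparr>carrier := span M S\<rparr>)" if "i > n" for i
    by (rule lc_zero_fg[OF X _ M S(1,2), of "Suc n"]) (use v that in auto)
  then show "\<forall>i>n. lc_zero X i M" using S(3) by simp
next
  assume v: "\<forall>i>n. lc_zero X i M"
  \<comment> \<open>\<open>k\<close> bounds the distance from \<open>i\<close> to the degrees beyond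
    the number of generators, where vanishing is automatic.\<close>
  have "lc_zero X i (regular_module R)" if "Suc (card X) \<le> i + k" "n < i" for i k
    using that
  proof (induction k arbitrary: i)
    case 0
    then show ?case by (intro lc_zero_large[OF X regular_module]) simp
  next
    case (Suc k)
    have above: "lc_zero X j (regular_module R)" if "i < j" for j using Suc.IH[of j] Suc.prems that by simp
    have "lc_zero X i M" "0 < i" using v Suc.prems by auto
    then show ?case using lc_zero_regular_from_faithful[OF X M S faithful above] by blast
  qed
  then show "\<forall>i>n. lc_zero X i (regular_module R)" by (meson le_add2)
qed

text \<open>Vanishing of Ext gives exactness in positive degrees, and the homothety isomorphism
  identifies the kernel in degree zero with \<open>R\<close>. The complex uses the chosen resolution
  because the Ext modules are defined by it.\<close>

lemma semidualizing_resolution: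
  assumes sd: "semidualizing R M" and M: "module R M" and r: "baer_resolution M E d e"
    and ch: "chosen_injective_resolution R M = (E, d)"
  shows "resolution (regular_module R) (\<lambda>i. Hom_module R M (E i)) (\<lambda>i \<phi>. \<lambda>x\<in>carrier M. d i (\<phi> x))
      (\<lambda>r. \<lambda>m\<in>carrier M. e (r \<odot>\<^bsub>M\<^esub> m))"
    and "\<And>r. r \<in> carrier R \<Longrightarrow> (\<And>m. m \<in> carrier M \<Longrightarrow> r \<odot>\<^bsub>M\<^esub> m = \<zero>\<^bsub>M\<^esub>) \<Longrightarrow> r = \<zero>"
proof -
  note r' = resolutionD[OF baer_resolutionD(1)[OF r]] and dd = resolution_dd[OF baer_resolutionD(1)[OF r]]
  let ?K = "\<lambda>i. Hom_module R M (E i)" and ?d = "\<lambda>i \<phi>. \<lambda>x\<in>carrier M. d i (\<phi> x)"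
  let ?h = "\<lambda>r\<in>carrier R. \<lambda>s\<in>carrier M. r \<odot>\<^bsub>M\<^esub> s"
  have bij: "bij_betw ?h (carrier R) (mod_hom R M M)" and ext: "\<And>i. 0 < i \<Longrightarrow> is_zero_module (Ext_module R i M M)"
    using sd by (auto simp: semidualizing_def Let_def)
  show faithful: "r = \<zero>" if r: "r \<in> carrier R" and k: "\<And>m. m \<in> carrier M \<Longrightarrow> r \<odot>\<^bsub>M\<^esub> m = \<zero>\<^bsub>M\<^esub>" for r
  proof -
    have "?h r = ?h \<zero>" using r k M by (auto simp: fun_eq_iff restrict_def)
    then show ?thesis using inj_onD[OF bij_betw_imp_inj_on[OF bij], of r \<zero>] r by simp
  qed
  have Km: "module R (?K i)" for i by (rule Hom_is_module[OF M r'(2)])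
  have dh: "mhom R (?K i) (?K (Suc i)) (?d i)" for i by (rule Hom_postcompose[OF r'(3) M])
  have ddK: "?d (Suc i) (?d i \<phi>) = \<zero>\<^bsub>?K (Suc (Suc i))\<^esub>" if "\<phi> \<in> carrier (?K i)" for i \<phi>
    using dd(2) mod_hom_closed[of \<phi> M "E i"] that by (auto simp: fun_eq_iff restrict_def)
  have exact: "?d (Suc i) \<phi> = \<zero>\<^bsub>?K (Suc (Suc i))\<^esub> \<longleftrightarrow> \<phi> \<in> ?d i ` carrier (?K i)" if ph: "\<phi> \<in> carrier (?K (Suc i))" for i \<phi>
  proof
    have "Ext_module R (Suc i) M M = cohomology ?K ?d (Suc i)" by (simp add: Ext_module_def ch)
    then have "is_zero_module (cohomology ?K ?d (Suc i))" using ext[of "Suc i"] by simp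
    from iffD1[OF is_zero_cohomology[of ?K ?d "Suc i", OF Km dh ddK] this]
    have "\<forall>z\<in>carrier (?K (Suc i)). ?d (Suc i) z = \<zero>\<^bsub>?K (Suc (Suc i))\<^esub> \<longrightarrow> z \<in> ?d i ` carrier (?K i)"
      unfolding nat.case .
    then show "?d (Suc i) \<phi> = \<zero>\<^bsub>?K (Suc (Suc i))\<^esub> \<Longrightarrow> \<phi> \<in> ?d i ` carrier (?K i)" using ph by blast
    show "\<phi> \<in> ?d i ` carrier (?K i) \<Longrightarrow> ?d (Suc i) \<phi> = \<zero>\<^bsub>?K (Suc (Suc i))\<^esub>" using ddK by blast
  qed
  let ?e = "\<lambda>r. \<lambda>m\<in>carrier M. e (r \<odot>\<^bsub>M\<^esub> m)"
  have ec: "\<And>m. m \<in> carrier M \<Longrightarrow> e m \<in> carrier (E 0)" by (rule mhom_closed[OF r'(4)])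
  have hm: "mhom R M M (\<lambda>m. r \<odot>\<^bsub>M\<^esub> m)" if "r \<in> carrier R" for r
    by (rule mhom_smult_const[OF that _ M M]) (simp add: mhom_def)
  have eh: "mhom R (regular_module R) (?K 0) ?e"
  proof (rule mhomI)
    fix r assume "r \<in> carrier (regular_module R)"
    then show "?e r \<in> carrier (?K 0)"
      using mhom_restrict_mod_hom[OF mhom_compose[OF hm r'(4)] M] by simp
  qed (use M mhom_add[OF r'(4)] mhom_smult[OF r'(4)] in \<open>auto simp: fun_eq_iff restrict_def mod_l_distr mod_smult_assoc\<close>)
  have ei: "inj_on ?e (carrier (regular_module R))"
  proof (rule mhom_inj_onI[OF eh regular_module Km])
    fix r assume rc: "r \<in> carrier (regular_module R)" and e0: "?e r = \<zero>\<^bsub>?K 0\<^esub>"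
    have "r \<odot>\<^bsub>M\<^esub> m = \<zero>\<^bsub>M\<^esub>" if m: "m \<in> carrier M" for m
    proof -
      have "e (r \<odot>\<^bsub>M\<^esub> m) = \<zero>\<^bsub>E 0\<^esub>" using fun_cong[OF e0, of m] m by simp
      then show ?thesis using mhom_inj_zero[OF r'(4,1,2,5), of "r \<odot>\<^bsub>M\<^esub> m"] rc m M by simp
    qed
    then show "r = \<zero>\<^bsub>regular_module R\<^esub>" using faithful rc by simp
  qed
  have e0: "?d 0 \<phi> = \<zero>\<^bsub>?K (Suc 0)\<^esub> \<longleftrightarrow> \<phi> \<in> ?e ` carrier (regular_module R)" if ph: "\<phi> \<in> carrier (?K 0)" for \<phi>
  proof
    have phm: "\<phi> \<in> mod_hom R M (E 0)" using ph by simp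
    assume d0: "?d 0 \<phi> = \<zero>\<^bsub>?K (Suc 0)\<^esub>"
    \<comment> \<open>A cocycle in degree zero takes values in the image of \<open>e\<close>;
      pulling it back along \<open>e\<close> gives an endomorphism of \<open>M\<close>, which is
      multiplication by a scalar.\<close>
    define \<chi> where "\<chi> m = inv_into (carrier M) e (\<phi> m)" for m
    have im: "\<phi> m \<in> e ` carrier M" if m: "m \<in> carrier M" for m
      using r'(6)[OF mod_hom_closed[OF phm m]] fun_cong[OF d0, of m] m by simp
    have \<chi>: "\<chi> m \<in> carrier M" "e (\<chi> m) = \<phi> m" if "m \<in> carrier M" for m
      using im[OF that] unfolding \<chi>_def by (auto intro: inv_into_into f_inv_into_f)
    have inj: "u = v" if "u \<in> carrier M" "v \<in> carrier M" "e u = e v" for u v using r'(5) that by (auto dest: inj_onD)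
    have "mhom R M M \<chi>"
    proof (rule mhomI)
      fix x y assume "x \<in> carrier M" "y \<in> carrier M"
      then show "\<chi> (x \<oplus>\<^bsub>M\<^esub> y) = \<chi> x \<oplus>\<^bsub>M\<^esub> \<chi> y"
        using M \<chi> mhom_add[OF r'(4)] mhom_add[OF mod_hom_mhom[OF phm]] by (intro inj) simp_all
    next
      fix t x assume "t \<in> carrier R" "x \<in> carrier M"
      then show "\<chi> (t \<odot>\<^bsub>M\<^esub> x) = t \<odot>\<^bsub>M\<^esub> \<chi> x"
        using M \<chi> mhom_smult[OF r'(4)] mhom_smult[OF mod_hom_mhom[OF phm]] by (intro inj) simp_all
    qed (rule \<chi>)
    then have "restrict \<chi> (carrier M) \<in> mod_hom R M M" by (rule mhom_restrict_mod_hom[OF _ M])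
    then have "restrict \<chi> (carrier M) \<in> ?h ` carrier R" using bij_betw_imp_surj_on[OF bij] by simp
    then obtain t where t: "t \<in> carrier R" "restrict \<chi> (carrier M) = ?h t" by blast
    have "\<chi> m = t \<odot>\<^bsub>M\<^esub> m" if "m \<in> carrier M" for m using fun_cong[OF t(2), of m] t(1) that by simp
    then have "\<phi> = ?e t" using \<chi>(2) mod_hom_arb[OF phm] by (auto simp: fun_eq_iff restrict_def)
    then show "\<phi> \<in> ?e ` carrier (regular_module R)" using t(1) by (intro image_eqI[of _ _ t]) simp_all
  next
    assume "\<phi> \<in> ?e ` carrier (regular_module R)"
    then obtain t where t: "t \<in> carrier R" "\<phi> = ?e t" by auto
    show "?d 0 \<phi> = \<zero>\<^bsub>?K (Suc 0)\<^esub>"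
      unfolding t(2) Hom_simps(2) by (rule restrict_ext) (use t(1) dd(1) M in simp)
  qed
  show "resolution (regular_module R) ?K ?d ?e"
    unfolding resolution_def using regular_module Km dh eh ei e0 exact by blast
qed

text \<open>The lowest nonvanishing degrees agree by \<open>below\<close> and \<open>at\<close>, the
  bounds from above by \<open>sup\<close>. A single nonvanishing degree means that the two ends
  coincide.\<close>

lemma semidualizing_lc_zero_singleton_iff:
  assumes X: "finite X" "X \<subseteq> carrier R" and sd: "semidualizing R M"
  shows "(\<exists>!i. \<not> lc_zero X i M) \<longleftrightarrow> (\<exists>!i. \<not> lc_zero X i (regular_module R))"
proof -
  obtain S where M: "module R M" and S: "finite S" "S \<subseteq> carrier M" "span M S = carrier M"
    using sd by (auto simp: semidualizing_def finitely_generated_module_def span_def)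
  obtain E d e where ch: "chosen_injective_resolution R M = (E, d)" and r: "baer_resolution M E d e"
    by (rule chosen_baer_resolution[OF M])
  note r' = resolutionD[OF baer_resolutionD(1)[OF r]] and dd = resolution_dd(2)[OF baer_resolutionD(1)[OF r]]
  note sr = semidualizing_resolution[OF sd M r ch]
  let ?K = "\<lambda>i. Hom_module R M (E i)" and ?d = "\<lambda>i \<phi>. \<lambda>x\<in>carrier M. d i (\<phi> x)"
  have hM: "lc_zero X i M \<longleftrightarrow> torsion_exact X E d i" for i by (rule lc_zero_iff_torsion_exact[OF X(2) r])
  have hR: "lc_zero X i (regular_module R) \<longleftrightarrow> torsion_exact X ?K ?d i" for i
    by (rule lc_zero_acyclic_resolution[OF X(2) sr(1) lc_zero_Hom[OF X M S baer_resolutionD(2)[OF r]]])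
  have below: "lc_zero X i (regular_module R)" if "\<And>i. i < g \<Longrightarrow> lc_zero X i M" "i < g" for i g
    using torsion_exact_Hom_below[where E=E and d=d, OF X M S sr(2) baer_resolutionD(2)[OF r] r'(3) dd, of g i] that unfolding hM hR by blast
  have at: "\<not> lc_zero X g (regular_module R)" if "\<And>i. i < g \<Longrightarrow> lc_zero X i M" "\<not> lc_zero X g M" for g
    using torsion_exact_Hom_at[where E=E and d=d, OF X M S sr(2) baer_resolutionD(2)[OF r] r'(3) dd, of g] that unfolding hM hR by blast
  have sup: "(\<forall>i>n. lc_zero X i M) \<longleftrightarrow> (\<forall>i>n. lc_zero X i (regular_module R))" for n
    by (rule lc_zero_sup_eq[OF X M S sr(2)])
  show ?thesis
  proof
    assume "\<exists>!i. \<not> lc_zero X i M"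
    then obtain n where n: "\<not> lc_zero X n M" "\<And>i. i \<noteq> n \<Longrightarrow> lc_zero X i M" by blast
    have "\<not> lc_zero X n (regular_module R)" using n by (intro at) auto
    moreover have "lc_zero X i (regular_module R)" if "i \<noteq> n" for i
      using below[of n i] sup[of n] n(2) that by (cases "i < n") auto
    ultimately show "\<exists>!i. \<not> lc_zero X i (regular_module R)" by (intro ex1I[of _ n]) auto
  next
    assume "\<exists>!i. \<not> lc_zero X i (regular_module R)"
    then obtain n where n: "\<not> lc_zero X n (regular_module R)" "\<And>i. i \<noteq> n \<Longrightarrow> lc_zero X i (regular_module R)" by blast
    have above: "lc_zero X i M" if "n < i" for i using sup[of n] n(2) that by auto
    \<comment> \<open>If the cohomology of \<open>M\<close> vanished in all degrees up to
      \<open>n\<close>, then \<open>below\<close> with bound \<open>n + 1\<close> would make that of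
      \<open>R\<close> vanish in degree \<open>n\<close>.\<close>
    have "\<exists>g. \<not> lc_zero X g M" using below[of "Suc n" n] n(1) by blast
    define g where "g = (LEAST g. \<not> lc_zero X g M)"
    have g: "\<not> lc_zero X g M" unfolding g_def by (rule LeastI_ex) fact
    have g': "lc_zero X i M" if "i < g" for i using not_less_Least[of i "\<lambda>g. \<not> lc_zero X g M"] that unfolding g_def by blast
    have "g = n" using at[OF g' g] n(2) by blast
    then have "\<not> lc_zero X n M" "\<And>i. i \<noteq> n \<Longrightarrow> lc_zero X i M" using g g' above by (auto simp: linorder_neq_iff)
    then show "\<exists>!i. \<not> lc_zero X i M" by (intro ex1I[of _ n]) auto
  qed
qed

lemma regular_module_finitely_generated: "finitely_generated_module R (regular_module R)"
proof -
  have "span (regular_module R) {\<one>} = carrier R"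
    using span_regular_eq_genideal[of "{\<one>}"] genideal_one by simp
  then show ?thesis using regular_module
    by (auto simp: finitely_generated_module_def span_def intro!: exI[of _ "{\<one>}"])
qed

end

theorem corollary3p4:
  fixes R :: "('a, 'r) ring_scheme" and \<aa> :: "'a set" and M :: "('a, 'b, 'm) module_scheme"
  assumes "cring R" and "noetherian_ring R"
    and "ideal \<aa> R" and "\<aa> \<noteq> carrier R"
    and "semidualizing R M"
  shows "relative_Cohen_Macaulay R \<aa> M \<longleftrightarrow> relative_Cohen_Macaulay R \<aa> (regular_module R)"
proof -
  interpret noeth_cring R using assms(1,2) by (rule noeth_cring.intro)
  \<comment> \<open>A finite generating set gives access to the statements about
    \<open>torsion X\<close>.\<close>
  obtain X where X: "X \<subseteq> carrier R" "finite X" "\<aa> = Idl\<^bsub>R\<^esub> X" using finetely_gen[OF assms(3)] by blast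
  have M: "finitely_generated_module R M" using assms(5) by (simp add: semidualizing_def)
  then have Mm: "module R M" by (simp add: finitely_generated_module_def)
  show ?thesis
    unfolding relative_Cohen_Macaulay_def X(3) local_cohomology_zero_iff[OF X(1) Mm]
      local_cohomology_zero_iff[OF X(1) regular_module]
    using semidualizing_lc_zero_singleton_iff[OF X(2,1) assms(5)] M regular_module_finitely_generated by simp
qed

end
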